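(* Let $G$ be a locally compact amenable group, let $\{F_n\}_{n\in\mathbb{N}}$ be a tempered F\o lner sequence of $G$, and let $(X,\mathcal{B}_X,\mu,G)$ be a measure-preserving system. Then the following are equivalent: (1) $\mu$ has discrete spectrum; (2) $\mu$ is mean equicontinuous along $\{F_n\}_{n\in\mathbb{N}}$; (3) $\mu$ is equicontinuous in the mean along $\{F_n\}_{n\in\mathbb{N}}$.
   Context: A locally compact group action is a pair $(X,G)$ where $X$ is a compact metric space with metric $d$ and $G$ is a locally compact group acting continuously on $X$. A measure-preserving system is a quadruple $(X,\mathcal{B}_X,\mu,G)$, where $(X,G)$ is a locally compact group action, $\mathcal{B}_X$ is the Borel $\sigma$-algebra of $X$ and $\mu$ is a $G$-invariant Borel probability measure on $X$. Let $m_G$ be a left Haar measure on $G$. A (left) F\o lner sequence of $G$ is a sequence $\{F_n\}_{n\in\mathbb{N}}$ of non-empty compact subsets of $G$ with $0<m_G(F_n)<\infty$ for all $n$ and $\lim_{n\to\infty}\frac{m_G(gF_n\triangle F_n)}{m_G(F_n)}=0$ for all $g\in G$, where $\triangle$ is the symmetric difference. The locally compact group $G$ is called amenable if it admits a F\o lner sequence in this sense. A F\o lner sequence $\{F_n\}_{n\in\mathbb{N}}$ is tempered if there is a constant $C>0$, independent of $n$, such that $m_G\big(\bigcup_{k<n}F_k^{-1}F_n\big)\le C\,m_G(F_n)$ for every $n\in\mathbb{N}$. For $f\in C(X)$ and $g\in G$ put $(gf)(x)=f(gx)$ for $x\in X$. A Borel probability measure $\mu$ on $X$ has discrete spectrum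 if for every $f\in C(X)$ the set $\{gf: g\in G\}$ is precompact in $L^2(\mu)$. For $x,y\in X$ put $d_{m_G|_{F_n}}(x,y)=\frac{1}{m_G(F_n)}\int_{F_n}d(gx,gy)\,dm_G(g)$. A subset $Q\subseteq X$ is mean equicontinuous along $\{F_n\}$ if for every $\epsilon>0$ there is $\delta>0$ such that $x,y\in Q$ and $d(x,y)<\delta$ imply $\limsup_{n\to\infty}d_{m_G|_{F_n}}(x,y)<\epsilon$. A subset $Q\subseteq X$ is equicontinuous in the mean along $\{F_n\}$ if for every $\epsilon>0$ there is $\delta>0$ such that $x,y\in Q$ and $d(x,y)<\delta$ imply $d_{m_G|_{F_n}}(x,y)<\epsilon$ for all $n\in\mathbb{N}$. The measure $\mu$ is mean equicontinuous along $\{F_n\}$ (respectively, equicontinuous in the mean along $\{F_n\}$) if for every $\tau>0$ there is a compact subset $Q\subseteq X$ with $\mu(Q)>1-\tau$ such that $Q$ is mean equicontinuous along $\{F_n\}$ (respectively, equicontinuous in the mean along $\{F_n\}$). *)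

theory Defs
  imports "HOL-Analysis.Analysis"
begin

text \<open>
  Groups are written additively: the class \<open>topological_group_add\<close> extends \<open>group_add\<close>, which does
  not assume commutativity. Thus \<open>g + h\<close>, \<open>- g\<close>, \<open>0\<close> stand for \<open>gh\<close>, \<open>g\<inverse>\<close>, \<open>e\<close>, the left
  translate \<open>gA\<close> is \<open>(+) g ` A\<close>, and \<open>A\<inverse>B\<close> is \<open>{- a + b | a b. a \<in> A \<and> b \<in> B}\<close>. Locally compact
  groups are understood to be Hausdorff.
\<close>

section \<open>Haar measure, Folner sequences, amenability\<close>

text \<open>
  A left Haar measure is a nonzero left-invariant Radon measure on the Borel sets: finite on compact
  sets, outer regular on Borel sets, inner regular on open sets.
\<close>
definition left_haar_measure :: "'g::{topological_group_add, t2_space} measure \<Rightarrow> bool" where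
  "left_haar_measure m \<longleftrightarrow>
     sets m = sets borel \<and>
     emeasure m UNIV \<noteq> 0 \<and>
     (\<forall>g. \<forall>A\<in>sets borel. emeasure m ((+) g ` A) = emeasure m A) \<and>
     (\<forall>K. compact K \<longrightarrow> emeasure m K < \<infinity>) \<and>
     (\<forall>A\<in>sets borel. emeasure m A = (INF U\<in>{U. open U \<and> A \<subseteq> U}. emeasure m U)) \<and>
     (\<forall>U. open U \<longrightarrow> emeasure m U = (SUP K\<in>{K. compact K \<and> K \<subseteq> U}. emeasure m K))"

definition folner_sequence ::
    "'g::{topological_group_add, t2_space} measure \<Rightarrow> (nat \<Rightarrow> 'g set) \<Rightarrow> bool" where
  "folner_sequence m F \<longleftrightarrow>
     (\<forall>n. F n \<noteq> {} \<and> compact (F n) \<and> 0 < emeasure m (F n) \<and> emeasure m (F n) < \<infinity>) \<and>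
     (\<forall>g. (\<lambda>n. measure m (sym_diff ((+) g ` F n) (F n)) / measure m (F n)) \<longlonglongrightarrow> 0)"

definition amenable_group :: "'g::{topological_group_add, t2_space} itself \<Rightarrow> bool" where
  "amenable_group _ \<longleftrightarrow> (\<exists>(m :: 'g measure) F. left_haar_measure m \<and> folner_sequence m F)"

definition tempered ::
    "'g::{topological_group_add, t2_space} measure \<Rightarrow> (nat \<Rightarrow> 'g set) \<Rightarrow> bool" where
  "tempered m F \<longleftrightarrow>
     (\<exists>C>0. \<forall>n. emeasure m (\<Union>k<n. {- a + b | a b. a \<in> F k \<and> b \<in> F n})
                  \<le> ennreal C * emeasure m (F n))"

section \<open>Actions and measure-preserving systems\<close>

definition locally_compact_group_action ::
    "('g::{topological_group_add, t2_space} \<Rightarrow> 'x::metric_space \<Rightarrow> 'x) \<Rightarrow> bool" where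
  "locally_compact_group_action act \<longleftrightarrow>
     compact (UNIV :: 'x set) \<and>
     locally_compact_space (euclidean :: 'g topology) \<and>
     (\<forall>x. act 0 x = x) \<and>
     (\<forall>g h x. act (g + h) x = act g (act h x)) \<and>
     continuous_on UNIV (\<lambda>(g, x). act g x)"

definition borel_probability :: "'x::topological_space measure \<Rightarrow> bool" where
  "borel_probability \<mu> \<longleftrightarrow> sets \<mu> = sets borel \<and> emeasure \<mu> UNIV = 1"

definition measure_preserving_system ::
    "('g::{topological_group_add, t2_space} \<Rightarrow> 'x::metric_space \<Rightarrow> 'x) \<Rightarrow> 'x measure \<Rightarrow> bool" where
  "measure_preserving_system act \<mu> \<longleftrightarrow>
     locally_compact_group_action act \<and>
     borel_probability \<mu> \<and>
     (\<forall>g. \<forall>A\<in>sets borel. emeasure \<mu> (act g -` A) = emeasure \<mu> A)"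

section \<open>The metric space \<open>L\<^sup>2(\<mu>)\<close>\<close>

definition square_integrable :: "'x measure \<Rightarrow> ('x \<Rightarrow> complex) set" where
  "square_integrable \<mu> =
     {f \<in> borel_measurable \<mu>. integrable \<mu> (\<lambda>x. (cmod (f x))\<^sup>2)}"

definition L2_rel :: "'x measure \<Rightarrow> (('x \<Rightarrow> complex) \<times> ('x \<Rightarrow> complex)) set" where
  "L2_rel \<mu> = {(f, g). f \<in> square_integrable \<mu> \<and> g \<in> square_integrable \<mu> \<and> (AE x in \<mu>. f x = g x)}"

definition L2_space :: "'x measure \<Rightarrow> ('x \<Rightarrow> complex) set set" where
  "L2_space \<mu> = square_integrable \<mu> // L2_rel \<mu>"

definition L2_class :: "'x measure \<Rightarrow> ('x \<Rightarrow> complex) \<Rightarrow> ('x \<Rightarrow> complex) set" where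
  "L2_class \<mu> f = L2_rel \<mu> `` {f}"

text \<open>The choice of representatives is immaterial; see \<open>L2_dist_class\<close> below.\<close>
definition L2_dist :: "'x measure \<Rightarrow> ('x \<Rightarrow> complex) set \<Rightarrow> ('x \<Rightarrow> complex) set \<Rightarrow> real" where
  "L2_dist \<mu> A B = sqrt (LINT x|\<mu>. (cmod ((SOME f. f \<in> A) x - (SOME g. g \<in> B) x))\<^sup>2)"

lemma equiv_L2_rel: "equiv (square_integrable \<mu>) (L2_rel \<mu>)"
proof (rule equivI)
  show "refl_on (square_integrable \<mu>) (L2_rel \<mu>)"
    by (auto simp: refl_on_def L2_rel_def)
  show "L2_rel \<mu> \<subseteq> square_integrable \<mu> \<times> square_integrable \<mu>"
    by (auto simp: L2_rel_def)
  show "sym (L2_rel \<mu>)"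
  proof (rule symI)
    fix f g assume "(f, g) \<in> L2_rel \<mu>"
    then have "f \<in> square_integrable \<mu>" "g \<in> square_integrable \<mu>" "AE x in \<mu>. f x = g x"
      by (simp_all add: L2_rel_def)
    moreover from this(3) have "AE x in \<mu>. g x = f x" by eventually_elim simp
    ultimately show "(g, f) \<in> L2_rel \<mu>" by (simp add: L2_rel_def)
  qed
  show "trans (L2_rel \<mu>)"
  proof (rule transI)
    fix f g h assume "(f, g) \<in> L2_rel \<mu>" "(g, h) \<in> L2_rel \<mu>"
    then have "f \<in> square_integrable \<mu>" "h \<in> square_integrable \<mu>"
      "AE x in \<mu>. f x = g x" "AE x in \<mu>. g x = h x"
      by (simp_all add: L2_rel_def)
    moreover from this(3,4) have "AE x in \<mu>. f x = h x" by eventually_elim simp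
    ultimately show "(f, h) \<in> L2_rel \<mu>" by (simp add: L2_rel_def)
  qed
qed

lemma square_integrable_add:
  assumes "f \<in> square_integrable \<mu>" "g \<in> square_integrable \<mu>"
  shows "(\<lambda>x. f x + g x) \<in> square_integrable \<mu>"
proof -
  have "integrable \<mu> (\<lambda>x. 2 * (cmod (f x))\<^sup>2 + 2 * (cmod (g x))\<^sup>2)"
    using assms by (auto simp: square_integrable_def)
  then have "integrable \<mu> (\<lambda>x. (cmod (f x + g x))\<^sup>2)"
  proof (rule Bochner_Integration.integrable_bound)
    show "(\<lambda>x. (cmod (f x + g x))\<^sup>2) \<in> borel_measurable \<mu>"
      using assms by (auto simp: square_integrable_def)
    have "(cmod (u + v))\<^sup>2 \<le> 2 * (cmod u)\<^sup>2 + 2 * (cmod v)\<^sup>2" for u v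
    proof -
      have "(cmod (u + v))\<^sup>2 \<le> (cmod u + cmod v)\<^sup>2"
        by (intro power_mono norm_triangle_ineq) auto
      also have "\<dots> \<le> 2 * (cmod u)\<^sup>2 + 2 * (cmod v)\<^sup>2"
        using sum_squares_bound[of "cmod u" "cmod v"] by (simp add: power2_sum)
      finally show ?thesis .
    qed
    then show "AE x in \<mu>. norm ((cmod (f x + g x))\<^sup>2) \<le> norm (2 * (cmod (f x))\<^sup>2 + 2 * (cmod (g x))\<^sup>2)"
      by simp
  qed
  then show ?thesis using assms by (auto simp: square_integrable_def)
qed

lemma square_integrable_diff:
  assumes "f \<in> square_integrable \<mu>" "g \<in> square_integrable \<mu>"
  shows "(\<lambda>x. f x - g x) \<in> square_integrable \<mu>"
proof -
  have "(\<lambda>x. - g x) \<in> square_integrable \<mu>"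
    using assms(2) by (auto simp: square_integrable_def)
  from square_integrable_add[OF assms(1) this] show ?thesis by simp
qed

lemma L2_norm_eq_0_iff:
  assumes "f \<in> square_integrable \<mu>"
  shows "(LINT x|\<mu>. (cmod (f x))\<^sup>2) = 0 \<longleftrightarrow> (AE x in \<mu>. f x = 0)"
  using assms by (subst integral_nonneg_eq_0_iff_AE) (auto simp: square_integrable_def)

lemma L2_norm_triangle:
  assumes f: "f \<in> square_integrable \<mu>" and g: "g \<in> square_integrable \<mu>"
  shows "sqrt (LINT x|\<mu>. (cmod (f x + g x))\<^sup>2)
           \<le> sqrt (LINT x|\<mu>. (cmod (f x))\<^sup>2) + sqrt (LINT x|\<mu>. (cmod (g x))\<^sup>2)"
proof -
  define a where "a = sqrt (LINT x|\<mu>. (cmod (f x))\<^sup>2)"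
  define b where "b = sqrt (LINT x|\<mu>. (cmod (g x))\<^sup>2)"
  have ab: "a \<ge> 0" "b \<ge> 0" by (auto simp: a_def b_def)
  have a2: "(LINT x|\<mu>. (cmod (f x))\<^sup>2) = a\<^sup>2" and b2: "(LINT x|\<mu>. (cmod (g x))\<^sup>2) = b\<^sup>2"
    by (auto simp: a_def b_def)
  consider "a = 0" | "b = 0" | "a > 0" "b > 0" using ab by fastforce
  then have "(LINT x|\<mu>. (cmod (f x + g x))\<^sup>2) \<le> (a + b)\<^sup>2"
  proof cases
    case 1
    then have "AE x in \<mu>. f x = 0" using L2_norm_eq_0_iff[OF f] a2 by simp
    then have "AE x in \<mu>. (cmod (f x + g x))\<^sup>2 = (cmod (g x))\<^sup>2" by eventually_elim simp
    then have "(LINT x|\<mu>. (cmod (f x + g x))\<^sup>2) = (LINT x|\<mu>. (cmod (g x))\<^sup>2)"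
      using f g by (intro integral_cong_AE) (auto simp: square_integrable_def)
    then show ?thesis using 1 b2 by simp
  next
    case 2
    then have "AE x in \<mu>. g x = 0" using L2_norm_eq_0_iff[OF g] b2 by simp
    then have "AE x in \<mu>. (cmod (f x + g x))\<^sup>2 = (cmod (f x))\<^sup>2" by eventually_elim simp
    then have "(LINT x|\<mu>. (cmod (f x + g x))\<^sup>2) = (LINT x|\<mu>. (cmod (f x))\<^sup>2)"
      using f g by (intro integral_cong_AE) (auto simp: square_integrable_def)
    then show ?thesis using 2 a2 by simp
  next
    case 3
    have pw: "(cmod (u + v))\<^sup>2 \<le> (1 + b / a) * (cmod u)\<^sup>2 + (1 + a / b) * (cmod v)\<^sup>2" for u v
    proof -
      have "0 \<le> (b * cmod u - a * cmod v)\<^sup>2 / (a * b)" using 3 by simp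
      also have "\<dots> = b / a * (cmod u)\<^sup>2 + a / b * (cmod v)\<^sup>2 - 2 * cmod u * cmod v"
        using 3 by (simp add: field_simps power2_eq_square)
      finally have "(cmod u + cmod v)\<^sup>2 \<le> (1 + b / a) * (cmod u)\<^sup>2 + (1 + a / b) * (cmod v)\<^sup>2"
        by (simp add: power2_sum algebra_simps)
      moreover have "(cmod (u + v))\<^sup>2 \<le> (cmod u + cmod v)\<^sup>2"
        by (intro power_mono norm_triangle_ineq) auto
      ultimately show ?thesis by linarith
    qed
    have "(LINT x|\<mu>. (cmod (f x + g x))\<^sup>2)
            \<le> (LINT x|\<mu>. (1 + b / a) * (cmod (f x))\<^sup>2 + (1 + a / b) * (cmod (g x))\<^sup>2)"
      using f g square_integrable_add[OF f g] pw
      by (intro integral_mono) (auto simp: square_integrable_def)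
    also have "\<dots> = (1 + b / a) * a\<^sup>2 + (1 + a / b) * b\<^sup>2"
      using f g a2 b2 by (simp add: square_integrable_def)
    also have "\<dots> = (a + b)\<^sup>2"
      using 3 by (simp add: field_simps power2_eq_square)
    finally show ?thesis .
  qed
  then have "sqrt (LINT x|\<mu>. (cmod (f x + g x))\<^sup>2) \<le> a + b"
    using ab by (intro real_le_lsqrt) auto
  then show ?thesis by (simp add: a_def b_def)
qed

lemma L2_dist_class:
  assumes f: "f \<in> square_integrable \<mu>" and g: "g \<in> square_integrable \<mu>"
  shows "L2_dist \<mu> (L2_class \<mu> f) (L2_class \<mu> g) = sqrt (LINT x|\<mu>. (cmod (f x - g x))\<^sup>2)"
proof -
  define f' where "f' = (SOME h. h \<in> L2_class \<mu> f)"
  define g' where "g' = (SOME h. h \<in> L2_class \<mu> g)"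
  have "f \<in> L2_class \<mu> f" "g \<in> L2_class \<mu> g"
    using f g by (auto simp: L2_class_def L2_rel_def)
  then have "f' \<in> L2_class \<mu> f" "g' \<in> L2_class \<mu> g"
    unfolding f'_def g'_def by (metis someI)+
  then have fg': "f' \<in> square_integrable \<mu>" "AE x in \<mu>. f x = f' x"
                 "g' \<in> square_integrable \<mu>" "AE x in \<mu>. g x = g' x"
    by (auto simp: L2_class_def L2_rel_def)
  have "AE x in \<mu>. (cmod (f' x - g' x))\<^sup>2 = (cmod (f x - g x))\<^sup>2"
    using fg'(2,4) by eventually_elim simp
  then have "(LINT x|\<mu>. (cmod (f' x - g' x))\<^sup>2) = (LINT x|\<mu>. (cmod (f x - g x))\<^sup>2)"
    using f g fg' by (intro integral_cong_AE) (auto simp: square_integrable_def)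
  then show ?thesis by (simp add: L2_dist_def f'_def g'_def)
qed

lemma L2_space_cases:
  assumes "A \<in> L2_space \<mu>"
  obtains f where "f \<in> square_integrable \<mu>" "A = L2_class \<mu> f"
  using assms by (auto simp: L2_space_def L2_class_def quotient_def)

lemma L2_class_in_L2_space: "f \<in> square_integrable \<mu> \<Longrightarrow> L2_class \<mu> f \<in> L2_space \<mu>"
  by (auto simp: L2_space_def L2_class_def quotient_def)

lemma Metric_space_L2: "Metric_space (L2_space \<mu>) (L2_dist \<mu>)"
proof
  show "0 \<le> L2_dist \<mu> A B" for A B by (simp add: L2_dist_def)
  show "L2_dist \<mu> A B = L2_dist \<mu> B A" for A B by (simp add: L2_dist_def norm_minus_commute)
next
  fix A B assume "A \<in> L2_space \<mu>" "B \<in> L2_space \<mu>"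
  then obtain f g where f: "f \<in> square_integrable \<mu>" "A = L2_class \<mu> f"
    and g: "g \<in> square_integrable \<mu>" "B = L2_class \<mu> g" by (metis L2_space_cases)
  have "L2_dist \<mu> A B = 0 \<longleftrightarrow> (AE x in \<mu>. f x = g x)"
    using f g L2_norm_eq_0_iff[OF square_integrable_diff[OF f(1) g(1)]]
    by (simp add: L2_dist_class)
  also have "\<dots> \<longleftrightarrow> A = B"
    using f g eq_equiv_class_iff[OF equiv_L2_rel f(1) g(1)]
    by (simp add: L2_class_def L2_rel_def)
  finally show "L2_dist \<mu> A B = 0 \<longleftrightarrow> A = B" .
next
  fix A B C assume "A \<in> L2_space \<mu>" "B \<in> L2_space \<mu>" "C \<in> L2_space \<mu>"
  then obtain f g h where f: "f \<in> square_integrable \<mu>" "A = L2_class \<mu> f"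
    and g: "g \<in> square_integrable \<mu>" "B = L2_class \<mu> g"
    and h: "h \<in> square_integrable \<mu>" "C = L2_class \<mu> h" by (metis L2_space_cases)
  show "L2_dist \<mu> A C \<le> L2_dist \<mu> A B + L2_dist \<mu> B C"
    using L2_norm_triangle[OF square_integrable_diff[OF f(1) g(1)] square_integrable_diff[OF g(1) h(1)]]
      f g h by (simp add: L2_dist_class)
qed

definition L2_topology :: "'x measure \<Rightarrow> ('x \<Rightarrow> complex) set topology" where
  "L2_topology \<mu> = Metric_space.mtopology (L2_space \<mu>) (L2_dist \<mu>)"

section \<open>Discrete spectrum and mean equicontinuity\<close>

definition precompactin :: "'a topology \<Rightarrow> 'a set \<Rightarrow> bool" where
  "precompactin T S \<longleftrightarrow> S \<subseteq> topspace T \<and> compactin T (T closure_of S)"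

text \<open>\<open>C(X)\<close> consists of the complex-valued continuous functions.\<close>
definition discrete_spectrum ::
    "('g \<Rightarrow> 'x::topological_space \<Rightarrow> 'x) \<Rightarrow> 'x measure \<Rightarrow> bool" where
  "discrete_spectrum act \<mu> \<longleftrightarrow>
     (\<forall>f :: 'x \<Rightarrow> complex. continuous_on UNIV f \<longrightarrow>
        precompactin (L2_topology \<mu>) {L2_class \<mu> (\<lambda>x. f (act g x)) | g. True})"

definition mean_dist ::
    "('g \<Rightarrow> 'x::metric_space \<Rightarrow> 'x) \<Rightarrow> 'g measure \<Rightarrow> 'g set \<Rightarrow> 'x \<Rightarrow> 'x \<Rightarrow> real" where
  "mean_dist act m A x y = 1 / measure m A * (LINT g:A|m. dist (act g x) (act g y))"

definition mean_equicontinuous_on ::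
    "('g \<Rightarrow> 'x::metric_space \<Rightarrow> 'x) \<Rightarrow> 'g measure \<Rightarrow> (nat \<Rightarrow> 'g set) \<Rightarrow> 'x set \<Rightarrow> bool" where
  "mean_equicontinuous_on act m F Q \<longleftrightarrow>
     (\<forall>\<epsilon>>0. \<exists>\<delta>>0. \<forall>x\<in>Q. \<forall>y\<in>Q. dist x y < \<delta> \<longrightarrow>
        limsup (\<lambda>n. ereal (mean_dist act m (F n) x y)) < ereal \<epsilon>)"

definition equicontinuous_in_mean_on ::
    "('g \<Rightarrow> 'x::metric_space \<Rightarrow> 'x) \<Rightarrow> 'g measure \<Rightarrow> (nat \<Rightarrow> 'g set) \<Rightarrow> 'x set \<Rightarrow> bool" where
  "equicontinuous_in_mean_on act m F Q \<longleftrightarrow>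
     (\<forall>\<epsilon>>0. \<exists>\<delta>>0. \<forall>x\<in>Q. \<forall>y\<in>Q. dist x y < \<delta> \<longrightarrow>
        (\<forall>n. mean_dist act m (F n) x y < \<epsilon>))"

definition mean_equicontinuous_measure ::
    "('g \<Rightarrow> 'x::metric_space \<Rightarrow> 'x) \<Rightarrow> 'g measure \<Rightarrow> (nat \<Rightarrow> 'g set) \<Rightarrow> 'x measure \<Rightarrow> bool" where
  "mean_equicontinuous_measure act m F \<mu> \<longleftrightarrow>
     (\<forall>\<tau>>0. \<exists>Q. compact Q \<and> measure \<mu> Q > 1 - \<tau> \<and> mean_equicontinuous_on act m F Q)"

definition equicontinuous_in_mean_measure ::
    "('g \<Rightarrow> 'x::metric_space \<Rightarrow> 'x) \<Rightarrow> 'g measure \<Rightarrow> (nat \<Rightarrow> 'g set) \<Rightarrow> 'x measure \<Rightarrow> bool" where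
  "equicontinuous_in_mean_measure act m F \<mu> \<longleftrightarrow>
     (\<forall>\<tau>>0. \<exists>Q. compact Q \<and> measure \<mu> Q > 1 - \<tau> \<and> equicontinuous_in_mean_on act m F Q)"

end

theory Submission
  imports Defs
begin

text \<open>
  If \<open>\<mu>\<close> is mean equicontinuous, then for most \<open>h \<in> F n\<close> the function \<open>f \<circ> act h\<close> is \<open>L\<^sup>2\<close>-close to a step
  function on one fixed finite partition of \<open>X\<close>, and such step functions form a precompact set. Since
  \<open>act h\<close> preserves \<open>\<mu>\<close>, a long \<open>\<epsilon>\<close>-separated family \<open>f \<circ> act t\<close> would give an equally long
  \<open>\<epsilon>\<close>-separated family \<open>f \<circ> act (t + h)\<close> for every \<open>h\<close>, and by the Folner property some \<open>h\<close> makes half of its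
  members close to step functions.

  Conversely, the element \<open>K\<close> of minimal \<open>L\<^sup>2\<close>-norm in the closed convex hull of the orbit of \<open>f \<otimes> f\<close> is a
  kernel with \<open>K (gx, gy) = K (x, y)\<close>, and discrete spectrum makes \<open>f\<close> a limit of functions
  \<open>\<phi> = \<integral>K (\<cdot>, y) \<psi> y dy\<close>. Invariance gives \<open>\<phi> (gx) - \<phi> (gx') = \<integral>(K (x, y) - K (x', y)) \<psi> (gy) dy\<close>, which is
  small uniformly in \<open>g\<close> off a small set, because \<open>K\<close> is an \<open>L\<^sup>1\<close>-limit of continuous kernels. The averages of
  \<open>\<bar>f - \<phi>\<bar>\<close> over all \<open>F n\<close> are controlled at once by a maximal inequality, the only place where temperedness
  enters. Applying this to the distance functions to a dense sequence of points yields equicontinuity in the mean.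
\<close>

section \<open>Borel sets and measurable maps on a compact metric space\<close>

text \<open>Nearly every estimate exchanges an integral over \<open>G\<close> with one over
  \<open>X\<close>, although \<open>G\<close> need not be second countable and is not assumed
  sigma-compact. Sigma-finiteness of \<open>m\<close> is therefore extracted from the Folner
  sequence, and joint measurability of the action from compactness of \<open>X\<close>.

  The implications are proved in the cycle (1), (3), (2), (1). A maximal inequality treats all
  \<open>n\<close> at once, so (3) comes directly, without a limit of averages and a separate
  treatment of small \<open>n\<close>.

  An invariant kernel exists for every system but may carry no information: it can be constant.
  Discrete spectrum enters as a finite net of the orbit of \<open>f\<close>, which bounds the
  quadratic form of every kernel in the hull from below. This bound is affine in the kernel, so it
  survives convex combinations and limits. Least squares then shows that \<open>f\<close> is a limit
  of functions in the range of the integral operator, which replaces the expansion into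
  eigenfunctions.\<close>

lemma finite_measurable_net:
  fixes Q :: "'x::metric_space set"
  assumes "compact Q" "Q \<noteq> {}" "e > 0"
  obtains p :: "'x \<Rightarrow> 'x" where "p \<in> measurable borel (count_space UNIV)" "finite (range p)"
    "range p \<subseteq> Q" "\<And>x. x \<in> Q \<Longrightarrow> dist x (p x) < e"
proof -
  obtain k where k: "finite k" "k \<subseteq> Q" "Q \<subseteq> (\<Union>x\<in>k. ball x e)"
    using seq_compact_imp_totally_bounded[OF compact_imp_seq_compact[OF assms(1)], rule_format, OF assms(3)]
    by (elim exE conjE)
  then have "k \<noteq> {}" using assms by auto
  then have rk: "range (from_nat_into k) = k"
    using k(1) by (simp add: countable_finite range_from_nat_into)
  \<comment> \<open>The first center of the enumeration within \<open>e\<close> is taken, which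
    keeps the fibres measurable. Where no center is near, \<open>LEAST\<close> is unspecified, but
    \<open>from_nat_into k\<close> sends every index into \<open>k\<close>, so \<open>p\<close> maps
    the whole space into \<open>Q\<close>.\<close>
  define p where "p x = from_nat_into k (LEAST i. dist x (from_nat_into k i) < e)" for x
  have [measurable]: "(\<lambda>x::'x. dist x c) \<in> borel_measurable borel" for c
    by (intro borel_measurable_continuous_onI continuous_intros)
  have "(\<lambda>x::'x. LEAST i. dist x (from_nat_into k i) < e) \<in> measurable borel (count_space UNIV)"
    by measurable
  then have "(from_nat_into k \<circ> (\<lambda>x::'x. LEAST i. dist x (from_nat_into k i) < e))
      \<in> measurable borel (count_space UNIV)"
    by (rule measurable_comp) simp
  then have "p \<in> measurable borel (count_space UNIV)"
    by (simp add: p_def[abs_def] comp_def)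
  moreover have rp: "range p \<subseteq> k" using rk by (auto simp: p_def)
  moreover have "dist x (p x) < e" if "x \<in> Q" for x
  proof -
    have "x \<in> (\<Union>x\<in>k. ball x e)" using k(3) that by blast
    then obtain c where "c \<in> k" "dist c x < e" by auto
    then obtain i where "dist x (from_nat_into k i) < e" using rk by (metis dist_commute rangeE)
    then show ?thesis unfolding p_def by (rule LeastI)
  qed
  ultimately show ?thesis using that k(1,2) by (meson finite_subset order_trans)
qed

text \<open>
  A replacement for the library rules about \<open>borel \<Otimes>\<^sub>M borel\<close>, which need the class
  \<open>second_countable_topology\<close>; here separability comes from compactness.
\<close>
lemma borel_measurable_Caratheodory:
  fixes \<phi> :: "'a \<Rightarrow> 'x::metric_space \<Rightarrow> 'y::metric_space"
  assumes cpt: "compact (UNIV :: 'x set)"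
    and meas: "\<And>x. (\<lambda>w. \<phi> w x) \<in> borel_measurable M"
    and cont: "\<And>w. continuous_on UNIV (\<phi> w)"
  shows "(\<lambda>(w, x). \<phi> w x) \<in> borel_measurable (M \<Otimes>\<^sub>M borel)"
proof -
  have "\<exists>p :: 'x \<Rightarrow> 'x. p \<in> measurable borel (count_space UNIV) \<and> finite (range p) \<and>
      (\<forall>x. dist x (p x) < inverse (real (Suc n)))" for n
    by (rule finite_measurable_net[OF cpt, of "inverse (real (Suc n))"]) auto
  then obtain p where p: "\<And>n. p n \<in> measurable borel (count_space UNIV)" "\<And>n. finite (range (p n))"
    "\<And>n (x::'x). dist x (p n x) < inverse (real (Suc n))"
    by metis
  show ?thesis
  proof (rule borel_measurable_LIMSEQ_metric)
    fix n
    show "(\<lambda>z. \<phi> (fst z) (p n (snd z))) \<in> borel_measurable (M \<Otimes>\<^sub>M borel)"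
    proof (rule measurable_compose_countable'[where I = "range (p n)"
          and f = "\<lambda>i z. \<phi> (fst z) i" and g = "\<lambda>z. p n (snd z)"])
      show "(\<lambda>z. \<phi> (fst z) i) \<in> borel_measurable (M \<Otimes>\<^sub>M borel)" for i
        by (rule measurable_compose[OF measurable_fst meas])
      have "p n \<in> measurable borel (count_space (range (p n)))"
        using p(1)[of n] p(2)[of n] by (auto simp: measurable_count_space_eq2 measurable_def)
      then show "(\<lambda>z. p n (snd z)) \<in> measurable (M \<Otimes>\<^sub>M borel) (count_space (range (p n)))"
        by (rule measurable_compose[OF measurable_snd])
      show "countable (range (p n))" using p(2) by (simp add: countable_finite)
    qed
  next
    fix z :: "'a \<times> 'x"
    have "(\<lambda>n. dist (p n (snd z)) (snd z)) \<longlonglongrightarrow> 0"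
      by (rule Lim_null_comparison[OF _ LIMSEQ_inverse_real_of_nat])
        (use p(3)[of "snd z"] in \<open>auto simp: dist_commute less_imp_le\<close>)
    then have "(\<lambda>n. p n (snd z)) \<longlonglongrightarrow> snd z" by (rule iffD2[OF tendsto_dist_iff])
    then have "(\<lambda>n. \<phi> (fst z) (p n (snd z))) \<longlonglongrightarrow> \<phi> (fst z) (snd z)"
      by (intro continuous_on_tendsto_compose[OF cont]) auto
    then show "(\<lambda>n. \<phi> (fst z) (p n (snd z))) \<longlonglongrightarrow> (case z of (w, x) \<Rightarrow> \<phi> w x)"
      by (simp add: case_prod_beta)
  qed
qed

text \<open>The induction over the sigma-algebra carries an inner and an outer approximation
  together, because complementation exchanges them. It starts from closed sets, which in a metric
  space are decreasing intersections of open neighbourhoods.\<close>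

lemma finite_borel_measure_closed_open_approx:
  fixes \<mu> :: "'x::metric_space measure"
  assumes fin: "finite_measure \<mu>" and sets: "sets \<mu> = sets borel"
    and B: "B \<in> sets borel" and "e > 0"
  shows "\<exists>C U. closed C \<and> open U \<and> C \<subseteq> B \<and> B \<subseteq> U \<and> measure \<mu> (U - C) < e"
proof -
  interpret finite_measure \<mu> by fact
  have sp: "space \<mu> = UNIV" using sets_eq_imp_space_eq[OF sets] by simp
  have [simp, measurable]: "open A \<Longrightarrow> A \<in> sets \<mu>" "closed A \<Longrightarrow> A \<in> sets \<mu>" for A
    by (auto simp: sets)
  define P where "P B \<longleftrightarrow> (\<forall>e>0. \<exists>C U. closed C \<and> open U \<and> C \<subseteq> B \<and> B \<subseteq> U \<and> measure \<mu> (U - C) < e)" for B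
  have P_D: "\<exists>C U. closed C \<and> open U \<and> C \<subseteq> A \<and> A \<subseteq> U \<and> measure \<mu> (U - C) < e" if "P A" "e > 0" for A e
    using that unfolding P_def by simp
  have P_empty: "P {}" unfolding P_def
  proof (intro allI impI)
    fix e :: real assume "e > 0"
    then show "\<exists>C U. closed C \<and> open U \<and> C \<subseteq> {} \<and> {} \<subseteq> U \<and> measure \<mu> (U - C) < e"
      by (intro exI[of _ "{}"]) simp
  qed
  have "B \<in> sigma_sets UNIV (Collect closed)"
    using B by (simp add: borel_eq_closed)
  then have "P B"
  proof induction
    case (Basic A)
    then have A: "closed A" by simp
    show ?case unfolding P_def
    proof (intro allI impI)
      fix e :: real assume e: "e > 0"
      show "\<exists>C U. closed C \<and> open U \<and> C \<subseteq> A \<and> A \<subseteq> U \<and> measure \<mu> (U - C) < e"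
      proof (cases "A = {}")
        \<comment> \<open>\<open>infdist x {}\<close> is \<open>0\<close> by convention, so the
          neighbourhoods used in the other case would all be the whole space.\<close>
        case True
        then show ?thesis using e by (intro exI[of _ "{}"]) auto
      next
        case False
        define U where "U n = {x. infdist x A < inverse (real (Suc n))}" for n
        have U: "open (U n)" for n
          unfolding U_def by (intro open_Collect_less continuous_intros)
        have "decseq U"
        proof (rule decseq_SucI)
          fix n
          have "inverse (real (Suc (Suc n))) \<le> inverse (real (Suc n))"
            by (intro le_imp_inverse_le) auto
          then show "U (Suc n) \<subseteq> U n" unfolding U_def by (metis (no_types, lifting) Collect_mono less_le_trans)
        qed
        moreover have "(\<Inter>n. U n) = A"
        proof
          show "(\<Inter>n. U n) \<subseteq> A"
          proof
            fix x assume x: "x \<in> (\<Inter>n. U n)"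
            have "infdist x A \<le> 0"
            proof (rule LIMSEQ_le_const[OF LIMSEQ_inverse_real_of_nat])
              show "\<exists>N. \<forall>n\<ge>N. infdist x A \<le> inverse (real (Suc n))"
                using x by (auto simp: U_def less_imp_le)
            qed
            then show "x \<in> A"
              using in_closed_iff_infdist_zero[OF A False] infdist_nonneg[of x A] by simp
          qed
          show "A \<subseteq> (\<Inter>n. U n)"
          proof
            fix x assume "x \<in> A"
            then have "infdist x A = 0" by simp
            then show "x \<in> (\<Inter>n. U n)" unfolding U_def by simp
          qed
        qed
        ultimately have "(\<lambda>n. measure \<mu> (U n)) \<longlonglongrightarrow> measure \<mu> A"
          using finite_Lim_measure_decseq[of U] U by (auto simp: image_subset_iff)
        then have "eventually (\<lambda>n. measure \<mu> (U n) < measure \<mu> A + e) sequentially"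
          using e by (intro order_tendstoD(2)) auto
        then obtain n where n: "measure \<mu> (U n) < measure \<mu> A + e"
          by (meson eventually_sequentially order_refl)
        have "A \<subseteq> U n" using \<open>(\<Inter>n. U n) = A\<close> by auto
        then have "measure \<mu> (U n - A) < e"
          using n A U by (subst finite_measure_Diff) auto
        then show ?thesis using A U[of n] \<open>A \<subseteq> U n\<close>
          by (intro exI[of _ A] exI[of _ "U n"] conjI) auto
      qed
    qed
  next
    case Empty
    show ?case by (rule P_empty)
  next
    case (Compl A)
    show ?case unfolding P_def
    proof (intro allI impI)
      fix e :: real assume "e > 0"
      then obtain C U where CU: "closed C" "open U" "C \<subseteq> A" "A \<subseteq> U" "measure \<mu> (U - C) < e"
        using P_D[OF Compl.IH] by metis
      have "- C - (- U) = U - C" by auto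
      then show "\<exists>C U. closed C \<and> open U \<and> C \<subseteq> UNIV - A \<and> UNIV - A \<subseteq> U \<and> measure \<mu> (U - C) < e"
        using CU by (intro exI[of _ "- U"] exI[of _ "- C"]) auto
    qed
  next
    case (Union A)
    show ?case unfolding P_def
    proof (intro allI impI)
      fix e :: real assume e: "e > 0"
      \<comment> \<open>Summed over \<open>i\<close>, these tolerances give \<open>e / 2\<close>. A
        countable union of closed sets need not be closed, so the inner set is cut off at
        \<open>i \<le> n\<close>, which costs another \<open>e / 4\<close>.\<close>
      have "\<exists>C U. closed C \<and> open U \<and> C \<subseteq> A i \<and> A i \<subseteq> U \<and> measure \<mu> (U - C) < e / 4 * (1/2)^i" for i
      proof -
        have "e / 4 * (1/2)^i > 0" using e by simp
        then show ?thesis by (rule P_D[OF Union.IH])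
      qed
      then obtain C U where CU: "\<And>i. closed (C i)" "\<And>i. open (U i)" "\<And>i. C i \<subseteq> A i" "\<And>i. A i \<subseteq> U i"
        "\<And>i. measure \<mu> (U i - C i) < e / 4 * (1/2)^i"
        by metis
      have mC: "(\<lambda>n. measure \<mu> (\<Union>i\<le>n. C i)) \<longlonglongrightarrow> measure \<mu> (\<Union>n. \<Union>i\<le>n. C i)"
        using CU(1) by (intro finite_Lim_measure_incseq)
          (auto simp: incseq_def intro: order_trans)
      have eq: "(\<Union>n. \<Union>i\<le>n. C i) = (\<Union>i. C i)" by auto
      have "eventually (\<lambda>n. measure \<mu> (\<Union>i. C i) - e / 4 < measure \<mu> (\<Union>i\<le>n. C i)) sequentially"
        using mC e unfolding eq by (intro order_tendstoD(1)) auto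
      then obtain n where n: "measure \<mu> (\<Union>i. C i) - e / 4 < measure \<mu> (\<Union>i\<le>n. C i)"
        by (meson eventually_sequentially order_refl)
      have sm: "summable (\<lambda>i. e / 4 * (1/2::real)^i)" by (intro summable_mult summable_geometric) auto
      have smm: "summable (\<lambda>i. measure \<mu> (U i - C i))"
        by (rule summable_comparison_test'[OF sm, of 0]) (use CU(5) in \<open>auto simp: less_imp_le\<close>)
      have "measure \<mu> (\<Union>i. U i - C i) \<le> (\<Sum>i. measure \<mu> (U i - C i))"
        using CU smm by (intro finite_measure_subadditive_countably) (auto simp: image_subset_iff)
      also have "\<dots> \<le> (\<Sum>i. e / 4 * (1/2)^i)"
        using CU(5) by (intro suminf_le smm sm) (auto simp: less_imp_le)
      also have "\<dots> = e / 2" by (subst suminf_mult) (auto simp: suminf_geometric)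
      finally have 1: "measure \<mu> (\<Union>i. U i - C i) \<le> e / 2" .
      have mUC: "(\<Union>i. C i) \<in> sets \<mu>" "(\<Union>i\<le>n. C i) \<in> sets \<mu>" "(\<Union>i. U i - C i) \<in> sets \<mu>"
        using CU(1,2) by auto
      have "measure \<mu> ((\<Union>i. U i) - (\<Union>i\<le>n. C i)) \<le> measure \<mu> ((\<Union>i. U i - C i) \<union> ((\<Union>i. C i) - (\<Union>i\<le>n. C i)))"
        using mUC by (intro finite_measure_mono) auto
      also have "\<dots> \<le> measure \<mu> (\<Union>i. U i - C i) + measure \<mu> ((\<Union>i. C i) - (\<Union>i\<le>n. C i))"
        using mUC by (intro measure_Un_le) auto
      also have "measure \<mu> ((\<Union>i. C i) - (\<Union>i\<le>n. C i)) = measure \<mu> (\<Union>i. C i) - measure \<mu> (\<Union>i\<le>n. C i)"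
        using mUC by (intro finite_measure_Diff) auto
      finally have "measure \<mu> ((\<Union>i. U i) - (\<Union>i\<le>n. C i)) < e" using 1 n e by linarith
      moreover have "closed (\<Union>i\<le>n. C i)" "open (\<Union>i. U i)" using CU by auto
      moreover have "(\<Union>i\<le>n. C i) \<subseteq> (\<Union>i. A i)" "(\<Union>i. A i) \<subseteq> (\<Union>i. U i)" using CU(3,4) by blast+
      ultimately show "\<exists>C V. closed C \<and> open V \<and> C \<subseteq> \<Union> (range A) \<and> \<Union> (range A) \<subseteq> V \<and> measure \<mu> (V - C) < e"
        by (intro exI[of _ "\<Union>i\<le>n. C i"] exI[of _ "\<Union>i. U i"] conjI)
    qed
  qed
  then show ?thesis using \<open>e > 0\<close> by (rule P_D)
qed

section \<open>Folner systems\<close>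

locale folner_system =
  fixes act :: "'g::{topological_group_add, t2_space} \<Rightarrow> 'x::metric_space \<Rightarrow> 'x"
    and m :: "'g measure"
    and F :: "nat \<Rightarrow> 'g set"
    and \<mu> :: "'x measure"
  assumes haar: "left_haar_measure m"
    and folner: "folner_sequence m F"
    and mps: "measure_preserving_system act \<mu>"
begin

section \<open>Measurability of the action and invariance of integrals\<close>

lemma sets_m [simp, measurable_cong]: "sets m = sets borel"
  using haar by (simp add: left_haar_measure_def)

lemma space_m [simp]: "space m = UNIV"
  using sets_eq_imp_space_eq[OF sets_m] by simp

lemma sets_mu [simp, measurable_cong]: "sets \<mu> = sets borel"
  using mps by (simp add: measure_preserving_system_def borel_probability_def)

lemma space_mu [simp]: "space \<mu> = UNIV"
  using sets_eq_imp_space_eq[OF sets_mu] by simp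

lemma emeasure_mu_UNIV [simp]: "emeasure \<mu> UNIV = 1"
  using mps by (simp add: measure_preserving_system_def borel_probability_def)

lemma finite_measure_mu: "finite_measure \<mu>"
  by (rule finite_measureI) simp

sublocale mu: finite_measure \<mu>
  by (rule finite_measure_mu)

lemma measure_mu_UNIV [simp]: "measure \<mu> UNIV = 1"
  by (simp add: measure_def)

lemma compact_X: "compact (UNIV :: 'x set)"
  and act_0 [simp]: "act 0 x = x"
  and act_add: "act (g + h) x = act g (act h x)"
  and continuous_act2: "continuous_on UNIV (\<lambda>(g, x). act g x)"
  using mps by (auto simp: measure_preserving_system_def locally_compact_group_action_def)

lemma act_minus [simp]: "act (- g) (act g x) = x" "act g (act (- g) x) = x"
  by (simp_all flip: act_add)

lemma continuous_act: "continuous_on UNIV (act g)"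
proof -
  have "continuous_on UNIV (\<lambda>x::'x. (g, x))"
    by (intro continuous_on_Pair continuous_on_const continuous_on_id)
  from continuous_on_compose2[OF continuous_act2 this] show ?thesis by simp
qed

lemma continuous_orbit: "continuous_on UNIV (\<lambda>g. act g x)"
proof -
  have "continuous_on UNIV (\<lambda>g::'g. (g, x))"
    by (intro continuous_on_Pair continuous_on_const continuous_on_id)
  from continuous_on_compose2[OF continuous_act2 this] show ?thesis by simp
qed

text \<open>Tonelli needs this for the product sigma-algebra of \<open>G\<close> and
  \<open>X\<close>. Separability is available on the side of \<open>X\<close>, so the action is used
  as a map continuous in the point and Borel in the group element.\<close>

lemma measurable_act [measurable (raw)]:
  assumes "f \<in> borel_measurable M" "h \<in> borel_measurable M"
  shows "(\<lambda>w. act (f w) (h w)) \<in> borel_measurable M"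
proof -
  have "(\<lambda>(g, x). act g x) \<in> borel_measurable (borel \<Otimes>\<^sub>M borel)"
    by (rule borel_measurable_Caratheodory[OF compact_X])
      (auto intro: continuous_act continuous_orbit borel_measurable_continuous_onI)
  from measurable_compose[OF measurable_Pair[OF assms] this] show ?thesis by simp
qed

lemma measurable_dist_X [measurable (raw)]:
  fixes f h :: "'a \<Rightarrow> 'x"
  assumes "f \<in> borel_measurable M" "h \<in> borel_measurable M"
  shows "(\<lambda>w. dist (f w) (h w)) \<in> borel_measurable M"
proof -
  have "(\<lambda>(x::'x, y::'x). dist x y) \<in> borel_measurable (borel \<Otimes>\<^sub>M borel)"
    by (rule borel_measurable_Caratheodory[OF compact_X])
      (auto intro!: borel_measurable_continuous_onI continuous_intros)
  from measurable_compose[OF measurable_Pair[OF assms] this] show ?thesis by simp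
qed

lemma measurable_uminus_G [measurable (raw)]:
  fixes f :: "'a \<Rightarrow> 'g"
  assumes "f \<in> borel_measurable M"
  shows "(\<lambda>w. - f w) \<in> borel_measurable M"
  by (rule measurable_compose[OF assms borel_measurable_continuous_onI]) (intro continuous_intros)

text \<open>Only one summand varies: on a very large group, addition as a map of two variables can
  fail to be measurable for the product sigma-algebra.\<close>

lemma measurable_add_G [measurable (raw)]:
  fixes f :: "'a \<Rightarrow> 'g"
  assumes "f \<in> borel_measurable M"
  shows "(\<lambda>w. h + f w) \<in> borel_measurable M"
  by (rule measurable_compose[OF assms borel_measurable_continuous_onI]) (intro continuous_intros)

lemma distr_act: "distr \<mu> borel (act g) = \<mu>"
proof (rule measure_eqI)
  fix A assume "A \<in> sets (distr \<mu> borel (act g))"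
  then show "emeasure (distr \<mu> borel (act g)) A = emeasure \<mu> A"
    using mps by (simp add: emeasure_distr measure_preserving_system_def)
qed simp

lemma nn_integral_act:
  assumes "u \<in> borel_measurable borel"
  shows "(\<integral>\<^sup>+x. u (act g x) \<partial>\<mu>) = (\<integral>\<^sup>+x. u x \<partial>\<mu>)"
proof -
  have "(\<integral>\<^sup>+x. u x \<partial>\<mu>) = (\<integral>\<^sup>+x. u x \<partial>distr \<mu> borel (act g))" by (simp add: distr_act)
  also have "\<dots> = (\<integral>\<^sup>+x. u (act g x) \<partial>\<mu>)"
    using assms by (intro nn_integral_distr) auto
  finally show ?thesis by simp
qed

lemma integral_act:
  fixes u :: "'x \<Rightarrow> real"
  assumes "u \<in> borel_measurable borel"
  shows "(\<integral>x. u (act g x) \<partial>\<mu>) = (\<integral>x. u x \<partial>\<mu>)"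
proof -
  have "(\<integral>x. u x \<partial>\<mu>) = (\<integral>x. u x \<partial>distr \<mu> borel (act g))" by (simp add: distr_act)
  also have "\<dots> = (\<integral>x. u (act g x) \<partial>\<mu>)"
    using assms by (intro integral_distr) auto
  finally show ?thesis by simp
qed

lemma distr_left_translation: "distr m borel ((+) g) = m"
proof (rule measure_eqI)
  fix A assume "A \<in> sets (distr m borel ((+) g))"
  then have A: "A \<in> sets borel" by simp
  have "(+) g -` A = (+) (- g) ` A"
  proof
    show "(+) g -` A \<subseteq> (+) (- g) ` A"
    proof
      fix x assume "x \<in> (+) g -` A"
      then show "x \<in> (+) (- g) ` A" by (intro image_eqI[of _ _ "g + x"]) auto
    qed
  qed auto
  then show "emeasure (distr m borel ((+) g)) A = emeasure m A"
    using A haar by (simp add: emeasure_distr left_haar_measure_def)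
qed simp

lemma nn_integral_left_translation:
  assumes "u \<in> borel_measurable borel"
  shows "(\<integral>\<^sup>+h. u (g + h) \<partial>m) = (\<integral>\<^sup>+h. u h \<partial>m)"
proof -
  have "(\<integral>\<^sup>+h. u h \<partial>m) = (\<integral>\<^sup>+h. u h \<partial>distr m borel ((+) g))" by (simp add: distr_left_translation)
  also have "\<dots> = (\<integral>\<^sup>+h. u (g + h) \<partial>m)"
    using assms by (intro nn_integral_distr) auto
  finally show ?thesis by simp
qed

section \<open>Folner sets and sigma-finiteness of Haar measure\<close>

lemma compact_F: "compact (F n)"
  and F_pos: "0 < emeasure m (F n)"
  and F_finite: "emeasure m (F n) < \<infinity>"
  and F_folner: "(\<lambda>n. measure m (sym_diff ((+) g ` F n) (F n)) / measure m (F n)) \<longlonglongrightarrow> 0"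
  using folner by (auto simp: folner_sequence_def)

lemma F_neq [simp]: "emeasure m (F n) \<noteq> 0" "emeasure m (F n) \<noteq> top"
  using F_pos[of n] F_finite[of n] by auto

lemma F_divide_self [simp]: "emeasure m (F n) / emeasure m (F n) = 1"
  using F_finite[of n] by (intro ennreal_divide_self) simp_all

lemma measure_F_pos: "0 < measure m (F n)"
  using F_pos[of n] F_finite[of n] by (simp add: measure_def enn2real_positive_iff)

lemma emeasure_F: "emeasure m (F n) = ennreal (measure m (F n))"
  by (intro emeasure_eq_ennreal_measure) simp

lemma sets_F [measurable]: "F n \<in> sets borel"
  using compact_F by (simp add: compact_imp_closed)

lemma compact_translate: "compact K \<Longrightarrow> compact ((+) g ` K)" for g :: 'g
  by (intro compact_continuous_image continuous_intros)

lemma compact_left_quotient: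
  "compact {- a + b | a b. a \<in> F j \<and> b \<in> F k}"
proof -
  have "compact ((\<lambda>(a, b). - a + b) ` (F j \<times> F k))"
    by (intro compact_continuous_image compact_Times compact_F)
      (auto simp: case_prod_beta intro!: continuous_intros)
  also have "(\<lambda>(a, b). - a + b) ` (F j \<times> F k) = {- a + b | a b. a \<in> F j \<and> b \<in> F k}" by auto
  finally show ?thesis .
qed

lemma compact_right_quotient: "compact {a - b | a b. a \<in> F n \<and> b \<in> F n}"
proof -
  have "compact ((\<lambda>(a, b). a + (- b)) ` (F n \<times> F n))"
    by (intro compact_continuous_image compact_Times compact_F)
      (auto simp: case_prod_beta intro!: continuous_intros)
  also have "(\<lambda>(a, b). a + (- b)) ` (F n \<times> F n) = {a - b | a b. a \<in> F n \<and> b \<in> F n}" by auto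
  finally show ?thesis .
qed

text \<open>Once \<open>g + F n\<close> meets \<open>F n\<close>, the element \<open>g\<close> lies in \<open>F n - F n\<close>.\<close>
lemma UN_right_quotient: "(\<Union>n. {a - b | a b. a \<in> F n \<and> b \<in> F n}) = UNIV"
proof -
  have "g \<in> (\<Union>n. {a - b | a b. a \<in> F n \<and> b \<in> F n})" for g
  proof -
    have "eventually (\<lambda>n. measure m (sym_diff ((+) g ` F n) (F n)) / measure m (F n) < 1) sequentially"
      using F_folner[of g] by (intro order_tendstoD(2)) auto
    then obtain n where n: "measure m (sym_diff ((+) g ` F n) (F n)) / measure m (F n) < 1"
      by (meson eventually_sequentially order_refl)
    have "(+) g ` F n \<inter> F n \<noteq> {}"
    proof
      assume d: "(+) g ` F n \<inter> F n = {}"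
      have fm: "A \<in> fmeasurable m" if "compact A" for A
        using haar that by (auto simp: fmeasurable_def left_haar_measure_def compact_imp_closed)
      have "sym_diff ((+) g ` F n) (F n) = (+) g ` F n \<union> F n" using d by auto
      then have "measure m (F n) \<le> measure m (sym_diff ((+) g ` F n) (F n))"
        by (auto intro!: measure_mono_fmeasurable fmeasurable.Un fm compact_F compact_translate)
      then show False using n measure_F_pos[of n] by simp
    qed
    then obtain b where "b \<in> F n" "g + b \<in> F n" by auto
    then have "g \<in> {a - b | a b. a \<in> F n \<and> b \<in> F n}"
      by (intro CollectI exI[of _ "g + b"] exI[of _ b]) (simp add: diff_conv_add_uminus add.assoc del: add_uminus_conv_diff)
    then show ?thesis by blast
  qed
  then show ?thesis by blast
qed

text \<open>Haar measure of a group that is not sigma-compact lacks this property, and Tonelli with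
  it. Here the compact sets of differences of elements of \<open>F n\<close> form a countable
  cover.\<close>

lemma sigma_finite_m: "sigma_finite_measure m"
proof
  let ?A = "range (\<lambda>n. {a - b | a b. a \<in> F n \<and> b \<in> F n})"
  have "emeasure m {a - b | a b. a \<in> F n \<and> b \<in> F n} \<noteq> \<infinity>" for n
    using haar compact_right_quotient[of n] by (auto simp: left_haar_measure_def)
  moreover have "?A \<subseteq> sets m"
    using compact_right_quotient by (auto simp: compact_imp_closed)
  moreover have "\<Union> ?A = space m" using UN_right_quotient by simp
  ultimately show "\<exists>A. countable A \<and> A \<subseteq> sets m \<and> \<Union> A = space m \<and> (\<forall>a\<in>A. emeasure m a \<noteq> \<infinity>)"
    by (intro exI[of _ ?A] conjI) auto
qed

sublocale m: sigma_finite_measure m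
  by (rule sigma_finite_m)

sublocale m_mu: pair_sigma_finite m \<mu> ..

sublocale mu_mu: pair_sigma_finite \<mu> \<mu> ..

end

section \<open>The maximal inequality\<close>

context folner_system
begin

section \<open>A weighted covering argument\<close>

abbreviation F_quot :: "nat \<Rightarrow> nat \<Rightarrow> 'g set" where
  "F_quot j k \<equiv> {- a + b | a b. a \<in> F j \<and> b \<in> F k}"

lemma sets_F_quot [measurable]: "F_quot j k \<in> sets borel"
  using compact_left_quotient by (simp add: compact_imp_closed)

text \<open>
  Greedy weights, from the largest scale down: a point of \<open>B n\<close> receives its full weight at scale
  \<open>n\<close> unless the sets chosen at larger scales that meet its own set already carry total mass \<open>1\<close>.
  This fractional choice replaces the random selection in Lindenstrauss's covering lemma.
\<close>
function weight :: "nat \<Rightarrow> (nat \<Rightarrow> 'x set) \<Rightarrow> nat \<Rightarrow> 'x \<Rightarrow> ennreal" where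
  "weight N B n x =
     (if x \<in> B n \<and>
         (\<Sum>k\<in>{n<..<N}. \<integral>\<^sup>+g. indicator (F_quot n k) g * weight N B k (act (- g) x) \<partial>m) < 1
      then 1 / emeasure m (F n) else 0)"
  by pat_completeness auto
termination by (relation "Wellfounded.measure (\<lambda>(N, B, n, x). N - n)") auto

declare weight.simps [simp del]

text \<open>If \<open>z = act (- g) x\<close> with \<open>g = - a + b\<close>, then
  \<open>act a x = act b z\<close>. So the sum collects the weight of those later centers
  \<open>z\<close> whose sets \<open>F k z\<close> meet \<open>F n x\<close>.\<close>

definition load :: "nat \<Rightarrow> (nat \<Rightarrow> 'x set) \<Rightarrow> nat \<Rightarrow> 'x \<Rightarrow> ennreal" where
  "load N B n x = (\<Sum>k\<in>{n<..<N}. \<integral>\<^sup>+g. indicator (F_quot n k) g * weight N B k (act (- g) x) \<partial>m)"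

lemma weight_eq: "weight N B n x = (if x \<in> B n \<and> load N B n x < 1 then 1 / emeasure m (F n) else 0)"
  by (subst weight.simps) (simp add: load_def)

lemma measurable_weight_load:
  assumes B: "\<And>n. B n \<in> sets borel"
  shows "weight N B n \<in> borel_measurable borel \<and> load N B n \<in> borel_measurable borel"
proof (induction "N - n" arbitrary: n rule: less_induct)
  case less
  have [measurable]: "weight N B k \<in> borel_measurable borel" if "k \<in> {n<..<N}" for k
    using that less[of k] by auto
  have [measurable]: "load N B n \<in> borel_measurable borel"
    unfolding load_def
  proof (intro borel_measurable_sum)
    fix k assume k: "k \<in> {n<..<N}"
    note this[measurable]
    show "(\<lambda>x. \<integral>\<^sup>+g. indicator (F_quot n k) g * weight N B k (act (- g) x) \<partial>m) \<in> borel_measurable borel"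
      by measurable
  qed
  note B[measurable]
  have "weight N B n \<in> borel_measurable borel"
    unfolding weight_eq[abs_def] by measurable
  then show ?case by simp
qed

text \<open>Here \<open>act (- h) y\<close> with \<open>h \<in> F n\<close> runs over the centers
  whose sets at scale \<open>n\<close> contain \<open>y\<close>.\<close>

definition overlap :: "nat \<Rightarrow> (nat \<Rightarrow> 'x set) \<Rightarrow> nat \<Rightarrow> 'x \<Rightarrow> ennreal" where
  "overlap N B n y = (\<integral>\<^sup>+h. indicator (F n) h * weight N B n (act (- h) y) \<partial>m)"

lemma overlap_le_1: "overlap N B n y \<le> 1"
proof -
  have "overlap N B n y \<le> (\<integral>\<^sup>+h. indicator (F n) h * (1 / emeasure m (F n)) \<partial>m)"
    unfolding overlap_def by (intro nn_integral_mono mult_left_mono) (auto simp: weight_eq)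
  also have "\<dots> = emeasure m (F n) * (1 / emeasure m (F n))"
    by (subst nn_integral_multc) auto
  also have "\<dots> = 1" by (simp add: ennreal_times_divide ennreal_divide_self)
  finally show ?thesis .
qed

text \<open>At the smallest scale \<open>n\<close> that covers \<open>y\<close>, some center
  \<open>x\<close> was accepted, so its load is below \<open>1\<close>. Every later set containing
  \<open>y\<close> meets the set of \<open>x\<close> in \<open>y\<close> and is thus counted in that
  load. Scale \<open>n\<close> itself adds at most \<open>1\<close>.\<close>

lemma sum_overlap_le_2:
  assumes B: "\<And>n. B n \<in> sets borel"
  shows "(\<Sum>n<N. overlap N B n y) \<le> 2"
proof (cases "\<exists>n<N. overlap N B n y \<noteq> 0")
  case False
  then show ?thesis by simp
next
  case True
  define n where "n = (LEAST n. n < N \<and> overlap N B n y \<noteq> 0)"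
  have n: "n < N" "overlap N B n y \<noteq> 0"
    using LeastI_ex[of "\<lambda>n. n < N \<and> overlap N B n y \<noteq> 0"] True by (auto simp: n_def)
  have zero: "overlap N B k y = 0" if "k < n" for k
    using not_less_Least[of k "\<lambda>n. n < N \<and> overlap N B n y \<noteq> 0"] that n(1) by (auto simp: n_def)
  have [measurable]: "weight N B k \<in> borel_measurable borel" for k
    using measurable_weight_load[of B, OF B] by blast
  have "\<exists>h. indicator (F n) h * weight N B n (act (- h) y) \<noteq> 0"
  proof (rule ccontr)
    assume "\<not> ?thesis"
    then have z: "indicator (F n) h * weight N B n (act (- h) y) = 0" for h by blast
    have "overlap N B n y = 0" unfolding overlap_def z by simp
    with n show False by simp
  qed
  then obtain h where h: "h \<in> F n" "weight N B n (act (- h) y) \<noteq> 0"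
    by (auto split: split_indicator_asm)
  define x where "x = act (- h) y"
  have y: "y = act h x" by (simp add: x_def)
  have load: "load N B n x < 1" using h(2) by (auto simp: weight_eq x_def split: if_splits)
  have "overlap N B k y \<le> (\<integral>\<^sup>+g. indicator (F_quot n k) g * weight N B k (act (- g) x) \<partial>m)" for k
  proof -
    \<comment> \<open>Left translation by \<open>h\<close> recentres from \<open>y\<close> to
      \<open>x\<close>: the center \<open>act (- (h + g)) y\<close> is
      \<open>act (- g) x\<close>.\<close>
    have "overlap N B k y = (\<integral>\<^sup>+g. indicator (F k) (h + g) * weight N B k (act (- (h + g)) y) \<partial>m)"
      unfolding overlap_def by (rule nn_integral_left_translation[symmetric]) measurable
    also have "\<dots> \<le> (\<integral>\<^sup>+g. indicator (F_quot n k) g * weight N B k (act (- g) x) \<partial>m)"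
    proof (intro nn_integral_mono mult_mono)
      fix g
      have "g = - h + (h + g)" by (simp add: add.assoc[symmetric])
      then have "g \<in> F_quot n k" if "h + g \<in> F k" using that h(1) by blast
      then show "indicator (F k) (h + g) \<le> (indicator (F_quot n k) g :: ennreal)"
        by (auto split: split_indicator)
      show "weight N B k (act (- (h + g)) y) \<le> weight N B k (act (- g) x)"
        by (simp add: y minus_add add.assoc flip: act_add)
    qed auto
    finally show ?thesis .
  qed
  then have "(\<Sum>k\<in>{n<..<N}. overlap N B k y) \<le> load N B n x"
    unfolding load_def by (intro sum_mono)
  with load have later: "(\<Sum>k\<in>{n<..<N}. overlap N B k y) \<le> 1" by simp
  have N_split: "{..<N} = {..<n} \<union> insert n {n<..<N}"
    using n(1) by (auto simp only: lessThan_iff Un_iff insert_iff greaterThanLessThan_iff)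
  have "(\<Sum>k<N. overlap N B k y) = (\<Sum>k<n. overlap N B k y) + (\<Sum>k\<in>insert n {n<..<N}. overlap N B k y)"
    unfolding N_split by (rule sum.union_disjoint) auto
  also have "(\<Sum>k<n. overlap N B k y) = 0" using zero by simp
  also have "(\<Sum>k\<in>insert n {n<..<N}. overlap N B k y) = overlap N B n y + (\<Sum>k\<in>{n<..<N}. overlap N B k y)"
    by simp
  finally show ?thesis
    using add_mono[OF overlap_le_1[of N B n y] later] by simp
qed

text \<open>A point of \<open>B n\<close> either has full weight, so that
  \<open>emeasure m (F n) * weight N B n x = 1\<close>, or was refused because its load is at least
  \<open>1\<close>. The first case gives the \<open>1\<close> in \<open>1 + C\<close>. For the
  second, the load is charged to the later center \<open>z\<close> that causes it: the points
  \<open>act g z\<close> loaded by \<open>z\<close> have \<open>g\<close> in the union of the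
  \<open>F_quot n k\<close>, whose measure is bounded through \<open>C\<close>.\<close>

lemma measure_le_total_weight:
  assumes B: "\<And>n. B n \<in> sets borel" and disj: "disjoint_family B"
    and C: "\<And>n. emeasure m (\<Union>k<n. F_quot k n) \<le> C * emeasure m (F n)"
  shows "(\<Sum>n<N. emeasure \<mu> (B n)) \<le> (1 + C) * (\<Sum>n<N. emeasure m (F n) * (\<integral>\<^sup>+x. weight N B n x \<partial>\<mu>))"
proof -
  note B[measurable]
  have [measurable]: "weight N B k \<in> borel_measurable borel" "load N B k \<in> borel_measurable borel" for k
    using measurable_weight_load[of B, OF B] by blast+
  define I where "I n k = (\<integral>\<^sup>+z. weight N B k z *
      (\<integral>\<^sup>+g. indicator (B n) (act g z) * indicator (F_quot n k) g \<partial>m) \<partial>\<mu>)" for n k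
  have le: "emeasure \<mu> (B n) \<le> emeasure m (F n) * (\<integral>\<^sup>+x. weight N B n x \<partial>\<mu>)
      + (\<integral>\<^sup>+x. indicator (B n) x * load N B n x \<partial>\<mu>)" for n
  proof -
    have "emeasure \<mu> (B n) = (\<integral>\<^sup>+x. indicator (B n) x \<partial>\<mu>)" by simp
    also have "\<dots> \<le> (\<integral>\<^sup>+x. emeasure m (F n) * weight N B n x + indicator (B n) x * load N B n x \<partial>\<mu>)"
    proof (rule nn_integral_mono)
      fix x
      show "indicator (B n) x \<le> emeasure m (F n) * weight N B n x + indicator (B n) x * load N B n x"
        by (auto simp: weight_eq ennreal_times_divide not_less split: split_indicator)
    qed
    also have "\<dots> = emeasure m (F n) * (\<integral>\<^sup>+x. weight N B n x \<partial>\<mu>)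
      + (\<integral>\<^sup>+x. indicator (B n) x * load N B n x \<partial>\<mu>)"
      by (simp add: nn_integral_add nn_integral_cmult)
    finally show ?thesis .
  qed
  have load_eq: "(\<integral>\<^sup>+x. indicator (B n) x * load N B n x \<partial>\<mu>) = (\<Sum>k\<in>{n<..<N}. I n k)" for n
  proof -
    have "(\<integral>\<^sup>+x. indicator (B n) x * load N B n x \<partial>\<mu>) = (\<Sum>k\<in>{n<..<N}. \<integral>\<^sup>+x. indicator (B n) x *
        (\<integral>\<^sup>+g. indicator (F_quot n k) g * weight N B k (act (- g) x) \<partial>m) \<partial>\<mu>)"
      unfolding load_def sum_distrib_left by (intro nn_integral_sum) measurable
    also have "\<dots> = (\<Sum>k\<in>{n<..<N}. I n k)"
    proof (rule sum.cong)
      fix k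
      have "(\<integral>\<^sup>+x. indicator (B n) x * (\<integral>\<^sup>+g. indicator (F_quot n k) g * weight N B k (act (- g) x) \<partial>m) \<partial>\<mu>)
        = (\<integral>\<^sup>+x. (\<integral>\<^sup>+g. indicator (B n) x * (indicator (F_quot n k) g * weight N B k (act (- g) x)) \<partial>m) \<partial>\<mu>)"
        by (intro nn_integral_cong) (simp add: nn_integral_cmult)
      also have "\<dots> = (\<integral>\<^sup>+g. (\<integral>\<^sup>+x. indicator (B n) x * (indicator (F_quot n k) g * weight N B k (act (- g) x)) \<partial>\<mu>) \<partial>m)"
        by (rule m_mu.Fubini') measurable
      \<comment> \<open>The substitution \<open>x = act g z\<close>, for fixed \<open>g\<close>,
        moves the integration from the refused point to the later center.\<close>
      also have "\<dots> = (\<integral>\<^sup>+g. (\<integral>\<^sup>+z. indicator (B n) (act g z) * (indicator (F_quot n k) g * weight N B k (act (- g) (act g z))) \<partial>\<mu>) \<partial>m)"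
        by (intro nn_integral_cong nn_integral_act[symmetric]) measurable
      also have "\<dots> = (\<integral>\<^sup>+z. (\<integral>\<^sup>+g. indicator (B n) (act g z) * (indicator (F_quot n k) g * weight N B k (act (- g) (act g z))) \<partial>m) \<partial>\<mu>)"
        by (rule m_mu.Fubini'[symmetric]) measurable
      also have "\<dots> = (\<integral>\<^sup>+z. (\<integral>\<^sup>+g. weight N B k z * (indicator (B n) (act g z) * indicator (F_quot n k) g) \<partial>m) \<partial>\<mu>)"
        by (simp add: mult_ac)
      also have "\<dots> = I n k"
        unfolding I_def by (intro nn_integral_cong nn_integral_cmult) measurable
      finally show "(\<integral>\<^sup>+x. indicator (B n) x * (\<integral>\<^sup>+g. indicator (F_quot n k) g * weight N B k (act (- g) x) \<partial>m) \<partial>\<mu>) = I n k" .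
    qed simp
    finally show ?thesis .
  qed
  have I_le: "(\<Sum>n<k. I n k) \<le> C * (emeasure m (F k) * (\<integral>\<^sup>+x. weight N B k x \<partial>\<mu>))" for k
  proof -
    have "(\<Sum>n<k. I n k) = (\<integral>\<^sup>+z. weight N B k z *
      (\<integral>\<^sup>+g. (\<Sum>n<k. indicator (B n) (act g z) * indicator (F_quot n k) g) \<partial>m) \<partial>\<mu>)"
    proof -
      have "(\<Sum>n<k. I n k) = (\<integral>\<^sup>+z. (\<Sum>n<k. weight N B k z *
          (\<integral>\<^sup>+g. indicator (B n) (act g z) * indicator (F_quot n k) g \<partial>m)) \<partial>\<mu>)"
        unfolding I_def by (rule nn_integral_sum[symmetric]) measurable
      also have "\<dots> = (\<integral>\<^sup>+z. weight N B k z *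
          (\<integral>\<^sup>+g. (\<Sum>n<k. indicator (B n) (act g z) * indicator (F_quot n k) g) \<partial>m) \<partial>\<mu>)"
        unfolding sum_distrib_left[symmetric]
        by (intro nn_integral_cong arg_cong2[where f = "(*)"] refl nn_integral_sum[symmetric]) measurable
      finally show ?thesis .
    qed
    also have "\<dots> \<le> (\<integral>\<^sup>+z. weight N B k z * (C * emeasure m (F k)) \<partial>\<mu>)"
    proof (intro nn_integral_mono mult_left_mono)
      fix z
      have "(\<integral>\<^sup>+g. (\<Sum>n<k. indicator (B n) (act g z) * indicator (F_quot n k) g) \<partial>m)
          \<le> (\<integral>\<^sup>+g. indicator (\<Union>n<k. F_quot n k) g \<partial>m)"
      proof (rule nn_integral_mono)
        fix g
        show "(\<Sum>n<k. indicator (B n) (act g z) * indicator (F_quot n k) g)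
            \<le> (indicator (\<Union>n<k. F_quot n k) g :: ennreal)"
        proof (cases "\<exists>n<k. act g z \<in> B n")
          case False
          then have "(\<Sum>n<k. indicator (B n) (act g z) * indicator (F_quot n k) g) = (0::ennreal)"
            by (intro sum.neutral) auto
          then show ?thesis by simp
        next
          case True
          then obtain n where n: "n < k" "act g z \<in> B n" by blast
          \<comment> \<open>Disjointness lets \<open>act g z\<close> be charged at one scale only.
            Hence the sum is at most the indicator of the union, not a count with multiplicity up to
            \<open>k\<close>.\<close>
          have "act g z \<notin> B i" if "i \<noteq> n" for i
            using disj that n(2) unfolding disjoint_family_on_def by (metis IntI UNIV_I empty_iff)
          then have "indicator (B i) (act g z) = (0::ennreal)" if "i \<noteq> n" for i
            using that by simp
          then have "(\<Sum>n<k. indicator (B n) (act g z) * indicator (F_quot n k) g)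
              = indicator (B n) (act g z) * (indicator (F_quot n k) g :: ennreal)"
            using n(1) by (subst sum.remove[of _ n]) auto
          also have "\<dots> \<le> indicator (\<Union>n<k. F_quot n k) g"
            using n by (auto split: split_indicator)
          finally show ?thesis .
        qed
      qed
      also have "\<dots> = emeasure m (\<Union>n<k. F_quot n k)"
        by (intro nn_integral_indicator) measurable
      also have "\<dots> \<le> C * emeasure m (F k)" by (rule C)
      finally show "(\<integral>\<^sup>+g. (\<Sum>n<k. indicator (B n) (act g z) * indicator (F_quot n k) g) \<partial>m)
          \<le> C * emeasure m (F k)" .
    qed auto
    also have "\<dots> = C * (emeasure m (F k) * (\<integral>\<^sup>+x. weight N B k x \<partial>\<mu>))"
      by (simp add: nn_integral_cmult mult_ac)
    finally show ?thesis .
  qed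
  have swap: "(\<Sum>n<N. \<Sum>k\<in>{n<..<N}. I n k) = (\<Sum>k<N. \<Sum>n<k. I n k)"
  proof -
    have "(\<Sum>n<N. \<Sum>k\<in>{n<..<N}. I n k) = (\<Sum>(n, k)\<in>Sigma {..<N} (\<lambda>n. {n<..<N}). I n k)"
      by (rule sum.Sigma) auto
    also have "\<dots> = (\<Sum>(k, n)\<in>Sigma {..<N} (\<lambda>k. {..<k}). I n k)"
      by (rule sum.reindex_bij_witness[of _ prod.swap prod.swap]) auto
    also have "\<dots> = (\<Sum>k<N. \<Sum>n<k. I n k)"
      by (rule sum.Sigma[symmetric]) auto
    finally show ?thesis .
  qed
  have "(\<Sum>n<N. emeasure \<mu> (B n)) \<le> (\<Sum>n<N. emeasure m (F n) * (\<integral>\<^sup>+x. weight N B n x \<partial>\<mu>) + (\<Sum>k\<in>{n<..<N}. I n k))"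
    using le load_eq by (intro sum_mono) simp
  also have "\<dots> = (\<Sum>n<N. emeasure m (F n) * (\<integral>\<^sup>+x. weight N B n x \<partial>\<mu>)) + (\<Sum>k<N. \<Sum>n<k. I n k)"
    by (simp add: sum.distrib swap)
  also have "\<dots> \<le> (\<Sum>n<N. emeasure m (F n) * (\<integral>\<^sup>+x. weight N B n x \<partial>\<mu>))
      + (\<Sum>k<N. C * (emeasure m (F k) * (\<integral>\<^sup>+x. weight N B k x \<partial>\<mu>)))"
    by (intro add_left_mono sum_mono I_le)
  also have "\<dots> = (1 + C) * (\<Sum>n<N. emeasure m (F n) * (\<integral>\<^sup>+x. weight N B n x \<partial>\<mu>))"
    by (simp add: sum_distrib_left distrib_right sum.distrib)
  finally show ?thesis .
qed

text \<open>A center of positive weight at scale \<open>n\<close> lies in \<open>B n\<close>, where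
  the average of \<open>u\<close> is at least \<open>c\<close>. Integrating against the weights and
  passing from centers to the points they cover turns the averages into \<open>u\<close> times the
  total overlap, which is at most \<open>2\<close>.\<close>

lemma total_weight_le:
  assumes u [measurable]: "u \<in> borel_measurable borel"
    and B: "\<And>n. B n \<in> sets borel"
    and avg: "\<And>n x. x \<in> B n \<Longrightarrow> c * emeasure m (F n) \<le> (\<integral>\<^sup>+g\<in>F n. u (act g x) \<partial>m)"
  shows "c * (\<Sum>n<N. emeasure m (F n) * (\<integral>\<^sup>+x. weight N B n x \<partial>\<mu>)) \<le> 2 * (\<integral>\<^sup>+x. u x \<partial>\<mu>)"
proof -
  note B[measurable]
  have [measurable]: "weight N B k \<in> borel_measurable borel" "load N B k \<in> borel_measurable borel" for k
    using measurable_weight_load[of B, OF B] by blast+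
  have [measurable]: "overlap N B k \<in> borel_measurable borel" for k
    unfolding overlap_def[abs_def] by measurable
  have "c * (\<Sum>n<N. emeasure m (F n) * (\<integral>\<^sup>+x. weight N B n x \<partial>\<mu>))
      = (\<Sum>n<N. \<integral>\<^sup>+x. weight N B n x * (c * emeasure m (F n)) \<partial>\<mu>)"
    by (simp add: sum_distrib_left nn_integral_cmult mult_ac)
  also have "\<dots> \<le> (\<Sum>n<N. \<integral>\<^sup>+x. weight N B n x * (\<integral>\<^sup>+g\<in>F n. u (act g x) \<partial>m) \<partial>\<mu>)"
  proof (intro sum_mono nn_integral_mono)
    fix n x
    show "weight N B n x * (c * emeasure m (F n)) \<le> weight N B n x * (\<integral>\<^sup>+g\<in>F n. u (act g x) \<partial>m)"
      using avg[of x n] by (cases "x \<in> B n") (auto simp: weight_eq intro: mult_left_mono)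
  qed
  also have "\<dots> = (\<Sum>n<N. \<integral>\<^sup>+y. u y * overlap N B n y \<partial>\<mu>)"
  proof (rule sum.cong)
    fix n
    have "(\<integral>\<^sup>+x. weight N B n x * (\<integral>\<^sup>+g\<in>F n. u (act g x) \<partial>m) \<partial>\<mu>)
        = (\<integral>\<^sup>+x. (\<integral>\<^sup>+g. weight N B n x * (u (act g x) * indicator (F n) g) \<partial>m) \<partial>\<mu>)"
      by (intro nn_integral_cong nn_integral_cmult[symmetric]) measurable
    also have "\<dots> = (\<integral>\<^sup>+g. (\<integral>\<^sup>+x. weight N B n x * (u (act g x) * indicator (F n) g) \<partial>\<mu>) \<partial>m)"
      by (rule m_mu.Fubini') measurable
    also have "\<dots> = (\<integral>\<^sup>+g. (\<integral>\<^sup>+y. weight N B n (act (- g) y) * (u (act g (act (- g) y)) * indicator (F n) g) \<partial>\<mu>) \<partial>m)"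
      by (intro nn_integral_cong nn_integral_act[symmetric]) measurable
    also have "\<dots> = (\<integral>\<^sup>+y. (\<integral>\<^sup>+g. weight N B n (act (- g) y) * (u (act g (act (- g) y)) * indicator (F n) g) \<partial>m) \<partial>\<mu>)"
      by (rule m_mu.Fubini'[symmetric]) measurable
    also have "\<dots> = (\<integral>\<^sup>+y. (\<integral>\<^sup>+g. u y * (indicator (F n) g * weight N B n (act (- g) y)) \<partial>m) \<partial>\<mu>)"
      by (simp add: mult_ac)
    also have "\<dots> = (\<integral>\<^sup>+y. u y * overlap N B n y \<partial>\<mu>)"
      unfolding overlap_def by (intro nn_integral_cong nn_integral_cmult) measurable
    finally show "(\<integral>\<^sup>+x. weight N B n x * (\<integral>\<^sup>+g\<in>F n. u (act g x) \<partial>m) \<partial>\<mu>) = (\<integral>\<^sup>+y. u y * overlap N B n y \<partial>\<mu>)" .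
  qed simp
  also have "\<dots> = (\<integral>\<^sup>+y. u y * (\<Sum>n<N. overlap N B n y) \<partial>\<mu>)"
    unfolding sum_distrib_left by (rule nn_integral_sum[symmetric]) measurable
  also have "\<dots> \<le> (\<integral>\<^sup>+y. u y * 2 \<partial>\<mu>)"
    by (intro nn_integral_mono mult_left_mono sum_overlap_le_2 B) auto
  also have "\<dots> = 2 * (\<integral>\<^sup>+x. u x \<partial>\<mu>)"
    by (simp add: nn_integral_multc mult.commute)
  finally show ?thesis .
qed

text \<open>\<open>disjointed\<close> assigns each point to the first scale at which its average is
  large, since the covering bound wants disjoint sets. The weights are built downward from a last
  scale, so the bound is proved for \<open>n < N\<close> with a constant free of \<open>N\<close>,
  and then \<open>N\<close> grows.\<close>

theorem maximal_inequality:
  assumes u [measurable]: "u \<in> borel_measurable borel"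
    and C: "\<And>n. emeasure m (\<Union>k<n. F_quot k n) \<le> C * emeasure m (F n)"
  shows "c * emeasure \<mu> {x. \<exists>n. c * emeasure m (F n) \<le> (\<integral>\<^sup>+g\<in>F n. u (act g x) \<partial>m)}
      \<le> 2 * (1 + C) * (\<integral>\<^sup>+x. u x \<partial>\<mu>)"
proof -
  define E where "E n = {x. c * emeasure m (F n) \<le> (\<integral>\<^sup>+g\<in>F n. u (act g x) \<partial>m)}" for n
  have E [measurable]: "E n \<in> sets borel" for n
  proof -
    have "{x \<in> space borel. c * emeasure m (F n) \<le> (\<integral>\<^sup>+g\<in>F n. u (act g x) \<partial>m)} \<in> sets borel"
      by measurable
    then show ?thesis by (simp add: E_def)
  qed
  define B where "B = disjointed E"
  have B: "B n \<in> sets borel" for n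
    unfolding B_def using sets.range_disjointed_sets[of E borel] E by (auto simp: image_subset_iff)
  have dB: "disjoint_family B" unfolding B_def by (rule disjoint_family_disjointed)
  have fin: "c * emeasure \<mu> (\<Union>n<N. E n) \<le> 2 * (1 + C) * (\<integral>\<^sup>+x. u x \<partial>\<mu>)" for N
  proof -
    have "(\<Union>n<N. E n) = (\<Union>n<N. B n)"
      unfolding B_def using finite_UN_disjointed_eq[of E N] by (simp add: atLeast0LessThan)
    then have "emeasure \<mu> (\<Union>n<N. E n) = (\<Sum>n<N. emeasure \<mu> (B n))"
      using B dB by (simp add: sum_emeasure disjoint_family_on_mono image_subset_iff disjoint_family_on_def)
    then have "c * emeasure \<mu> (\<Union>n<N. E n) \<le> c * ((1 + C) * (\<Sum>n<N. emeasure m (F n) * (\<integral>\<^sup>+x. weight N B n x \<partial>\<mu>)))"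
      using measure_le_total_weight[of B C N, OF B dB C] by (simp add: mult_left_mono)
    also have "\<dots> = (1 + C) * (c * (\<Sum>n<N. emeasure m (F n) * (\<integral>\<^sup>+x. weight N B n x \<partial>\<mu>)))"
      by (simp add: mult_ac)
    also have "\<dots> \<le> (1 + C) * (2 * (\<integral>\<^sup>+x. u x \<partial>\<mu>))"
    proof (intro mult_left_mono total_weight_le u B)
      fix n x assume "x \<in> B n"
      then have "x \<in> E n" using disjointed_subset[of E n] by (auto simp: B_def)
      then show "c * emeasure m (F n) \<le> (\<integral>\<^sup>+g\<in>F n. u (act g x) \<partial>m)" by (simp add: E_def)
    qed auto
    also have "\<dots> = 2 * (1 + C) * (\<integral>\<^sup>+x. u x \<partial>\<mu>)"
      by (simp only: mult_ac)
    finally show ?thesis .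
  qed
  have "{x. \<exists>n. c * emeasure m (F n) \<le> (\<integral>\<^sup>+g\<in>F n. u (act g x) \<partial>m)} = (\<Union>N. \<Union>n<N. E n)"
    by (auto simp: E_def)
  moreover have "emeasure \<mu> (\<Union>N. \<Union>n<N. E n) = (SUP N. emeasure \<mu> (\<Union>n<N. E n))"
    by (rule SUP_emeasure_incseq[symmetric]) (auto simp: incseq_def intro: less_le_trans)
  ultimately show ?thesis using fin by (simp add: SUP_mult_left_ennreal SUP_le_iff)
qed

end

section \<open>Completeness of \<open>L\<^sup>2\<close>\<close>

lemma sqrt_less_iff_less_power2: "e > 0 \<Longrightarrow> sqrt a < e \<longleftrightarrow> a < e\<^sup>2"
  by (metis abs_of_pos real_sqrt_abs real_sqrt_less_iff)

text \<open>The second moment about the mean \<open>c\<close> is nonnegative. Since \<open>c\<close>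
  divides by the total mass, mass \<open>0\<close> is split off.\<close>

lemma (in finite_measure) integral_squared_le:
  fixes u :: "'a \<Rightarrow> real"
  assumes "integrable M u" "integrable M (\<lambda>x. (u x)\<^sup>2)"
  shows "(\<integral>x. u x \<partial>M)\<^sup>2 \<le> measure M (space M) * (\<integral>x. (u x)\<^sup>2 \<partial>M)"
proof (cases "measure M (space M) = 0")
  case True
  then have "emeasure M (space M) = 0" by (simp add: emeasure_eq_measure)
  then have "AE x in M. u x = 0" by (intro AE_I[of _ _ "space M"]) auto
  then have "(\<integral>x. u x \<partial>M) = 0" by (intro integral_eq_zero_AE)
  then show ?thesis using True by simp
next
  case False
  then have V: "measure M (space M) > 0" by (simp add: zero_less_measure_iff)
  define V where "V = measure M (space M)"
  define c where "c = (\<integral>x. u x \<partial>M) / V"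
  have "0 \<le> (\<integral>x. (u x - c)\<^sup>2 \<partial>M)" by simp
  also have "\<dots> = (\<integral>x. (u x)\<^sup>2 - 2 * c * u x + c\<^sup>2 \<partial>M)"
    by (simp add: power2_diff algebra_simps)
  also have "\<dots> = (\<integral>x. (u x)\<^sup>2 \<partial>M) - 2 * c * (\<integral>x. u x \<partial>M) + c\<^sup>2 * V"
    using assms by (simp add: V_def)
  also have "\<dots> = (\<integral>x. (u x)\<^sup>2 \<partial>M) - (\<integral>x. u x \<partial>M)\<^sup>2 / V"
    using V by (simp add: c_def V_def[symmetric] power2_eq_square field_simps)
  finally show ?thesis using V by (simp add: V_def[symmetric] field_simps)
qed

lemma (in finite_measure) square_integrable_imp_integrable:
  assumes "f \<in> square_integrable M"
  shows "integrable M f"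
proof (rule Bochner_Integration.integrable_bound)
  show "integrable M (\<lambda>x. 1 + (cmod (f x))\<^sup>2)" "f \<in> borel_measurable M"
    using assms by (auto simp: square_integrable_def)
  have "t \<le> 1 + t\<^sup>2" for t :: real
  proof -
    have "2 * t \<le> 1 + t\<^sup>2" using sum_squares_bound[of 1 t] by simp
    then show ?thesis using zero_le_power2[of t] by linarith
  qed
  then show "AE x in M. norm (f x) \<le> norm (1 + (cmod (f x))\<^sup>2)" by simp
qed

text \<open>Riesz-Fischer. On a finite measure space a Cauchy sequence of \<open>L\<^sup>2\<close>
  is Cauchy in \<open>L\<^sup>1\<close>, hence has an almost everywhere convergent subsequence;
  Fatou along it bounds the \<open>L\<^sup>2\<close>-distance of the whole sequence to the
  limit.\<close>

lemma (in finite_measure) mcomplete_L2: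
  "Metric_space.mcomplete (L2_space M) (L2_dist M)"
proof -
  interpret L2: Metric_space "L2_space M" "L2_dist M" by (rule Metric_space_L2)
  show ?thesis unfolding L2.mcomplete_def
  proof (intro allI impI)
    fix \<sigma> assume \<sigma>: "L2.MCauchy \<sigma>"
    then have "\<forall>n. \<exists>f. f \<in> square_integrable M \<and> \<sigma> n = L2_class M f"
      unfolding L2.MCauchy_def using L2_space_cases by (metis rangeI subsetD)
    then obtain f where f: "\<And>n. f n \<in> square_integrable M" and \<sigma>f: "\<And>n. \<sigma> n = L2_class M (f n)"
      by metis
    have [measurable]: "f n \<in> borel_measurable M" for n
      using f by (simp add: square_integrable_def)
    have sq: "integrable M (\<lambda>x. (cmod (f i x - f j x))\<^sup>2)" for i j
      using square_integrable_diff[OF f f] by (simp add: square_integrable_def)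
    have C: "\<exists>N. \<forall>i\<ge>N. \<forall>j\<ge>N. (\<integral>x. (cmod (f i x - f j x))\<^sup>2 \<partial>M) < e\<^sup>2" if "e > 0" for e
    proof -
      obtain N where "\<And>i j. i \<ge> N \<Longrightarrow> j \<ge> N \<Longrightarrow> L2_dist M (\<sigma> i) (\<sigma> j) < e"
        using \<sigma> \<open>e > 0\<close> unfolding L2.MCauchy_def by blast
      then have "\<forall>i\<ge>N. \<forall>j\<ge>N. (\<integral>x. (cmod (f i x - f j x))\<^sup>2 \<partial>M) < e\<^sup>2"
        using \<open>e > 0\<close> by (simp add: \<sigma>f L2_dist_class f sqrt_less_iff_less_power2)
      then show ?thesis by blast
    qed
    obtain r where r: "strict_mono r" "AE x in M. Cauchy (\<lambda>i. f (r i) x)"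
    proof (rule cauchy_L1_AE_cauchy_subseq)
      show "integrable M (f n)" for n
        by (rule square_integrable_imp_integrable[OF f])
      fix e :: real assume "e > 0"
      \<comment> \<open>The added \<open>1\<close> allows the division and makes
        \<open>e\<^sup>2 / V \<le> e\<^sup>2\<close>.\<close>
      define V where "V = measure M (space M) + 1"
      have V: "V > 0" unfolding V_def by (simp add: add_nonneg_pos)
      then have "e / V > 0" using \<open>e > 0\<close> by simp
      then obtain N where N: "\<And>i j. i \<ge> N \<Longrightarrow> j \<ge> N \<Longrightarrow> (\<integral>x. (cmod (f i x - f j x))\<^sup>2 \<partial>M) < (e / V)\<^sup>2"
        using C by blast
      have "(\<integral>x. cmod (f i x - f j x) \<partial>M) < e" if "i \<ge> N" "j \<ge> N" for i j
      proof -
        have "(\<integral>x. cmod (f i x - f j x) \<partial>M)\<^sup>2 \<le> measure M (space M) * (\<integral>x. (cmod (f i x - f j x))\<^sup>2 \<partial>M)"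
          using square_integrable_imp_integrable[OF square_integrable_diff[OF f[of i] f[of j]]]
          by (intro integral_squared_le sq integrable_norm)
        also have "\<dots> \<le> V * (\<integral>x. (cmod (f i x - f j x))\<^sup>2 \<partial>M)"
          by (intro mult_right_mono) (auto simp: V_def)
        also have "\<dots> < V * (e / V)\<^sup>2"
          using N[OF that] V by simp
        also have "\<dots> = e\<^sup>2 / V" using V by (simp add: power2_eq_square)
        also have "\<dots> \<le> e\<^sup>2"
        proof -
          have "e\<^sup>2 * 1 \<le> e\<^sup>2 * V" by (intro mult_left_mono) (auto simp: V_def)
          then show ?thesis using V by (simp add: divide_le_eq)
        qed
        finally show ?thesis using \<open>e > 0\<close> by (simp add: power2_less_imp_less)
      qed
      then show "\<exists>N. \<forall>i\<ge>N. \<forall>j\<ge>N. (\<integral>x. norm (f i x - f j x) \<partial>M) < e" by blast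
    qed
    define h where "h x = lim (\<lambda>i. f (r i) x)" for x
    have [measurable]: "h \<in> borel_measurable M" unfolding h_def[abs_def] by measurable
    have lim: "AE x in M. (\<lambda>i. f (r i) x) \<longlonglongrightarrow> h x"
      using r(2) by eventually_elim (simp add: h_def Cauchy_convergent_iff convergent_LIMSEQ_iff)
    have bound: "\<exists>N. \<forall>n\<ge>N. (\<integral>\<^sup>+x. ennreal ((cmod (f n x - h x))\<^sup>2) \<partial>M) \<le> ennreal (e\<^sup>2)" if "e > 0" for e
    proof -
      obtain N where N: "\<And>i j. i \<ge> N \<Longrightarrow> j \<ge> N \<Longrightarrow> (\<integral>x. (cmod (f i x - f j x))\<^sup>2 \<partial>M) < e\<^sup>2"
        using C[OF \<open>e > 0\<close>] by blast
      have "(\<integral>\<^sup>+x. ennreal ((cmod (f n x - h x))\<^sup>2) \<partial>M) \<le> ennreal (e\<^sup>2)" if "n \<ge> N" for n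
      proof -
        have "(\<integral>\<^sup>+x. ennreal ((cmod (f n x - h x))\<^sup>2) \<partial>M)
            = (\<integral>\<^sup>+x. liminf (\<lambda>i. ennreal ((cmod (f n x - f (r i) x))\<^sup>2)) \<partial>M)"
        proof (rule nn_integral_cong_AE)
          show "AE x in M. ennreal ((cmod (f n x - h x))\<^sup>2) = liminf (\<lambda>i. ennreal ((cmod (f n x - f (r i) x))\<^sup>2))"
            using lim
          proof eventually_elim
            case (elim x)
            have "(\<lambda>i. ennreal ((cmod (f n x - f (r i) x))\<^sup>2)) \<longlonglongrightarrow> ennreal ((cmod (f n x - h x))\<^sup>2)"
              by (intro tendsto_intros elim)
            then show ?case by (intro lim_imp_Liminf[symmetric]) auto
          qed
        qed
        also have "\<dots> \<le> liminf (\<lambda>i. \<integral>\<^sup>+x. ennreal ((cmod (f n x - f (r i) x))\<^sup>2) \<partial>M)"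
          by (rule nn_integral_liminf) measurable
        also have "\<dots> \<le> ennreal (e\<^sup>2)"
        proof (rule Liminf_le)
          have "eventually (\<lambda>i. i \<ge> N) sequentially" by (rule eventually_ge_at_top)
          then show "eventually (\<lambda>i. (\<integral>\<^sup>+x. ennreal ((cmod (f n x - f (r i) x))\<^sup>2) \<partial>M) \<le> ennreal (e\<^sup>2)) sequentially"
          proof eventually_elim
            case (elim i)
            then have "r i \<ge> N" using seq_suble[OF r(1), of i] by simp
            then have "(\<integral>x. (cmod (f n x - f (r i) x))\<^sup>2 \<partial>M) < e\<^sup>2" using N that by simp
            then show ?case using sq[of n "r i"]
              by (subst nn_integral_eq_integral) (auto intro: ennreal_leI less_imp_le)
          qed
        qed simp
        finally show ?thesis .
      qed
      then show ?thesis by blast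
    qed
    have diff: "\<exists>N. \<forall>n\<ge>N. (\<lambda>x. f n x - h x) \<in> square_integrable M \<and> (\<integral>x. (cmod (f n x - h x))\<^sup>2 \<partial>M) \<le> e\<^sup>2"
      if "e > 0" for e
    proof -
      obtain N where N: "\<And>n. n \<ge> N \<Longrightarrow> (\<integral>\<^sup>+x. ennreal ((cmod (f n x - h x))\<^sup>2) \<partial>M) \<le> ennreal (e\<^sup>2)"
        using bound[OF \<open>e > 0\<close>] by blast
      have "(\<lambda>x. f n x - h x) \<in> square_integrable M \<and> (\<integral>x. (cmod (f n x - h x))\<^sup>2 \<partial>M) \<le> e\<^sup>2" if "n \<ge> N" for n
      proof -
        have "(\<integral>\<^sup>+x. ennreal ((cmod (f n x - h x))\<^sup>2) \<partial>M) < \<infinity>"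
          using N[OF that] by (simp add: le_less_trans)
        then have i: "integrable M (\<lambda>x. (cmod (f n x - h x))\<^sup>2)"
          by (intro integrableI_nonneg) auto
        then have "ennreal (\<integral>x. (cmod (f n x - h x))\<^sup>2 \<partial>M) \<le> ennreal (e\<^sup>2)"
          using N[OF that] by (subst (asm) nn_integral_eq_integral) auto
        then show ?thesis using i by (auto simp: square_integrable_def)
      qed
      then show ?thesis by blast
    qed
    have h: "h \<in> square_integrable M"
    proof -
      obtain n where n: "(\<lambda>x. f n x - h x) \<in> square_integrable M" using diff[of 1] by auto
      from square_integrable_diff[OF f[of n] n] show ?thesis by simp
    qed
    have "limitin L2.mtopology \<sigma> (L2_class M h) sequentially"
      unfolding L2.limit_metric_sequentially
    proof (intro conjI allI impI)
      show "L2_class M h \<in> L2_space M" by (rule L2_class_in_L2_space[OF h])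
      fix e :: real assume "e > 0"
      then obtain N where N: "\<And>n. n \<ge> N \<Longrightarrow> (\<integral>x. (cmod (f n x - h x))\<^sup>2 \<partial>M) \<le> (e/2)\<^sup>2"
        using diff[of "e/2"] by auto
      have "L2_dist M (\<sigma> n) (L2_class M h) < e" if "n \<ge> N" for n
      proof -
        have "L2_dist M (\<sigma> n) (L2_class M h) \<le> sqrt ((e/2)\<^sup>2)"
          unfolding \<sigma>f L2_dist_class[OF f h] by (intro real_sqrt_le_mono N that)
        also have "\<dots> < e" using \<open>e > 0\<close> by simp
        finally show ?thesis .
      qed
      then show "\<exists>N. \<forall>n\<ge>N. \<sigma> n \<in> L2_space M \<and> L2_dist M (\<sigma> n) (L2_class M h) < e"
        using L2_class_in_L2_space[OF f] \<sigma>f by auto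
    qed
    then show "\<exists>x. limitin L2.mtopology \<sigma> x sequentially" by blast
  qed
qed

lemma (in finite_measure) precompactin_L2_iff:
  "precompactin (L2_topology M) S \<longleftrightarrow> Metric_space.mtotally_bounded (L2_space M) (L2_dist M) S"
proof -
  interpret L2: Metric_space "L2_space M" "L2_dist M" by (rule Metric_space_L2)
  show ?thesis
    using L2.mtotally_bounded_eq_compact_closure_of[OF mcomplete_L2]
    by (simp add: precompactin_def L2_topology_def)
qed

context folner_system
begin

text \<open>The squared \<open>L\<^sup>2\<close>-distance of two translates, taken on functions
  instead of classes so that it can be manipulated as an integral.\<close>

definition L2_gap :: "('x \<Rightarrow> complex) \<Rightarrow> 'g \<Rightarrow> 'g \<Rightarrow> real" where
  "L2_gap f s t = (\<integral>x. (cmod (f (act s x) - f (act t x)))\<^sup>2 \<partial>\<mu>)"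

lemma continuous_bounded:
  fixes f :: "'x \<Rightarrow> 'b::real_normed_vector"
  assumes "continuous_on UNIV f"
  obtains M where "M \<ge> 1" "\<And>x. norm (f x) \<le> M"
proof -
  have "bounded (range f)" using compact_continuous_image[OF assms compact_X] compact_imp_bounded by blast
  then obtain M where "\<And>x. norm (f x) \<le> M" by (auto simp: bounded_iff)
  then show ?thesis using that[of "max M 1"] by (meson max.cobounded1 max.cobounded2 order_trans)
qed

lemma square_integrable_orbit:
  assumes "continuous_on UNIV f"
  shows "(\<lambda>x. f (act g x)) \<in> square_integrable \<mu>"
proof -
  obtain M where M: "\<And>x. norm (f x) \<le> M" using continuous_bounded[OF assms] by blast
  have [measurable]: "f \<in> borel_measurable borel" by (rule borel_measurable_continuous_onI[OF assms])
  have "integrable \<mu> (\<lambda>x. (cmod (f (act g x)))\<^sup>2)"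
    by (rule mu.integrable_const_bound[of _ "M\<^sup>2"]) (auto intro!: power_mono M)
  then show ?thesis by (simp add: square_integrable_def)
qed

text \<open>By completeness precompact means totally bounded, and in \<open>mtotally_bounded\<close>
  the centers of a net belong to the set itself. They are thus translates of \<open>f\<close>, given
  by a finite set \<open>T\<close> of group elements.\<close>

lemma discrete_spectrum_iff:
  "discrete_spectrum act \<mu> \<longleftrightarrow> (\<forall>f :: 'x \<Rightarrow> complex. continuous_on UNIV f \<longrightarrow>
     (\<forall>\<epsilon>>0. \<exists>T. finite T \<and> (\<forall>g. \<exists>t\<in>T. L2_gap f t g < \<epsilon>)))"
proof -
  interpret L2: Metric_space "L2_space \<mu>" "L2_dist \<mu>" by (rule Metric_space_L2)
  have "precompactin (L2_topology \<mu>) {L2_class \<mu> (\<lambda>x. f (act g x)) | g. True} \<longleftrightarrow>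
      (\<forall>\<epsilon>>0. \<exists>T. finite T \<and> (\<forall>g. \<exists>t\<in>T. L2_gap f t g < \<epsilon>))" (is "?L \<longleftrightarrow> ?R")
    if f: "continuous_on UNIV f" for f :: "'x \<Rightarrow> complex"
  proof -
    define c where "c g = L2_class \<mu> (\<lambda>x. f (act g x))" for g
    have cL: "c g \<in> L2_space \<mu>" for g
      unfolding c_def by (rule L2_class_in_L2_space[OF square_integrable_orbit[OF f]])
    have dc: "L2_dist \<mu> (c s) (c t) = sqrt (L2_gap f s t)" for s t
      unfolding c_def L2_gap_def by (rule L2_dist_class) (intro square_integrable_orbit f)+
    have "?L \<longleftrightarrow> L2.mtotally_bounded (range c)"
      unfolding mu.precompactin_L2_iff by (simp add: c_def[symmetric] full_SetCompr_eq)
    also have "\<dots> \<longleftrightarrow> (\<forall>\<epsilon>>0. \<exists>T. finite T \<and> (\<forall>g. \<exists>t\<in>T. L2_gap f t g < \<epsilon>\<^sup>2))"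
      unfolding L2.mtotally_bounded_def
    proof (intro all_cong1 imp_cong refl)
      fix \<epsilon> :: real assume e: "\<epsilon> > 0"
      have ball: "c g \<in> L2.mball (c t) \<epsilon> \<longleftrightarrow> L2_gap f t g < \<epsilon>\<^sup>2" for g t
        using e cL by (simp add: L2.in_mball dc sqrt_less_iff_less_power2)
      show "(\<exists>K. finite K \<and> K \<subseteq> range c \<and> range c \<subseteq> (\<Union>x\<in>K. L2.mball x \<epsilon>)) \<longleftrightarrow>
          (\<exists>T. finite T \<and> (\<forall>g. \<exists>t\<in>T. L2_gap f t g < \<epsilon>\<^sup>2))"
      proof
        assume "\<exists>K. finite K \<and> K \<subseteq> range c \<and> range c \<subseteq> (\<Union>x\<in>K. L2.mball x \<epsilon>)"
        then obtain K where K: "finite K" "K \<subseteq> range c" "range c \<subseteq> (\<Union>x\<in>K. L2.mball x \<epsilon>)"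
          by (elim exE conjE)
        then obtain T where T: "finite T" "K = c ` T" by (meson finite_subset_image)
        have "\<exists>t\<in>T. L2_gap f t g < \<epsilon>\<^sup>2" for g
        proof -
          have "c g \<in> (\<Union>x\<in>c ` T. L2.mball x \<epsilon>)" using K(3) unfolding T(2) by blast
          then show ?thesis unfolding UN_iff bex_simps ball .
        qed
        then show "\<exists>T. finite T \<and> (\<forall>g. \<exists>t\<in>T. L2_gap f t g < \<epsilon>\<^sup>2)" using T(1) by blast
      next
        assume "\<exists>T. finite T \<and> (\<forall>g. \<exists>t\<in>T. L2_gap f t g < \<epsilon>\<^sup>2)"
        then obtain T where T: "finite T" "\<And>g. \<exists>t\<in>T. L2_gap f t g < \<epsilon>\<^sup>2" by blast
        then have "range c \<subseteq> (\<Union>x\<in>c ` T. L2.mball x \<epsilon>)" using ball by auto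
        then show "\<exists>K. finite K \<and> K \<subseteq> range c \<and> range c \<subseteq> (\<Union>x\<in>K. L2.mball x \<epsilon>)"
          using T(1) by (intro exI[of _ "c ` T"]) auto
      qed
    qed
    also have "\<dots> \<longleftrightarrow> ?R"
    proof
      assume L: "\<forall>\<epsilon>>0. \<exists>T. finite T \<and> (\<forall>g. \<exists>t\<in>T. L2_gap f t g < \<epsilon>\<^sup>2)"
      show ?R
      proof (intro allI impI)
        fix \<epsilon> :: real assume "\<epsilon> > 0"
        then show "\<exists>T. finite T \<and> (\<forall>g. \<exists>t\<in>T. L2_gap f t g < \<epsilon>)"
          using L[rule_format, of "sqrt \<epsilon>"] by simp
      qed
    next
      assume R: ?R
      show "\<forall>\<epsilon>>0. \<exists>T. finite T \<and> (\<forall>g. \<exists>t\<in>T. L2_gap f t g < \<epsilon>\<^sup>2)"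
        using R by simp
    qed
    finally show ?thesis .
  qed
  then show ?thesis unfolding discrete_spectrum_def by blast
qed

end

section \<open>Mean equicontinuity implies discrete spectrum\<close>

context folner_system
begin

section \<open>Averages over Folner sets\<close>

lemma emeasure_compact_finite: "compact K \<Longrightarrow> emeasure m K < \<infinity>"
  using haar by (simp add: left_haar_measure_def)

lemma emeasure_sym_diff_finite: "emeasure m (sym_diff ((+) g ` F n) (F n)) < \<infinity>"
proof -
  have "emeasure m ((+) g ` F n \<union> F n) < \<infinity>"
    by (intro emeasure_compact_finite compact_Un compact_translate compact_F)
  moreover have "(+) g ` F n \<union> F n \<in> sets m"
    using compact_Un[OF compact_translate[OF compact_F] compact_F] by (simp add: compact_imp_closed)
  then have "emeasure m (sym_diff ((+) g ` F n) (F n)) \<le> emeasure m ((+) g ` F n \<union> F n)"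
    by (intro emeasure_mono) auto
  ultimately show ?thesis by (rule le_less_trans[rotated])
qed

definition avg :: "nat \<Rightarrow> ('g \<Rightarrow> real) \<Rightarrow> real" where
  "avg n k = 1 / measure m (F n) * (LINT g:F n|m. k g)"

lemma mean_dist_eq: "mean_dist act m (F n) x y = avg n (\<lambda>g. dist (act g x) (act g y))"
  by (simp add: mean_dist_def avg_def)

lemma set_integrable_F:
  fixes k :: "'g \<Rightarrow> real"
  assumes [measurable]: "k \<in> borel_measurable borel" and K: "\<And>g. \<bar>k g\<bar> \<le> K"
  shows "set_integrable m (F n) k"
  unfolding set_integrable_def
proof (rule Bochner_Integration.integrable_bound)
  show "integrable m (\<lambda>g. indicator (F n) g * K)"
    using F_finite[of n] by (intro integrable_mult_left integrable_real_indicator) auto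
  show "(\<lambda>g. indicat_real (F n) g *\<^sub>R k g) \<in> borel_measurable m" by measurable
  show "AE g in m. norm (indicat_real (F n) g *\<^sub>R k g) \<le> norm (indicat_real (F n) g * K)"
    using K order_trans[OF K abs_ge_self] by (auto split: split_indicator)
qed

lemma nn_integral_avg:
  assumes [measurable]: "k \<in> borel_measurable borel" and "\<And>g. 0 \<le> k g" "\<And>g. k g \<le> K"
  shows "(\<integral>\<^sup>+g\<in>F n. ennreal (k g) \<partial>m) = emeasure m (F n) * ennreal (avg n k)"
proof -
  have "(\<integral>\<^sup>+g\<in>F n. ennreal (k g) \<partial>m) = (\<integral>\<^sup>+g. ennreal (indicator (F n) g *\<^sub>R k g) \<partial>m)"
    by (intro nn_integral_cong) (auto split: split_indicator)
  also have "\<dots> = ennreal (LINT g:F n|m. k g)"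
    unfolding set_lebesgue_integral_def
    using set_integrable_F[of k K n] assms
    by (intro nn_integral_eq_integral) (auto simp: set_integrable_def)
  also have "\<dots> = ennreal (measure m (F n) * avg n k)"
    using measure_F_pos[of n] by (simp add: avg_def)
  also have "\<dots> = emeasure m (F n) * ennreal (avg n k)"
    by (simp add: emeasure_F ennreal_mult')
  finally show ?thesis .
qed

lemma avg_nonneg: "(\<And>g. 0 \<le> k g) \<Longrightarrow> 0 \<le> avg n k"
  unfolding avg_def set_lebesgue_integral_def by (intro mult_nonneg_nonneg integral_nonneg) auto

lemma avg_le_const:
  assumes [measurable]: "k \<in> borel_measurable borel" and "\<And>g. 0 \<le> k g" "\<And>g. k g \<le> K"
  shows "avg n k \<le> K"
proof -
  have "K \<ge> 0" using assms(2,3) order_trans by blast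
  have "emeasure m (F n) * ennreal (avg n k) \<le> (\<integral>\<^sup>+g\<in>F n. ennreal K \<partial>m)"
    unfolding nn_integral_avg[of k K n, OF assms, symmetric]
    by (intro nn_integral_mono mult_right_mono ennreal_leI assms) auto
  also have "\<dots> = emeasure m (F n) * ennreal K"
    by (simp add: nn_integral_cmult mult.commute)
  finally have "ennreal (avg n k) \<le> ennreal K"
    by (simp add: ennreal_mult_le_mult_iff)
  then show ?thesis using \<open>K \<ge> 0\<close> by simp
qed

lemma dist_bounded:
  obtains D where "D > 0" "\<And>x y :: 'x. dist x y \<le> D"
proof -
  have "bounded (UNIV :: 'x set)" by (rule compact_imp_bounded[OF compact_X])
  then obtain D where "\<And>x y :: 'x. dist x y \<le> D"
    unfolding bounded_two_points by blast
  then show ?thesis using that[of "max D 1"] by (meson less_max_iff_disj max.coboundedI1 zero_less_one)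
qed

lemma measurable_mean_dist [measurable (raw)]:
  assumes [measurable]: "p \<in> borel_measurable borel" "q \<in> borel_measurable borel"
  shows "(\<lambda>x. mean_dist act m (F n) (p x) (q x)) \<in> borel_measurable borel"
  unfolding mean_dist_def set_lebesgue_integral_def by measurable

text \<open>Near pairs cost at most \<open>\<eta>\<close> by uniform continuity; at distance at
  least \<open>d\<close> the trivial bound \<open>4 * M\<^sup>2\<close> is paid by the linear term
  with \<open>L = 4 * M\<^sup>2 / d\<close>. A bound linear in the distance can be averaged, which
  turns \<open>mean_dist\<close> into control of \<open>f\<close>.\<close>

lemma uniformly_dominated_by_dist:
  fixes f :: "'x \<Rightarrow> 'b::real_normed_vector"
  assumes f: "continuous_on UNIV f" and "\<eta> > 0"
  obtains L where "L > 0" "\<And>u v. (norm (f u - f v))\<^sup>2 \<le> \<eta> + L * dist u v"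
proof -
  obtain M where M: "M \<ge> 1" "\<And>x. norm (f x) \<le> M" using continuous_bounded[OF f] by blast
  have "uniformly_continuous_on UNIV f" by (rule compact_uniformly_continuous[OF f compact_X])
  then obtain d where d: "d > 0" "\<And>u v. dist v u < d \<Longrightarrow> dist (f v) (f u) < sqrt \<eta>"
    using \<open>\<eta> > 0\<close> unfolding uniformly_continuous_on_def by (metis UNIV_I real_sqrt_gt_0_iff)
  have "(norm (f u - f v))\<^sup>2 \<le> \<eta> + 4 * M\<^sup>2 / d * dist u v" for u v
  proof (cases "dist u v < d")
    case True
    then have "norm (f u - f v) < sqrt \<eta>" using d(2)[of u v] by (simp add: dist_norm)
    then have "(norm (f u - f v))\<^sup>2 \<le> (sqrt \<eta>)\<^sup>2" by (intro power_mono) auto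
    also have "\<dots> = \<eta>" using \<open>\<eta> > 0\<close> by simp
    finally show ?thesis using d(1) by (simp add: add_increasing2)
  next
    case False
    have "norm (f u - f v) \<le> 2 * M" using norm_triangle_ineq4[of "f u" "f v"] M(2)[of u] M(2)[of v] by linarith
    then have "(norm (f u - f v))\<^sup>2 \<le> (2 * M)\<^sup>2" by (intro power_mono) auto
    also have "\<dots> = 4 * M\<^sup>2 / d * d" using d(1) by (simp add: power2_eq_square)
    also have "\<dots> \<le> 4 * M\<^sup>2 / d * dist u v" using False d(1) by (intro mult_left_mono) auto
    finally show ?thesis using \<open>\<eta> > 0\<close> by simp
  qed
  then show ?thesis using that[of "4 * M\<^sup>2 / d"] d(1) M(1) by simp
qed

text \<open>The map \<open>f \<circ> act h \<circ> p\<close> is constant on the fibres of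
  \<open>p\<close>; it is the step function approximating \<open>f \<circ> act h\<close>. The value
  lies in \<open>ennreal\<close> so that Tonelli applies directly.\<close>

definition step_error :: "('x \<Rightarrow> complex) \<Rightarrow> ('x \<Rightarrow> 'x) \<Rightarrow> 'g \<Rightarrow> ennreal" where
  "step_error f p h = (\<integral>\<^sup>+x. ennreal ((cmod (f (act h x) - f (act h (p x))))\<^sup>2) \<partial>\<mu>)"

text \<open>For \<open>x \<in> Q\<close> the points \<open>x\<close> and \<open>p x\<close> both lie
  in \<open>Q\<close> and are \<open>\<delta>\<close>-close, so mean equicontinuity controls their
  mean distance, for fixed \<open>x\<close> and \<open>h\<close> averaged over \<open>F n\<close>.
  Tonelli rereads this as a statement on \<open>step_error\<close> for most
  \<open>h\<close>.\<close>

lemma eventually_small_step_error: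
  assumes me: "mean_equicontinuous_measure act m F \<mu>" and f: "continuous_on UNIV f" and "\<eta> > 0"
  obtains p where "p \<in> borel_measurable borel" "finite (range p)"
    "eventually (\<lambda>n. (\<integral>\<^sup>+h\<in>F n. step_error f p h \<partial>m) \<le> ennreal \<eta> * emeasure m (F n)) sequentially"
proof -
  have [measurable]: "f \<in> borel_measurable borel" by (rule borel_measurable_continuous_onI[OF f])
  obtain M where M: "M \<ge> 1" "\<And>x. cmod (f x) \<le> M" using continuous_bounded[OF f] by blast
  obtain L where L: "L > 0" "\<And>u v. (norm (f u - f v))\<^sup>2 \<le> \<eta>/4 + L * dist u v"
    using uniformly_dominated_by_dist[OF f, of "\<eta>/4"] \<open>\<eta> > 0\<close> by (metis zero_less_divide_iff zero_less_numeral)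
  obtain D where D: "D > 0" "\<And>x y :: 'x. dist x y \<le> D" using dist_bounded by blast
  \<comment> \<open>Off \<open>Q\<close> only the bound \<open>4 * M\<^sup>2\<close> is available,
    which then costs at most \<open>\<eta>/4\<close>; the \<open>1/2\<close> keeps \<open>Q\<close>
    nonempty.\<close>
  define \<tau> where "\<tau> = min (1/2) (\<eta> / (16 * M\<^sup>2))"
  have "\<tau> > 0" using \<open>\<eta> > 0\<close> M(1) by (simp add: \<tau>_def)
  obtain Q where Q: "compact Q" "measure \<mu> Q > 1 - \<tau>" "mean_equicontinuous_on act m F Q"
    using me \<open>\<tau> > 0\<close> unfolding mean_equicontinuous_measure_def by blast
  have "Q \<noteq> {}" using Q(2) by (auto simp: \<tau>_def)
  have [measurable]: "Q \<in> sets borel" using Q(1) by (simp add: compact_imp_closed)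
  have muQ: "measure \<mu> (- Q) \<le> \<tau>"
    using mu.finite_measure_compl[of Q] Q(2) by (simp add: Compl_eq_Diff_UNIV)
  define \<epsilon> where "\<epsilon> = \<eta> / (4 * L)"
  have "\<epsilon> > 0" using \<open>\<eta> > 0\<close> L(1) by (simp add: \<epsilon>_def)
  obtain \<delta> where "\<delta> > 0" and \<delta>_all: "\<forall>x\<in>Q. \<forall>y\<in>Q. dist x y < \<delta> \<longrightarrow>
        limsup (\<lambda>n. ereal (mean_dist act m (F n) x y)) < ereal \<epsilon>"
    using Q(3)[unfolded mean_equicontinuous_on_def, rule_format, OF \<open>\<epsilon> > 0\<close>] by (elim exE conjE)
  note \<delta> = \<open>\<delta> > 0\<close> \<delta>_all[rule_format]
  obtain p where p: "p \<in> measurable borel (count_space UNIV)" "finite (range p)"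
    "range p \<subseteq> Q" "\<And>x. x \<in> Q \<Longrightarrow> dist x (p x) < \<delta>"
    by (rule finite_measurable_net[OF Q(1) \<open>Q \<noteq> {}\<close> \<delta>(1)], rule that)
  have p_meas [measurable]: "p \<in> borel_measurable borel"
    using measurable_compose[OF p(1), of "\<lambda>y. y" borel] by simp
  define E where "E n x = mean_dist act m (F n) x (p x)" for n x
  have [measurable]: "E n \<in> borel_measurable borel" for n
    unfolding E_def[abs_def] by measurable
  have E0: "0 \<le> E n x" for n x unfolding E_def mean_dist_eq by (intro avg_nonneg) simp
  have ED: "E n x \<le> D" for n x
    unfolding E_def mean_dist_eq by (intro avg_le_const) (auto simp: D)
  \<comment> \<open>The excess over \<open>\<epsilon>\<close> on \<open>Q\<close>. At each point it
    vanishes from some \<open>n\<close> on, without uniformity in the point; dominated convergence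
    makes its integral small.\<close>
  define s where "s n x = indicator Q x * max (E n x - \<epsilon>) 0" for n x
  have [measurable]: "s n \<in> borel_measurable borel" for n
    unfolding s_def[abs_def] by measurable
  have s0: "0 \<le> s n x" for n x by (auto simp: s_def)
  have sD: "s n x \<le> D" for n x using ED[of n x] D(1) \<open>\<epsilon> > 0\<close> by (auto simp: s_def split: split_indicator)
  have "(\<lambda>n. \<integral>x. s n x \<partial>\<mu>) \<longlonglongrightarrow> (\<integral>x. 0 \<partial>\<mu>)"
  proof (rule integral_dominated_convergence[where w = "\<lambda>_. D"])
    show "AE x in \<mu>. (\<lambda>n. s n x) \<longlonglongrightarrow> 0"
    proof (rule AE_I2)
      fix x
      show "(\<lambda>n. s n x) \<longlonglongrightarrow> 0"
      proof (cases "x \<in> Q")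
        case True
        then have "limsup (\<lambda>n. ereal (E n x)) < ereal \<epsilon>"
          unfolding E_def using \<delta>(2) p(3,4) by (simp add: image_subset_iff)
        then have "eventually (\<lambda>n. ereal (E n x) < ereal \<epsilon>) sequentially" by (rule Limsup_lessD)
        then have "eventually (\<lambda>n. s n x = 0) sequentially"
          by eventually_elim (simp add: s_def)
        then show ?thesis by (rule tendsto_eventually)
      qed (simp add: s_def)
    qed
    show "AE x in \<mu>. norm (s n x) \<le> D" for n using s0 sD by simp
  qed auto
  then have "eventually (\<lambda>n. (\<integral>x. s n x \<partial>\<mu>) < \<eta> / (4 * L)) sequentially"
    using \<open>\<eta> > 0\<close> L(1) by (intro order_tendstoD(2)) auto
  then have ev: "eventually (\<lambda>n. (\<integral>\<^sup>+h\<in>F n. step_error f p h \<partial>m) \<le> ennreal \<eta> * emeasure m (F n)) sequentially"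
  proof eventually_elim
    case (elim n)
    have int_s: "integrable \<mu> (s n)"
      by (rule mu.integrable_const_bound[of _ D]) (auto simp: s0 sD)
    define V where "V x = (\<integral>\<^sup>+h\<in>F n. ennreal ((cmod (f (act h x) - f (act h (p x))))\<^sup>2) \<partial>m)" for x
    \<comment> \<open>A pointwise majorant with four terms, each of integral at most
      \<open>\<eta>/4\<close>: oscillation of \<open>f\<close>, the bound \<open>\<epsilon>\<close>
      on \<open>Q\<close>, the excess \<open>s\<close>, and the complement of
      \<open>Q\<close>.\<close>
    define U where "U x = \<eta>/4 + L * \<epsilon> + L * s n x + indicator (- Q) x * (4 * M\<^sup>2)" for x
    have U0: "0 \<le> U x" for x
      unfolding U_def using \<open>\<eta> > 0\<close> L(1) \<open>\<epsilon> > 0\<close> s0[of n x] by (intro add_nonneg_nonneg) auto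
    have ind_Q: "integrable \<mu> (indicat_real (- Q))"
      by (rule mu.integrable_const_bound[of _ 1]) auto
    then have int_U: "integrable \<mu> U"
      unfolding U_def[abs_def] using int_s by (intro Bochner_Integration.integrable_add) auto
    have V_le: "V x \<le> emeasure m (F n) * ennreal (U x)" for x
    proof -
      have bd: "(cmod (f u - f v))\<^sup>2 \<le> 4 * M\<^sup>2" for u v
      proof -
        have "cmod (f u - f v) \<le> 2 * M" using norm_triangle_ineq4[of "f u" "f v"] M(2)[of u] M(2)[of v] by linarith
        then have "(cmod (f u - f v))\<^sup>2 \<le> (2 * M)\<^sup>2" by (intro power_mono) auto
        then show ?thesis by simp
      qed
      have V_avg: "V x = emeasure m (F n) * ennreal (avg n (\<lambda>h. (cmod (f (act h x) - f (act h (p x))))\<^sup>2))"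
        unfolding V_def by (rule nn_integral_avg[where K = "4 * M\<^sup>2"]) (auto intro: bd)
      have "avg n (\<lambda>h. (cmod (f (act h x) - f (act h (p x))))\<^sup>2) \<le> U x"
      proof (cases "x \<in> Q")
        case False
        have "avg n (\<lambda>h. (cmod (f (act h x) - f (act h (p x))))\<^sup>2) \<le> 4 * M\<^sup>2"
          by (rule avg_le_const) (auto intro: bd)
        also have "\<dots> \<le> U x"
          using False \<open>\<eta> > 0\<close> L(1) \<open>\<epsilon> > 0\<close> s0[of n x] by (simp add: U_def)
        finally show ?thesis .
      next
        case True
        have "avg n (\<lambda>h. (cmod (f (act h x) - f (act h (p x))))\<^sup>2)
            \<le> avg n (\<lambda>h. \<eta>/4 + L * dist (act h x) (act h (p x)))"
          unfolding avg_def
        proof (intro mult_left_mono set_integral_mono)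
          show "set_integrable m (F n) (\<lambda>h. (cmod (f (act h x) - f (act h (p x))))\<^sup>2)"
            by (rule set_integrable_F[where K = "4 * M\<^sup>2"]) (auto intro: bd)
          show "set_integrable m (F n) (\<lambda>h. \<eta>/4 + L * dist (act h x) (act h (p x)))"
            using L(1) \<open>\<eta> > 0\<close> D by (intro set_integrable_F[where K = "\<eta>/4 + L * D"]) auto
        qed (use L in auto)
        also have "\<dots> = \<eta>/4 + L * E n x"
        proof -
          have i: "set_integrable m (F n) (\<lambda>h. c)" for c :: real
            by (rule set_integrable_F[where K = "\<bar>c\<bar>"]) auto
          have "(LINT h:F n|m. \<eta>/4 + L * dist (act h x) (act h (p x)))
              = (LINT h:F n|m. \<eta>/4) + L * (LINT h:F n|m. dist (act h x) (act h (p x)))"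
            using D set_integrable_F[of "\<lambda>h. dist (act h x) (act h (p x))" D n]
            by (subst set_integral_add(2)) (auto intro!: i)
          also have "(LINT h:F n|m. \<eta>/4) = \<eta>/4 * measure m (F n)"
            by (simp add: set_lebesgue_integral_def)
          finally show ?thesis
            using measure_F_pos[of n] by (simp add: avg_def E_def mean_dist_def field_simps)
        qed
        also have "\<dots> \<le> U x"
        proof -
          have "E n x \<le> \<epsilon> + s n x" using True by (auto simp: s_def)
          then have "L * E n x \<le> L * (\<epsilon> + s n x)" using L(1) by simp
          then show ?thesis using True by (simp add: U_def distrib_left)
        qed
        finally show ?thesis .
      qed
      then show ?thesis unfolding V_avg by (intro mult_left_mono ennreal_leI) auto
    qed
    have "(\<integral>x. U x \<partial>\<mu>) = \<eta>/4 + L * \<epsilon> + L * (\<integral>x. s n x \<partial>\<mu>) + measure \<mu> (- Q) * (4 * M\<^sup>2)"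
      unfolding U_def using int_s ind_Q by simp
    also have "\<dots> \<le> \<eta>"
    proof -
      have "L * (\<integral>x. s n x \<partial>\<mu>) \<le> \<eta>/4" "L * \<epsilon> = \<eta>/4"
        using elim L(1) by (simp_all add: \<epsilon>_def field_simps)
      moreover have "measure \<mu> (- Q) * (4 * M\<^sup>2) \<le> \<eta> / (16 * M\<^sup>2) * (4 * M\<^sup>2)"
        using muQ by (intro mult_right_mono) (auto simp: \<tau>_def)
      moreover have "\<eta> / (16 * M\<^sup>2) * (4 * M\<^sup>2) = \<eta>/4" using M(1) by simp
      ultimately show ?thesis by linarith
    qed
    finally have U_le: "(\<integral>x. U x \<partial>\<mu>) \<le> \<eta>" .
    have "(\<integral>\<^sup>+h\<in>F n. step_error f p h \<partial>m)
        = (\<integral>\<^sup>+h. (\<integral>\<^sup>+x. ennreal ((cmod (f (act h x) - f (act h (p x))))\<^sup>2) * indicator (F n) h \<partial>\<mu>) \<partial>m)"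
      unfolding step_error_def by (intro nn_integral_cong nn_integral_multc[symmetric]) measurable
    also have "\<dots> = (\<integral>\<^sup>+x. V x \<partial>\<mu>)"
      unfolding V_def by (rule m_mu.Fubini'[symmetric]) measurable
    also have "\<dots> \<le> (\<integral>\<^sup>+x. emeasure m (F n) * ennreal (U x) \<partial>\<mu>)"
      by (intro nn_integral_mono V_le)
    also have "\<dots> = emeasure m (F n) * (\<integral>\<^sup>+x. ennreal (U x) \<partial>\<mu>)"
      by (intro nn_integral_cmult) (auto simp: U_def)
    also have "(\<integral>\<^sup>+x. ennreal (U x) \<partial>\<mu>) = ennreal (\<integral>x. U x \<partial>\<mu>)"
      by (rule nn_integral_eq_integral[OF int_U]) (simp add: U0)
    also have "emeasure m (F n) * ennreal (\<integral>x. U x \<partial>\<mu>) \<le> ennreal \<eta> * emeasure m (F n)"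
      unfolding mult.commute[of "emeasure m (F n)"] by (intro mult_right_mono ennreal_leI U_le) simp
    finally show ?case .
  qed
  from that[OF p_meas p(2) ev] show ?thesis .
qed


lemma measurable_step_error [measurable]:
  assumes [measurable]: "f \<in> borel_measurable borel" "p \<in> borel_measurable borel"
  shows "step_error f p \<in> borel_measurable borel"
  unfolding step_error_def[abs_def] by measurable

lemma nn_integral_F_translate_le:
  assumes [measurable]: "b \<in> borel_measurable borel" and K: "\<And>h. b h \<le> K"
  shows "(\<integral>\<^sup>+h\<in>F n. b (t + h) \<partial>m) \<le> (\<integral>\<^sup>+h\<in>F n. b h \<partial>m) + K * emeasure m (sym_diff ((+) t ` F n) (F n))"
proof -
  have [measurable]: "(+) t ` F n \<in> sets borel"
    by (simp add: compact_imp_closed compact_translate compact_F)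
  have "(\<integral>\<^sup>+h\<in>F n. b (t + h) \<partial>m) = (\<integral>\<^sup>+h. b (t + h) * indicator ((+) t ` F n) (t + h) \<partial>m)"
    by (intro nn_integral_cong) (auto split: split_indicator)
  also have "\<dots> = (\<integral>\<^sup>+h. b h * indicator ((+) t ` F n) h \<partial>m)"
    by (rule nn_integral_left_translation) measurable
  also have "\<dots> \<le> (\<integral>\<^sup>+h. b h * indicator (F n) h + K * indicator (sym_diff ((+) t ` F n) (F n)) h \<partial>m)"
    by (intro nn_integral_mono) (auto split: split_indicator simp: K)
  also have "\<dots> = (\<integral>\<^sup>+h\<in>F n. b h \<partial>m) + K * emeasure m (sym_diff ((+) t ` F n) (F n))"
    by (subst nn_integral_add) (auto simp: nn_integral_cmult)
  finally show ?thesis .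
qed

lemma ennreal_L2_gap:
  assumes f: "continuous_on UNIV f"
  shows "ennreal (L2_gap f s t) = (\<integral>\<^sup>+x. ennreal ((cmod (f (act s x) - f (act t x)))\<^sup>2) \<partial>\<mu>)"
  unfolding L2_gap_def
  using square_integrable_diff[OF square_integrable_orbit[OF f, of s] square_integrable_orbit[OF f, of t]]
  by (intro nn_integral_eq_integral[symmetric]) (auto simp: square_integrable_def)

text \<open>By invariance of \<open>\<mu>\<close> the gap between \<open>s\<close> and
  \<open>t\<close> equals that between \<open>s + h\<close> and \<open>t + h\<close>, so
  \<open>h\<close> may be chosen freely. The latter is split through the two step functions;
  \<open>9\<close> stands for three terms, each with the factor \<open>3\<close> from squaring a sum
  of three.\<close>

lemma L2_gap_le_step_error:
  assumes f: "continuous_on UNIV f" and p [measurable]: "p \<in> borel_measurable borel"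
    and s: "step_error f p (s + h) \<le> ennreal \<beta>" and t: "step_error f p (t + h) \<le> ennreal \<beta>"
    and close: "\<And>q. q \<in> range p \<Longrightarrow> (cmod (f (act (s + h) q) - f (act (t + h) q)))\<^sup>2 \<le> \<beta>"
    and "\<beta> \<ge> 0"
  shows "L2_gap f s t \<le> 9 * \<beta>"
proof -
  have [measurable]: "f \<in> borel_measurable borel" by (rule borel_measurable_continuous_onI[OF f])
  have sq3: "(cmod (a - d))\<^sup>2 \<le> 3 * (cmod (a - b))\<^sup>2 + 3 * (cmod (d - c))\<^sup>2 + 3 * (cmod (b - c))\<^sup>2" for a b c d
  proof -
    define A B C where "A = cmod (a - b)" and "B = cmod (b - c)" and "C = cmod (d - c)"
    have "cmod (a - d) \<le> A + B + C"
      using norm_triangle_ineq[of "a - b" "b - d"] norm_triangle_ineq[of "b - c" "c - d"]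
      unfolding A_def B_def C_def by (simp add: norm_minus_commute)
    then have "(cmod (a - d))\<^sup>2 \<le> (A + B + C)\<^sup>2" by (intro power_mono) auto
    also have "\<dots> \<le> 3 * A\<^sup>2 + 3 * C\<^sup>2 + 3 * B\<^sup>2"
      using sum_squares_bound[of A B] sum_squares_bound[of B C] sum_squares_bound[of A C]
      by (simp add: power2_eq_square algebra_simps)
    finally show ?thesis by (simp add: A_def B_def C_def)
  qed
  have lin: "ennreal 3 * ennreal (a\<^sup>2) + ennreal 3 * ennreal (b\<^sup>2) + ennreal 3 * ennreal \<beta>
      = ennreal (3 * a\<^sup>2 + 3 * b\<^sup>2 + 3 * \<beta>)" for a b :: real
    using \<open>\<beta> \<ge> 0\<close> by (simp add: ennreal_mult' ennreal_plus)
  have "ennreal (L2_gap f s t) = (\<integral>\<^sup>+x. ennreal ((cmod (f (act s (act h x)) - f (act t (act h x))))\<^sup>2) \<partial>\<mu>)"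
    unfolding ennreal_L2_gap[OF f] by (rule nn_integral_act[symmetric]) measurable
  also have "\<dots> \<le> (\<integral>\<^sup>+x. ennreal 3 * ennreal ((cmod (f (act (s + h) x) - f (act (s + h) (p x))))\<^sup>2)
      + ennreal 3 * ennreal ((cmod (f (act (t + h) x) - f (act (t + h) (p x))))\<^sup>2) + ennreal 3 * ennreal \<beta> \<partial>\<mu>)"
  proof (rule nn_integral_mono)
    fix x
    have "(cmod (f (act (s + h) x) - f (act (t + h) x)))\<^sup>2
        \<le> 3 * (cmod (f (act (s + h) x) - f (act (s + h) (p x))))\<^sup>2
          + 3 * (cmod (f (act (t + h) x) - f (act (t + h) (p x))))\<^sup>2 + 3 * \<beta>"
      using sq3[of "f (act (s + h) x)" "f (act (t + h) x)" "f (act (s + h) (p x))" "f (act (t + h) (p x))"]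
        close[of "p x"] by simp
    then show "ennreal ((cmod (f (act s (act h x)) - f (act t (act h x))))\<^sup>2)
        \<le> ennreal 3 * ennreal ((cmod (f (act (s + h) x) - f (act (s + h) (p x))))\<^sup>2)
      + ennreal 3 * ennreal ((cmod (f (act (t + h) x) - f (act (t + h) (p x))))\<^sup>2) + ennreal 3 * ennreal \<beta>"
      unfolding lin act_add by (rule ennreal_leI)
  qed
  also have "\<dots> = ennreal 3 * step_error f p (s + h) + ennreal 3 * step_error f p (t + h) + ennreal 3 * ennreal \<beta>"
    unfolding step_error_def by (simp add: nn_integral_add nn_integral_cmult)
  also have "\<dots> \<le> ennreal 3 * ennreal \<beta> + ennreal 3 * ennreal \<beta> + ennreal 3 * ennreal \<beta>"
    by (intro add_mono mult_left_mono s t) auto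
  also have "\<dots> = ennreal (9 * \<beta>)"
    using lin[of "sqrt \<beta>" "sqrt \<beta>"] \<open>\<beta> \<ge> 0\<close> by simp
  finally show ?thesis using \<open>\<beta> \<ge> 0\<close> by (simp add: ennreal_le_iff)
qed

text \<open>
  A pigeonhole argument: on average over \<open>h \<in> F n\<close> at least half of the translates \<open>t + h\<close>,
  \<open>t \<in> T\<close>, are well approximated by step functions, and these have boundedly many shapes.
\<close>
lemma separated_card_bound:
  assumes me: "mean_equicontinuous_measure act m F \<mu>" and f: "continuous_on UNIV f" and "\<epsilon> > 0"
  obtains N :: nat where "\<And>T. finite T \<Longrightarrow> (\<And>s t. s \<in> T \<Longrightarrow> t \<in> T \<Longrightarrow> s \<noteq> t \<Longrightarrow> \<epsilon> \<le> L2_gap f s t) \<Longrightarrow> card T \<le> N"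
proof -
  have f_meas [measurable]: "f \<in> borel_measurable borel" by (rule borel_measurable_continuous_onI[OF f])
  obtain M where M: "M \<ge> 1" "\<And>x. cmod (f x) \<le> M" using continuous_bounded[OF f] by blast
  \<comment> \<open>\<open>L2_gap_le_step_error\<close> yields \<open>9 * \<beta>\<close>, which has
    to stay below the separation \<open>\<epsilon>\<close>.\<close>
  define \<beta> where "\<beta> = \<epsilon> / 10"
  have \<beta>: "\<beta> > 0" "9 * \<beta> < \<epsilon>" using \<open>\<epsilon> > 0\<close> by (auto simp: \<beta>_def)
  \<comment> \<open>The tolerances double: \<open>\<beta>/8\<close> for the average of
    \<open>step_error\<close>, \<open>\<beta>/4\<close> after translation by \<open>t\<close>,
    \<open>\<beta>/2\<close> for a single well-chosen \<open>h\<close>. Markov at level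
    \<open>\<beta>\<close> then discards less than half of \<open>T\<close>.\<close>
  have "\<beta> / 8 > 0" using \<beta> by simp
  obtain p where p [measurable]: "p \<in> borel_measurable borel"
    and fin: "finite (range p)"
    and ev: "eventually (\<lambda>n. (\<integral>\<^sup>+h\<in>F n. step_error f p h \<partial>m) \<le> ennreal (\<beta>/8) * emeasure m (F n)) sequentially"
    by (rule eventually_small_step_error[OF me f \<open>\<beta> / 8 > 0\<close>], rule that)
  have "sqrt \<beta> / 2 > 0" using \<beta> by simp
  obtain Z where Z: "finite Z" "cball 0 M \<subseteq> (\<Union>z\<in>Z. ball (z::complex) (sqrt \<beta> / 2))"
    using seq_compact_imp_totally_bounded[OF compact_imp_seq_compact[OF compact_cball],
        of "0::complex" M, rule_format, OF \<open>sqrt \<beta> / 2 > 0\<close>]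
    by (elim exE conjE) (rule that)
  define zz where "zz w = (SOME z. z \<in> Z \<and> dist z w < sqrt \<beta> / 2)" for w
  have zz: "zz (f x) \<in> Z" "dist (zz (f x)) (f x) < sqrt \<beta> / 2" for x
  proof -
    have "f x \<in> (\<Union>z\<in>Z. ball z (sqrt \<beta> / 2))" using Z(2) M(2)[of x] by (intro subsetD[OF Z(2)]) simp
    then have "\<exists>z. z \<in> Z \<and> dist z (f x) < sqrt \<beta> / 2" by auto
    then show "zz (f x) \<in> Z" "dist (zz (f x)) (f x) < sqrt \<beta> / 2"
      unfolding zz_def by (metis (mono_tags, lifting) someI_ex)+
  qed
  \<comment> \<open>A code records, for each value of \<open>p\<close>, a point of \<open>Z\<close>
    within \<open>sqrt \<beta> / 2\<close>. Equal codes mean values closer than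
    \<open>sqrt \<beta>\<close>, so two good translates with equal codes are not separated.\<close>
  define codes where "codes = (range p \<rightarrow>\<^sub>E Z)"
  have fcodes: "finite codes" unfolding codes_def by (intro finite_PiE fin Z)
  have card: "card T \<le> 2 * card codes"
    if T: "finite T" and sep: "\<And>s t. s \<in> T \<Longrightarrow> t \<in> T \<Longrightarrow> s \<noteq> t \<Longrightarrow> \<epsilon> \<le> L2_gap f s t" for T
  proof (cases "T = {}")
    case True
    then show ?thesis by simp
  next
    case False
    then have K: "card T > 0" using T by (simp add: card_gt_0_iff)
    define b where "b = step_error f p"
    have [measurable]: "b \<in> borel_measurable borel" unfolding b_def by measurable
    have b_le: "b h \<le> ennreal (4 * M\<^sup>2)" for h
    proof -
      have "b h \<le> (\<integral>\<^sup>+x. ennreal (4 * M\<^sup>2) \<partial>\<mu>)"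
        unfolding b_def step_error_def
      proof (intro nn_integral_mono ennreal_leI)
        fix x
        have "cmod (f (act h x) - f (act h (p x))) \<le> 2 * M"
          using norm_triangle_ineq4[of "f (act h x)" "f (act h (p x))"] M(2)[of "act h x"] M(2)[of "act h (p x)"]
          by linarith
        then have "(cmod (f (act h x) - f (act h (p x))))\<^sup>2 \<le> (2 * M)\<^sup>2" by (intro power_mono) auto
        then show "(cmod (f (act h x) - f (act h (p x))))\<^sup>2 \<le> 4 * M\<^sup>2" by simp
      qed
      then show ?thesis by simp
    qed
    have "eventually (\<lambda>n. (\<integral>\<^sup>+h\<in>F n. b (t + h) \<partial>m) \<le> ennreal (\<beta>/4) * emeasure m (F n)) sequentially" for t
    proof -
      have "eventually (\<lambda>n. measure m (sym_diff ((+) t ` F n) (F n)) / measure m (F n) < \<beta> / (32 * M\<^sup>2)) sequentially"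
        using F_folner[of t] \<beta> M(1) by (intro order_tendstoD(2)) auto
      with ev show ?thesis
      proof eventually_elim
        case (elim n)
        have sd: "measure m (sym_diff ((+) t ` F n) (F n)) \<le> \<beta> / (32 * M\<^sup>2) * measure m (F n)"
          using elim(2) measure_F_pos[of n] by (simp add: divide_less_eq)
        have "(\<integral>\<^sup>+h\<in>F n. b (t + h) \<partial>m) \<le> (\<integral>\<^sup>+h\<in>F n. b h \<partial>m)
            + ennreal (4 * M\<^sup>2) * emeasure m (sym_diff ((+) t ` F n) (F n))"
          by (rule nn_integral_F_translate_le) (simp_all add: b_le)
        also have "\<dots> \<le> ennreal (\<beta>/8) * emeasure m (F n) + ennreal (4 * M\<^sup>2) * ennreal (\<beta> / (32 * M\<^sup>2) * measure m (F n))"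
        proof (intro add_mono mult_left_mono)
          show "(\<integral>\<^sup>+h\<in>F n. b h \<partial>m) \<le> ennreal (\<beta>/8) * emeasure m (F n)" using elim(1) by (simp add: b_def)
          have "emeasure m (sym_diff ((+) t ` F n) (F n)) = ennreal (measure m (sym_diff ((+) t ` F n) (F n)))"
            using emeasure_sym_diff_finite[of t n] by (intro emeasure_eq_ennreal_measure) auto
          then show "emeasure m (sym_diff ((+) t ` F n) (F n)) \<le> ennreal (\<beta> / (32 * M\<^sup>2) * measure m (F n))"
            using sd by (simp add: ennreal_leI)
        qed auto
        also have "\<dots> = ennreal (\<beta>/8 * measure m (F n) + 4 * M\<^sup>2 * (\<beta> / (32 * M\<^sup>2) * measure m (F n)))"
        proof -
          have lin: "ennreal a * ennreal u + ennreal c * ennreal v = ennreal (a * u + c * v)"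
            if "0 \<le> a" "0 \<le> u" "0 \<le> c" "0 \<le> v" for a c u v
            using that by (simp add: ennreal_mult' ennreal_plus)
          show ?thesis unfolding emeasure_F using \<beta> by (intro lin) auto
        qed
        also have "\<beta>/8 * measure m (F n) + 4 * M\<^sup>2 * (\<beta> / (32 * M\<^sup>2) * measure m (F n)) = \<beta>/4 * measure m (F n)"
          using M(1) by (simp add: field_simps)
        also have "ennreal \<dots> = ennreal (\<beta>/4) * emeasure m (F n)"
          unfolding emeasure_F using \<beta> by (intro ennreal_mult') auto
        finally show ?case .
      qed
    qed
    then have "eventually (\<lambda>n. \<forall>t\<in>T. (\<integral>\<^sup>+h\<in>F n. b (t + h) \<partial>m) \<le> ennreal (\<beta>/4) * emeasure m (F n)) sequentially"
      using T by (simp add: eventually_ball_finite)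
    then obtain n where n: "\<And>t. t \<in> T \<Longrightarrow> (\<integral>\<^sup>+h\<in>F n. b (t + h) \<partial>m) \<le> ennreal (\<beta>/4) * emeasure m (F n)"
      by (auto simp: eventually_sequentially)
    \<comment> \<open>Some \<open>h\<close> lies below twice the average bound
      \<open>card T * (\<beta>/4)\<close>. Both \<open>n\<close> and \<open>h\<close> depend on
      \<open>T\<close>; the set of codes does not.\<close>
    have "\<exists>h. (\<Sum>t\<in>T. b (t + h)) < ennreal (card T * (\<beta>/2))"
    proof (rule ccontr)
      assume "\<not> ?thesis"
      then have ge: "ennreal (card T * (\<beta>/2)) \<le> (\<Sum>t\<in>T. b (t + h))" for h by (simp add: not_less)
      have "ennreal (card T * (\<beta>/2)) * emeasure m (F n) = (\<integral>\<^sup>+h\<in>F n. ennreal (card T * (\<beta>/2)) \<partial>m)"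
        by (simp add: nn_integral_cmult)
      also have "\<dots> \<le> (\<integral>\<^sup>+h\<in>F n. (\<Sum>t\<in>T. b (t + h)) \<partial>m)"
        by (intro nn_integral_mono mult_right_mono ge) auto
      also have "\<dots> = (\<Sum>t\<in>T. \<integral>\<^sup>+h\<in>F n. b (t + h) \<partial>m)"
        unfolding sum_distrib_right by (rule nn_integral_sum) measurable
      also have "\<dots> \<le> (\<Sum>t\<in>T. ennreal (\<beta>/4) * emeasure m (F n))"
        by (intro sum_mono n)
      also have "\<dots> = ennreal (card T * (\<beta>/4)) * emeasure m (F n)"
        unfolding ennreal_mult'[OF of_nat_0_le_iff]
        by (simp add: ennreal_of_nat_eq_real_of_nat mult.assoc)
      finally have "card T * (\<beta>/2) * measure m (F n) \<le> card T * (\<beta>/4) * measure m (F n)"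
        using \<beta> unfolding emeasure_F by (simp flip: ennreal_mult')
      then have "card T * (\<beta>/2) \<le> card T * (\<beta>/4)" using measure_F_pos[of n] by (rule mult_right_le_imp_le)
      then show False using K \<beta> by simp
    qed
    then obtain h where h: "(\<Sum>t\<in>T. b (t + h)) < ennreal (card T * (\<beta>/2))" by blast
    define good where "good = {t\<in>T. b (t + h) \<le> ennreal \<beta>}"
    have good: "finite good" "good \<subseteq> T" using T by (auto simp: good_def)
    have "ennreal (card (T - good) * \<beta>) = (\<Sum>t\<in>T - good. ennreal \<beta>)"
      using \<beta> by (simp add: ennreal_mult' ennreal_of_nat_eq_real_of_nat)
    also have "\<dots> \<le> (\<Sum>t\<in>T - good. b (t + h))"
      by (intro sum_mono) (auto simp: good_def)
    also have "\<dots> \<le> (\<Sum>t\<in>T. b (t + h))" by (intro sum_mono2 T) auto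
    also have "\<dots> < ennreal (card T * (\<beta>/2))" by (rule h)
    finally have "card (T - good) * \<beta> < card T * (\<beta>/2)"
      using \<beta> by (simp add: ennreal_less_iff)
    then have "real (2 * card (T - good)) < real (card T)" using \<beta> by (simp add: field_simps)
    then have bad: "2 * card (T - good) < card T" by linarith
    have "card (T - good) = card T - card good" by (rule card_Diff_subset[OF good])
    then have half: "card T \<le> 2 * card good" using bad card_mono[OF T good(2)] by linarith
    define code where "code t = (\<lambda>q\<in>range p. zz (f (act (t + h) q)))" for t
    have "inj_on code good"
    proof (rule inj_onI, rule ccontr)
      fix s t assume st: "s \<in> good" "t \<in> good" "code s = code t" "s \<noteq> t"
      have "L2_gap f s t \<le> 9 * \<beta>"
      proof (rule L2_gap_le_step_error[OF f p])
        show "step_error f p (s + h) \<le> ennreal \<beta>" "step_error f p (t + h) \<le> ennreal \<beta>"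
          using st by (auto simp: good_def b_def)
        fix q assume "q \<in> range p"
        then have "zz (f (act (s + h) q)) = zz (f (act (t + h) q))"
          using st(3) by (auto simp: code_def dest: fun_cong[of _ _ q])
        then have "dist (f (act (s + h) q)) (f (act (t + h) q)) < sqrt \<beta>"
          using zz(2)[of "act (s + h) q"] zz(2)[of "act (t + h) q"]
            dist_triangle2[of "f (act (s + h) q)" "f (act (t + h) q)" "zz (f (act (t + h) q))"]
          by (simp add: dist_commute)
        then have "(cmod (f (act (s + h) q) - f (act (t + h) q)))\<^sup>2 \<le> (sqrt \<beta>)\<^sup>2"
          by (intro power_mono) (auto simp: dist_norm)
        then show "(cmod (f (act (s + h) q) - f (act (t + h) q)))\<^sup>2 \<le> \<beta>" using \<beta> by simp
      qed (use \<beta> in auto)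
      moreover have "\<epsilon> \<le> L2_gap f s t" using st good(2) by (intro sep) auto
      ultimately show False using \<beta>(2) by linarith
    qed
    moreover have "code ` good \<subseteq> codes" by (auto simp: code_def codes_def zz)
    ultimately have "card good \<le> card codes" by (rule card_inj_on_le) (rule fcodes)
    then show ?thesis using half by linarith
  qed
  from that[OF card] show ?thesis .
qed

text \<open>A separated set of largest size is a net: an element far from all its members could be
  added to it.\<close>

theorem mean_equicontinuous_imp_discrete_spectrum:
  assumes "mean_equicontinuous_measure act m F \<mu>"
  shows "discrete_spectrum act \<mu>"
  unfolding discrete_spectrum_iff
proof (intro allI impI)
  fix f :: "'x \<Rightarrow> complex" and \<epsilon> :: real
  assume f: "continuous_on UNIV f" and "\<epsilon> > 0"
  define sep where "sep T \<longleftrightarrow> finite T \<and> (\<forall>s\<in>T. \<forall>t\<in>T. s \<noteq> t \<longrightarrow> \<epsilon> \<le> L2_gap f s t)" for T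
  obtain N :: nat where N: "\<And>T. sep T \<Longrightarrow> card T \<le> N"
  proof (rule separated_card_bound[OF assms f \<open>\<epsilon> > 0\<close>])
    fix N :: nat
    assume "\<And>T. finite T \<Longrightarrow> (\<And>s t. s \<in> T \<Longrightarrow> t \<in> T \<Longrightarrow> s \<noteq> t \<Longrightarrow> \<epsilon> \<le> L2_gap f s t) \<Longrightarrow> card T \<le> N"
    then show thesis using that[of N] by (simp add: sep_def)
  qed
  have "sep {}" by (simp add: sep_def)
  then obtain T where T: "sep T" and max: "\<And>S. sep S \<Longrightarrow> card S \<le> card T"
    using ex_has_greatest_nat[of sep "{}" card "Suc N"] N by (metis less_Suc_eq_le)
  have comm: "L2_gap f s t = L2_gap f t s" for s t by (simp add: L2_gap_def norm_minus_commute)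
  have zero: "L2_gap f g g = 0" for g by (simp add: L2_gap_def)
  have "\<exists>t\<in>T. L2_gap f t g < \<epsilon>" for g
  proof (rule ccontr)
    assume "\<not> ?thesis"
    then have far: "\<epsilon> \<le> L2_gap f t g" if "t \<in> T" for t using that by (simp add: not_less)
    then have "g \<notin> T" using zero[of g] \<open>\<epsilon> > 0\<close> by fastforce
    moreover have "sep (insert g T)"
      using T far comm by (auto simp: sep_def)
    ultimately show False using max[of "insert g T"] T by (simp add: sep_def)
  qed
  then show "\<exists>T. finite T \<and> (\<forall>g. \<exists>t\<in>T. L2_gap f t g < \<epsilon>)"
    using T by (auto simp: sep_def)
qed

end

section \<open>Bounded measurable functions\<close>

text \<open>Closed under the operations used below and integrable for every finite measure, so that
  integrability follows from the shape of a term through \<open>bm_intros\<close>. The bound holds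
  everywhere, not just almost everywhere, and so passes to every section of a kernel.\<close>

definition bm :: "'a measure \<Rightarrow> ('a \<Rightarrow> real) set" where
  "bm M = {u \<in> borel_measurable M. \<exists>B. \<forall>x. \<bar>u x\<bar> \<le> B}"

lemma bmI: "u \<in> borel_measurable M \<Longrightarrow> (\<And>x. \<bar>u x\<bar> \<le> B) \<Longrightarrow> u \<in> bm M"
  by (auto simp: bm_def)

lemma bm_measurable: "u \<in> bm M \<Longrightarrow> u \<in> borel_measurable M"
  by (simp add: bm_def)

lemma bmE:
  assumes "u \<in> bm M"
  obtains B where "B > 0" "\<And>x. \<bar>u x\<bar> \<le> B"
proof -
  obtain B where "\<And>x. \<bar>u x\<bar> \<le> B" using assms by (auto simp: bm_def)
  then have "\<bar>u x\<bar> \<le> max B 1" for x by (meson max.coboundedI1)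
  then show ?thesis using that[of "max B 1"] by simp
qed

lemma bm_const: "(\<lambda>_. c) \<in> bm M"
  by (rule bmI[of _ _ "\<bar>c\<bar>"]) auto

lemma bm_add: "u \<in> bm M \<Longrightarrow> v \<in> bm M \<Longrightarrow> (\<lambda>x. u x + v x) \<in> bm M"
proof -
  assume uv: "u \<in> bm M" "v \<in> bm M"
  obtain A where A: "\<And>x. \<bar>u x\<bar> \<le> A" by (rule bmE[OF uv(1)], rule that)
  obtain B where B: "\<And>x. \<bar>v x\<bar> \<le> B" by (rule bmE[OF uv(2)], rule that)
  have "\<bar>u x + v x\<bar> \<le> A + B" for x using A[of x] B[of x] by linarith
  then show ?thesis
    by (rule bmI[OF borel_measurable_add[OF bm_measurable[OF uv(1)] bm_measurable[OF uv(2)]]])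
qed

lemma bm_mult: "u \<in> bm M \<Longrightarrow> v \<in> bm M \<Longrightarrow> (\<lambda>x. u x * v x) \<in> bm M"
proof -
  assume uv: "u \<in> bm M" "v \<in> bm M"
  obtain A where A: "A > 0" "\<And>x. \<bar>u x\<bar> \<le> A" by (rule bmE[OF uv(1)], rule that)
  obtain B where B: "\<And>x. \<bar>v x\<bar> \<le> B" by (rule bmE[OF uv(2)], rule that)
  have "\<bar>u x * v x\<bar> \<le> A * B" for x unfolding abs_mult using A B by (intro mult_mono) auto
  then show ?thesis
    by (rule bmI[OF borel_measurable_times[OF bm_measurable[OF uv(1)] bm_measurable[OF uv(2)]]])
qed

lemma bm_uminus: "u \<in> bm M \<Longrightarrow> (\<lambda>x. - u x) \<in> bm M"
  using bm_mult[OF bm_const[of "-1" M]] by simp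

lemma bm_diff: "u \<in> bm M \<Longrightarrow> v \<in> bm M \<Longrightarrow> (\<lambda>x. u x - v x) \<in> bm M"
  using bm_add[OF _ bm_uminus, of u M v] by simp

lemma bm_divide: "u \<in> bm M \<Longrightarrow> (\<lambda>x. u x / c) \<in> bm M"
  using bm_mult[OF _ bm_const[of "1/c" M], of u] by simp

lemma bm_power2: "u \<in> bm M \<Longrightarrow> (\<lambda>x. (u x)\<^sup>2) \<in> bm M"
  unfolding power2_eq_square by (rule bm_mult)

lemma bm_abs: "u \<in> bm M \<Longrightarrow> (\<lambda>x. \<bar>u x\<bar>) \<in> bm M"
  by (auto simp: bm_def)

lemma bm_sum: "(\<And>i. i \<in> I \<Longrightarrow> u i \<in> bm M) \<Longrightarrow> (\<lambda>x. \<Sum>i\<in>I. u i x) \<in> bm M"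
  by (induction I rule: infinite_finite_induct) (auto intro: bm_const bm_add)

lemma bm_compose: "u \<in> bm M \<Longrightarrow> h \<in> measurable N M \<Longrightarrow> (\<lambda>x. u (h x)) \<in> bm N"
  by (auto simp: bm_def)

lemmas bm_intros = bm_const bm_add bm_mult bm_uminus bm_diff bm_divide bm_power2 bm_abs bm_sum

lemma (in finite_measure) bm_integrable:
  assumes "u \<in> bm M"
  shows "integrable M u"
proof -
  obtain B where "\<And>x. \<bar>u x\<bar> \<le> B" by (rule bmE[OF assms], rule that)
  then show ?thesis by (intro integrable_const_bound[OF _ bm_measurable[OF assms], of B]) simp
qed

text \<open>Take \<open>t = a / b\<close>; for \<open>b = 0\<close> the assumption is linear in
  \<open>t\<close> and forces \<open>a = 0\<close>. Besides Cauchy-Schwarz this serves the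
  near-minimizers in \<open>range_kop_dense\<close>.\<close>

lemma square_le_mult_of_quadratic:
  fixes a b e :: real
  assumes "\<And>t. 2 * t * a \<le> e + t\<^sup>2 * b" and "b \<ge> 0"
  shows "a\<^sup>2 \<le> e * b"
proof (cases "b = 0")
  case True
  have "a = 0"
  proof (rule ccontr)
    assume "a \<noteq> 0"
    then have "2 * ((e + 1) / (2 * a)) * a = e + 1" by simp
    then show False using assms(1)[of "(e + 1) / (2 * a)"] True by simp
  qed
  then show ?thesis using True by simp
next
  case False
  then have b: "b > 0" using assms(2) by simp
  have "2 * (a / b) * a \<le> e + (a / b)\<^sup>2 * b" by (rule assms(1))
  then have "(2 * (a / b) * a) * b \<le> (e + (a / b)\<^sup>2 * b) * b" using b by (intro mult_right_mono) auto
  then show ?thesis using b by (simp add: power2_eq_square distrib_right)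
qed

lemma (in finite_measure) bm_Cauchy_Schwarz:
  assumes u: "u \<in> bm M" and v: "v \<in> bm M"
  shows "(\<integral>x. u x * v x \<partial>M)\<^sup>2 \<le> (\<integral>x. (u x)\<^sup>2 \<partial>M) * (\<integral>x. (v x)\<^sup>2 \<partial>M)"
proof (rule square_le_mult_of_quadratic)
  fix t :: real
  have i: "integrable M (\<lambda>x. (u x)\<^sup>2)" "integrable M (\<lambda>x. u x * v x)" "integrable M (\<lambda>x. (v x)\<^sup>2)"
    by (intro bm_integrable bm_intros u v)+
  have "0 \<le> (\<integral>x. (u x - t * v x)\<^sup>2 \<partial>M)" by simp
  also have "\<dots> = (\<integral>x. (u x)\<^sup>2 - 2 * t * (u x * v x) + t\<^sup>2 * (v x)\<^sup>2 \<partial>M)"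
    by (simp add: power2_eq_square algebra_simps)
  also have "\<dots> = (\<integral>x. (u x)\<^sup>2 \<partial>M) - 2 * t * (\<integral>x. u x * v x \<partial>M) + t\<^sup>2 * (\<integral>x. (v x)\<^sup>2 \<partial>M)"
    using i by simp
  finally show "2 * t * (\<integral>x. u x * v x \<partial>M) \<le> (\<integral>x. (u x)\<^sup>2 \<partial>M) + t\<^sup>2 * (\<integral>x. (v x)\<^sup>2 \<partial>M)" by simp
qed simp

section \<open>An invariant kernel\<close>

context folner_system
begin

section \<open>The diagonal action on the product system\<close>

lemma finite_measure_mu_mu: "finite_measure (\<mu> \<Otimes>\<^sub>M \<mu>)"
  by (rule finite_measure_pair_measure) (rule finite_measure_mu)+

sublocale P: finite_measure "\<mu> \<Otimes>\<^sub>M \<mu>"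
  by (rule finite_measure_mu_mu)

lemma sets_mu_mu [measurable_cong]: "sets (\<mu> \<Otimes>\<^sub>M \<mu>) = sets (borel \<Otimes>\<^sub>M borel)"
  by (intro sets_pair_measure_cong sets_mu)

lemma space_mu_mu [simp]: "space (\<mu> \<Otimes>\<^sub>M \<mu>) = UNIV"
  by (simp add: space_pair_measure)

lemma measure_mu_mu_UNIV [simp]: "measure (\<mu> \<Otimes>\<^sub>M \<mu>) UNIV = 1"
proof -
  have "emeasure (\<mu> \<Otimes>\<^sub>M \<mu>) (UNIV \<times> UNIV) = 1"
    by (subst mu.emeasure_pair_measure_Times) auto
  then show ?thesis by (simp add: measure_def)
qed

definition act_pair :: "'g \<Rightarrow> 'x \<times> 'x \<Rightarrow> 'x \<times> 'x" where
  "act_pair g z = (act g (fst z), act g (snd z))"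

lemma measurable_act_pair [measurable]: "act_pair g \<in> measurable (\<mu> \<Otimes>\<^sub>M \<mu>) (\<mu> \<Otimes>\<^sub>M \<mu>)"
  unfolding act_pair_def[abs_def] by measurable

lemma distr_act_pair: "distr (\<mu> \<Otimes>\<^sub>M \<mu>) (\<mu> \<Otimes>\<^sub>M \<mu>) (act_pair g) = \<mu> \<Otimes>\<^sub>M \<mu>"
proof -
  have "\<mu> \<Otimes>\<^sub>M \<mu> = distr \<mu> borel (act g) \<Otimes>\<^sub>M distr \<mu> borel (act g)" by (simp add: distr_act)
  also have "\<dots> = distr (\<mu> \<Otimes>\<^sub>M \<mu>) (borel \<Otimes>\<^sub>M borel) (\<lambda>(x, y). (act g x, act g y))"
    by (rule pair_measure_distr) (auto simp: distr_act intro: mu.sigma_finite_measure_axioms)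
  also have "\<dots> = distr (\<mu> \<Otimes>\<^sub>M \<mu>) (\<mu> \<Otimes>\<^sub>M \<mu>) (act_pair g)"
    by (rule distr_cong) (auto simp: sets_mu_mu act_pair_def)
  finally show ?thesis by simp
qed

lemma integral_act_pair:
  fixes k :: "'x \<times> 'x \<Rightarrow> real"
  assumes [measurable]: "k \<in> borel_measurable (\<mu> \<Otimes>\<^sub>M \<mu>)"
  shows "(\<integral>z. k (act_pair g z) \<partial>(\<mu> \<Otimes>\<^sub>M \<mu>)) = (\<integral>z. k z \<partial>(\<mu> \<Otimes>\<^sub>M \<mu>))"
proof -
  have "(\<integral>z. k z \<partial>(\<mu> \<Otimes>\<^sub>M \<mu>)) = (\<integral>z. k z \<partial>distr (\<mu> \<Otimes>\<^sub>M \<mu>) (\<mu> \<Otimes>\<^sub>M \<mu>) (act_pair g))"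
    by (simp add: distr_act_pair)
  also have "\<dots> = (\<integral>z. k (act_pair g z) \<partial>(\<mu> \<Otimes>\<^sub>M \<mu>))"
    by (rule integral_distr) measurable
  finally show ?thesis by simp
qed

lemma bm_act: "u \<in> bm \<mu> \<Longrightarrow> (\<lambda>x. u (act g x)) \<in> bm \<mu>"
  by (erule bm_compose) measurable

lemma bm_act_pair: "k \<in> bm (\<mu> \<Otimes>\<^sub>M \<mu>) \<Longrightarrow> (\<lambda>z. k (act_pair g z)) \<in> bm (\<mu> \<Otimes>\<^sub>M \<mu>)"
  by (erule bm_compose) measurable

lemma bm_fst: "u \<in> bm \<mu> \<Longrightarrow> (\<lambda>z. u (fst z)) \<in> bm (\<mu> \<Otimes>\<^sub>M \<mu>)"
  and bm_snd: "u \<in> bm \<mu> \<Longrightarrow> (\<lambda>z. u (snd z)) \<in> bm (\<mu> \<Otimes>\<^sub>M \<mu>)"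
  by (erule bm_compose, measurable)+

lemma bm_section: "k \<in> bm (\<mu> \<Otimes>\<^sub>M \<mu>) \<Longrightarrow> (\<lambda>y. k (x, y)) \<in> bm \<mu>"
  by (erule bm_compose) measurable

lemma bm_continuous: "continuous_on UNIV f \<Longrightarrow> f \<in> bm \<mu>" for f :: "'x \<Rightarrow> real"
  using continuous_bounded[of f] borel_measurable_continuous_onI[of f]
  by (auto simp: bm_def)

lemma bm_integral_section:
  assumes "k \<in> bm (\<mu> \<Otimes>\<^sub>M \<mu>)"
  shows "(\<lambda>x. \<integral>y. k (x, y) \<partial>\<mu>) \<in> bm \<mu>"
proof -
  obtain B where B: "B > 0" "\<And>z. \<bar>k z\<bar> \<le> B" by (rule bmE[OF assms], rule that)
  have [measurable]: "k \<in> borel_measurable (\<mu> \<Otimes>\<^sub>M \<mu>)" by (rule bm_measurable[OF assms])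
  have "\<bar>\<integral>y. k (x, y) \<partial>\<mu>\<bar> \<le> B" for x
  proof -
    have "\<bar>\<integral>y. k (x, y) \<partial>\<mu>\<bar> \<le> (\<integral>y. \<bar>k (x, y)\<bar> \<partial>\<mu>)" by (rule integral_abs_bound)
    also have "\<dots> \<le> (\<integral>y. B \<partial>\<mu>)"
      by (intro integral_mono mu.bm_integrable bm_intros bm_section assms B)
    finally show ?thesis by simp
  qed
  then show ?thesis by (intro bmI[of _ _ B]) measurable
qed

lemma integral_mu_mu:
  assumes "k \<in> bm (\<mu> \<Otimes>\<^sub>M \<mu>)"
  shows "(\<integral>z. k z \<partial>(\<mu> \<Otimes>\<^sub>M \<mu>)) = (\<integral>x. (\<integral>y. k (x, y) \<partial>\<mu>) \<partial>\<mu>)"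
  using mu_mu.integral_fst'[OF P.bm_integrable[OF assms]] by simp

text \<open>The dyadic convex hull of the orbit of \<open>f \<otimes> f\<close> under the diagonal action.\<close>
inductive_set kernels :: "('x \<Rightarrow> real) \<Rightarrow> ('x \<times> 'x \<Rightarrow> real) set" for f :: "'x \<Rightarrow> real" where
  base: "(\<lambda>z. f (act g (fst z)) * f (act g (snd z))) \<in> kernels f"
| mid: "k \<in> kernels f \<Longrightarrow> l \<in> kernels f \<Longrightarrow> (\<lambda>z. (k z + l z) / 2) \<in> kernels f"

lemma kernels_le:
  assumes "k \<in> kernels f" and M: "\<And>x. \<bar>f x\<bar> \<le> M"
  shows "\<bar>k z\<bar> \<le> M\<^sup>2"
  using assms(1)
proof induction
  case (base g)
  have "\<bar>f (act g (fst z))\<bar> * \<bar>f (act g (snd z))\<bar> \<le> M * M"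
    using M[of undefined] by (intro mult_mono M) auto
  then show ?case by (simp add: abs_mult power2_eq_square)
next
  case (mid k l)
  then show ?case by (simp add: abs_le_iff field_simps)
qed

lemma kernels_bm:
  assumes "k \<in> kernels f" and "f \<in> bm \<mu>"
  shows "k \<in> bm (\<mu> \<Otimes>\<^sub>M \<mu>)"
  using assms(1)
proof induction
  case (base g)
  have "(\<lambda>x. f (act g x)) \<in> bm \<mu>" by (rule bm_act[OF assms(2)])
  from bm_mult[OF bm_fst[OF this] bm_snd[OF this]] show ?case .
next
  case (mid k l)
  show ?case by (intro bm_intros mid.IH)
qed

lemma kernels_act_pair:
  assumes "k \<in> kernels f"
  shows "(\<lambda>z. k (act_pair h z)) \<in> kernels f"
  using assms
proof induction
  case (base g)
  then show ?case using kernels.base[of f "g + h"] by (simp add: act_pair_def act_add)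
next
  case (mid k l)
  then show ?case using kernels.mid by blast
qed

text \<open>The modulus is uniform in \<open>y\<close>, so it survives integration against a bounded
  function of \<open>y\<close>. The limit kernel inherits it only approximately and off a small
  set.\<close>

lemma kernels_equicontinuous:
  assumes "k \<in> kernels f" and f: "continuous_on UNIV f" and "e > 0"
  shows "\<exists>d>0. \<forall>x x' y. dist x x' < d \<longrightarrow> \<bar>k (x, y) - k (x', y)\<bar> < e"
  using assms(1) \<open>e > 0\<close>
proof (induction arbitrary: e)
  case (base g)
  obtain M where M: "M \<ge> 1" "\<And>x. norm (f x) \<le> M" using continuous_bounded[OF f] by blast
  have "continuous_on UNIV (\<lambda>x. f (act g x))"
    by (rule continuous_on_compose2[OF f continuous_act]) auto
  then have "uniformly_continuous_on UNIV (\<lambda>x. f (act g x))"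
    by (rule compact_uniformly_continuous[OF _ compact_X])
  moreover have "e / M > 0" using base M(1) by simp
  ultimately obtain d where d: "d > 0" "\<forall>x x'. dist x' x < d \<longrightarrow> dist (f (act g x')) (f (act g x)) < e / M"
    unfolding uniformly_continuous_on_def by (metis UNIV_I)
  have "\<bar>f (act g x) * f (act g y) - f (act g x') * f (act g y)\<bar> < e" if "dist x x' < d" for x x' y
  proof -
    have "\<bar>f (act g x) - f (act g x')\<bar> * \<bar>f (act g y)\<bar> \<le> \<bar>f (act g x) - f (act g x')\<bar> * M"
      using M(2)[of "act g y"] by (intro mult_left_mono) auto
    also have "\<dots> < e / M * M"
      using d(2) that M(1) by (intro mult_strict_right_mono) (auto simp: dist_real_def)
    finally show ?thesis using M(1) by (simp add: abs_mult flip: left_diff_distrib)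
  qed
  then show ?case using d(1) by auto
next
  case (mid k l)
  obtain d1 where d1: "d1 > 0" "\<forall>x x' y. dist x x' < d1 \<longrightarrow> \<bar>k (x, y) - k (x', y)\<bar> < e"
    using mid.IH(1)[OF mid.prems] by blast
  obtain d2 where d2: "d2 > 0" "\<forall>x x' y. dist x x' < d2 \<longrightarrow> \<bar>l (x, y) - l (x', y)\<bar> < e"
    using mid.IH(2)[OF mid.prems] by blast
  have "\<bar>(k (x, y) + l (x, y)) / 2 - (k (x', y) + l (x', y)) / 2\<bar> < e" if "dist x x' < min d1 d2" for x x' y
  proof -
    have "\<bar>k (x, y) - k (x', y)\<bar> < e" "\<bar>l (x, y) - l (x', y)\<bar> < e" using d1 d2 that by auto
    then show ?thesis by (simp add: abs_less_iff field_simps)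
  qed
  then show ?case using d1(1) d2(1) by (intro exI[of _ "min d1 d2"]) simp
qed

abbreviation sqnorm2 :: "('x \<times> 'x \<Rightarrow> real) \<Rightarrow> real" where
  "sqnorm2 k \<equiv> \<integral>z. (k z)\<^sup>2 \<partial>(\<mu> \<Otimes>\<^sub>M \<mu>)"

definition min_norm :: "('x \<Rightarrow> real) \<Rightarrow> real" where
  "min_norm f = (INF k\<in>kernels f. sqnorm2 k)"

lemma min_norm_le: "k \<in> kernels f \<Longrightarrow> min_norm f \<le> sqnorm2 k"
  unfolding min_norm_def by (rule cINF_lower) (auto intro!: bdd_belowI[of _ 0])

text \<open>The parallelogram identity: near-minimizers of the norm in a convex set are close to each other.\<close>
lemma near_minimal_close:
  assumes f: "f \<in> bm \<mu>" and k: "k \<in> kernels f" and l: "l \<in> kernels f"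
    and "sqnorm2 k \<le> min_norm f + e" "sqnorm2 l \<le> min_norm f + e"
  shows "sqnorm2 (\<lambda>z. k z - l z) \<le> 4 * e"
proof -
  have i: "integrable (\<mu> \<Otimes>\<^sub>M \<mu>) (\<lambda>z. (k z)\<^sup>2)" "integrable (\<mu> \<Otimes>\<^sub>M \<mu>) (\<lambda>z. (l z)\<^sup>2)"
    "integrable (\<mu> \<Otimes>\<^sub>M \<mu>) (\<lambda>z. ((k z + l z) / 2)\<^sup>2)"
    by (intro P.bm_integrable bm_intros kernels_bm[OF k f] kernels_bm[OF l f])+
  have "sqnorm2 (\<lambda>z. k z - l z) = (\<integral>z. 2 * (k z)\<^sup>2 + 2 * (l z)\<^sup>2 - 4 * ((k z + l z) / 2)\<^sup>2 \<partial>(\<mu> \<Otimes>\<^sub>M \<mu>))"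
    by (intro Bochner_Integration.integral_cong) (auto simp: power2_eq_square field_simps)
  also have "\<dots> = 2 * sqnorm2 k + 2 * sqnorm2 l - 4 * sqnorm2 (\<lambda>z. (k z + l z) / 2)"
    using i by simp
  also have "\<dots> \<le> 4 * e"
    using assms(4,5) min_norm_le[OF kernels.mid[OF k l]] by simp
  finally show ?thesis .
qed

lemma integral_abs_le_sqrt:
  assumes "k \<in> bm (\<mu> \<Otimes>\<^sub>M \<mu>)" "sqnorm2 k \<le> e\<^sup>2" "e \<ge> 0"
  shows "(\<integral>z. \<bar>k z\<bar> \<partial>(\<mu> \<Otimes>\<^sub>M \<mu>)) \<le> e"
proof -
  have "(\<integral>z. \<bar>k z\<bar> \<partial>(\<mu> \<Otimes>\<^sub>M \<mu>))\<^sup>2 \<le> sqnorm2 k"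
    using P.integral_squared_le[of "\<lambda>z. \<bar>k z\<bar>"] assms(1) by (simp add: P.bm_integrable bm_intros)
  then show ?thesis using assms(2,3) by (meson order_trans power2_le_imp_le)
qed

text \<open>A minimizing sequence in \<open>kernels f\<close> is Cauchy, with limit
  \<open>K\<close>. Translation by \<open>g\<close> maps the hull into itself and preserves the
  norm, so the translated sequence is minimizing too and has the same limit. The resulting null set
  may depend on \<open>g\<close>.\<close>

lemma invariant_kernel:
  assumes f: "f \<in> bm \<mu>"
  obtains K k where "K \<in> bm (\<mu> \<Otimes>\<^sub>M \<mu>)" "\<And>j::nat. k j \<in> kernels f"
    "(\<lambda>j. \<integral>z. \<bar>k j z - K z\<bar> \<partial>(\<mu> \<Otimes>\<^sub>M \<mu>)) \<longlonglongrightarrow> 0"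
    "\<And>g. AE z in \<mu> \<Otimes>\<^sub>M \<mu>. K (act_pair g z) = K z"
proof -
  obtain M where M: "M > 0" "\<And>x. \<bar>f x\<bar> \<le> M" by (rule bmE[OF f], rule that)
  have ne: "kernels f \<noteq> {}" using kernels.base[of f 0] by blast
  \<comment> \<open>The halved tolerance is squared and multiplied by the \<open>4\<close> of
    \<open>near_minimal_close\<close>, which leaves exactly \<open>inverse (real (Suc j))\<close>
    for the \<open>L\<^sup>1\<close>-distance.\<close>
  have "\<exists>k\<in>kernels f. sqnorm2 k < min_norm f + (inverse (real (Suc j)) / 2)\<^sup>2" for j
  proof -
    have "Inf (sqnorm2 ` kernels f) < min_norm f + (inverse (real (Suc j)) / 2)\<^sup>2"
      unfolding min_norm_def by simp
    then show ?thesis using cInf_lessD[of "sqnorm2 ` kernels f"] ne by blast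
  qed
  then obtain l where l: "\<And>j. l j \<in> kernels f"
    "\<And>j. sqnorm2 (l j) < min_norm f + (inverse (real (Suc j)) / 2)\<^sup>2" by metis
  have l_bm: "l j \<in> bm (\<mu> \<Otimes>\<^sub>M \<mu>)" for j by (rule kernels_bm[OF l(1) f])
  have [measurable]: "l j \<in> borel_measurable (\<mu> \<Otimes>\<^sub>M \<mu>)" for j by (rule bm_measurable[OF l_bm])
  have inv_mono: "inverse (real (Suc j)) \<le> inverse (real (Suc i))" if "i \<le> j" for i j
    using that by (intro le_imp_inverse_le) auto
  have l1: "(\<integral>z. \<bar>k z - k' z\<bar> \<partial>(\<mu> \<Otimes>\<^sub>M \<mu>)) \<le> inverse (real (Suc N))"
    if "k \<in> kernels f" "k' \<in> kernels f" "sqnorm2 k \<le> min_norm f + (inverse (real (Suc N)) / 2)\<^sup>2"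
      "sqnorm2 k' \<le> min_norm f + (inverse (real (Suc N)) / 2)\<^sup>2" for k k' N
  proof (rule integral_abs_le_sqrt)
    show "(\<lambda>z. k z - k' z) \<in> bm (\<mu> \<Otimes>\<^sub>M \<mu>)" by (intro bm_intros kernels_bm[OF _ f] that)
    show "sqnorm2 (\<lambda>z. k z - k' z) \<le> (inverse (real (Suc N)))\<^sup>2"
      using near_minimal_close[OF f that] by (simp add: power_divide)
  qed simp
  have cauchy: "(\<integral>z. \<bar>l i z - l j z\<bar> \<partial>(\<mu> \<Otimes>\<^sub>M \<mu>)) \<le> inverse (real (Suc N))" if "N \<le> i" "N \<le> j" for i j N
  proof -
    have "sqnorm2 (l i) \<le> min_norm f + (inverse (real (Suc N)) / 2)\<^sup>2" if "N \<le> i" for i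
    proof -
      have "(inverse (real (Suc i)) / 2)\<^sup>2 \<le> (inverse (real (Suc N)) / 2)\<^sup>2"
        using inv_mono[OF that] by (intro power_mono divide_right_mono) auto
      then show ?thesis using l(2)[of i] by linarith
    qed
    then show ?thesis using that by (intro l1 l(1)) auto
  qed
  obtain r where r: "strict_mono r" "AE z in \<mu> \<Otimes>\<^sub>M \<mu>. Cauchy (\<lambda>i. l (r i) z)"
  proof (rule cauchy_L1_AE_cauchy_subseq)
    show "integrable (\<mu> \<Otimes>\<^sub>M \<mu>) (l n)" for n by (rule P.bm_integrable[OF l_bm])
    fix e :: real assume "e > 0"
    then obtain N where N: "inverse (real (Suc N)) < e" using reals_Archimedean by blast
    show "\<exists>N. \<forall>i\<ge>N. \<forall>j\<ge>N. (\<integral>z. norm (l i z - l j z) \<partial>(\<mu> \<Otimes>\<^sub>M \<mu>)) < e"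
      using le_less_trans[OF cauchy N] by auto
  qed
  define k where "k i = l (r i)" for i
  have k: "k i \<in> kernels f" for i by (simp add: k_def l)
  have [measurable]: "k i \<in> borel_measurable (\<mu> \<Otimes>\<^sub>M \<mu>)" for i by (simp add: k_def)
  have k_le: "\<bar>k i z\<bar> \<le> M\<^sup>2" for i z by (rule kernels_le[OF k M(2)])
  \<comment> \<open>Truncation at the common bound of the \<open>k i\<close> changes nothing where
    they converge and makes \<open>K\<close> bounded everywhere, also where \<open>lim\<close> is
    unspecified.\<close>
  define K where "K z = max (- M\<^sup>2) (min (M\<^sup>2) (lim (\<lambda>i. k i z)))" for z
  have [measurable]: "K \<in> borel_measurable (\<mu> \<Otimes>\<^sub>M \<mu>)" unfolding K_def[abs_def] by measurable
  have K_le: "\<bar>K z\<bar> \<le> M\<^sup>2" for z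
    using zero_le_power2[of M] unfolding K_def max_def min_def abs_if by (simp del: zero_le_power2)
  have K_bm: "K \<in> bm (\<mu> \<Otimes>\<^sub>M \<mu>)" by (rule bmI[OF _ K_le]) measurable
  have conv: "AE z in \<mu> \<Otimes>\<^sub>M \<mu>. (\<lambda>i. k i z) \<longlonglongrightarrow> K z"
    using r(2)
  proof eventually_elim
    case (elim z)
    then have L: "(\<lambda>i. k i z) \<longlonglongrightarrow> lim (\<lambda>i. k i z)"
      by (simp add: k_def Cauchy_convergent_iff convergent_LIMSEQ_iff)
    have "lim (\<lambda>i. k i z) \<le> M\<^sup>2"
      by (rule LIMSEQ_le_const2[OF L]) (use k_le in \<open>auto simp: abs_le_iff\<close>)
    moreover have "- M\<^sup>2 \<le> lim (\<lambda>i. k i z)"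
      by (rule LIMSEQ_le_const[OF L]) (use k_le in \<open>auto simp: abs_le_iff minus_le_iff\<close>)
    ultimately show ?case using L by (simp add: K_def)
  qed
  have lim: "(\<lambda>j. \<integral>z. \<bar>k j z - K z\<bar> \<partial>(\<mu> \<Otimes>\<^sub>M \<mu>)) \<longlonglongrightarrow> 0"
  proof -
    have "(\<lambda>j. \<integral>z. \<bar>k j z - K z\<bar> \<partial>(\<mu> \<Otimes>\<^sub>M \<mu>)) \<longlonglongrightarrow> (\<integral>z. 0 \<partial>(\<mu> \<Otimes>\<^sub>M \<mu>))"
    proof (rule integral_dominated_convergence[where w = "\<lambda>_. 2 * M\<^sup>2"])
      show "AE z in \<mu> \<Otimes>\<^sub>M \<mu>. (\<lambda>j. \<bar>k j z - K z\<bar>) \<longlonglongrightarrow> 0"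
        using conv
      proof eventually_elim
        case (elim z)
        then have "(\<lambda>j. k j z - K z) \<longlonglongrightarrow> 0" by (simp add: LIM_zero_iff)
        then show ?case by (rule tendsto_rabs_zero)
      qed
      show "AE z in \<mu> \<Otimes>\<^sub>M \<mu>. norm \<bar>k j z - K z\<bar> \<le> 2 * M\<^sup>2" for j
      proof (rule AE_I2)
        fix z show "norm \<bar>k j z - K z\<bar> \<le> 2 * M\<^sup>2" using k_le[of j z] K_le[of z] by simp
      qed
    qed auto
    then show ?thesis by simp
  qed
  have inv: "AE z in \<mu> \<Otimes>\<^sub>M \<mu>. K (act_pair g z) = K z" for g
  proof -
    define D where "D = (\<integral>z. \<bar>K (act_pair g z) - K z\<bar> \<partial>(\<mu> \<Otimes>\<^sub>M \<mu>))"
    have k_bm: "k j \<in> bm (\<mu> \<Otimes>\<^sub>M \<mu>)" for j by (rule kernels_bm[OF k f])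
    \<comment> \<open>From translated \<open>K\<close> to translated \<open>k j\<close>, to
      \<open>k j\<close>, to \<open>K\<close>: the two outer distances agree by invariance of the
      product measure, and the middle one is small because both kernels are near-minimizers.\<close>
    have "D \<le> 2 * (\<integral>z. \<bar>k j z - K z\<bar> \<partial>(\<mu> \<Otimes>\<^sub>M \<mu>)) + inverse (real (Suc j))" for j
    proof -
      let ?I = "\<lambda>u. \<integral>z. u z \<partial>(\<mu> \<Otimes>\<^sub>M \<mu>)"
      have "D \<le> ?I (\<lambda>z. \<bar>k j (act_pair g z) - K (act_pair g z)\<bar> + \<bar>k j z - K z\<bar> + \<bar>k j (act_pair g z) - k j z\<bar>)"
        unfolding D_def
        by (intro integral_mono P.bm_integrable bm_intros bm_act_pair K_bm k_bm) linarith
      also have "\<dots> = ?I (\<lambda>z. \<bar>k j (act_pair g z) - K (act_pair g z)\<bar>) + ?I (\<lambda>z. \<bar>k j z - K z\<bar>)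
          + ?I (\<lambda>z. \<bar>k j (act_pair g z) - k j z\<bar>)"
        by (subst Bochner_Integration.integral_add,
            (intro P.bm_integrable bm_intros bm_act_pair K_bm k_bm)+)+ simp
      also have "?I (\<lambda>z. \<bar>k j (act_pair g z) - K (act_pair g z)\<bar>) = ?I (\<lambda>z. \<bar>k j z - K z\<bar>)"
        by (rule integral_act_pair[of "\<lambda>z. \<bar>k j z - K z\<bar>"]) measurable
      also have "?I (\<lambda>z. \<bar>k j (act_pair g z) - k j z\<bar>) \<le> inverse (real (Suc j))"
      proof (rule l1)
        have "(inverse (real (Suc (r j))) / 2)\<^sup>2 \<le> (inverse (real (Suc j)) / 2)\<^sup>2"
          using inv_mono[OF seq_suble[OF r(1), of j]] by (intro power_mono divide_right_mono) auto
        then show "sqnorm2 (k j) \<le> min_norm f + (inverse (real (Suc j)) / 2)\<^sup>2"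
          using l(2)[of "r j"] unfolding k_def by linarith
        moreover have "sqnorm2 (\<lambda>z. k j (act_pair g z)) = sqnorm2 (k j)"
          by (rule integral_act_pair[of "\<lambda>z. (k j z)\<^sup>2"]) measurable
        ultimately show "sqnorm2 (\<lambda>z. k j (act_pair g z)) \<le> min_norm f + (inverse (real (Suc j)) / 2)\<^sup>2"
          by simp
      qed (intro k kernels_act_pair)+
      finally show ?thesis by simp
    qed
    moreover have "(\<lambda>j. 2 * (\<integral>z. \<bar>k j z - K z\<bar> \<partial>(\<mu> \<Otimes>\<^sub>M \<mu>)) + inverse (real (Suc j))) \<longlonglongrightarrow> 2 * 0 + 0"
      by (intro tendsto_intros lim LIMSEQ_inverse_real_of_nat)
    ultimately have "D \<le> 0" by (intro LIMSEQ_le_const[of _ 0 D]) auto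
    moreover have "D \<ge> 0" unfolding D_def by simp
    ultimately have "D = 0" by simp
    then have "AE z in \<mu> \<Otimes>\<^sub>M \<mu>. \<bar>K (act_pair g z) - K z\<bar> = 0"
      unfolding D_def
      by (subst (asm) integral_nonneg_eq_0_iff_AE) (auto intro!: P.bm_integrable bm_intros bm_act_pair K_bm)
    then show ?thesis by simp
  qed
  show ?thesis by (rule that[OF K_bm k lim inv])
qed


section \<open>The integral operator of the kernel\<close>

definition kop :: "('x \<times> 'x \<Rightarrow> real) \<Rightarrow> ('x \<Rightarrow> real) \<Rightarrow> 'x \<Rightarrow> real" where
  "kop K u x = (\<integral>y. K (x, y) * u y \<partial>\<mu>)"

lemma bm_kop: "K \<in> bm (\<mu> \<Otimes>\<^sub>M \<mu>) \<Longrightarrow> u \<in> bm \<mu> \<Longrightarrow> kop K u \<in> bm \<mu>"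
  unfolding kop_def[abs_def]
  using bm_integral_section[OF bm_mult[OF _ bm_snd], of K u] by simp

lemma kop_add_mult:
  assumes "K \<in> bm (\<mu> \<Otimes>\<^sub>M \<mu>)" "u \<in> bm \<mu>" "v \<in> bm \<mu>"
  shows "kop K (\<lambda>y. u y + t * v y) x = kop K u x + t * kop K v x"
proof -
  have i: "integrable \<mu> (\<lambda>y. K (x, y) * u y)" "integrable \<mu> (\<lambda>y. K (x, y) * v y)"
    by (intro mu.bm_integrable bm_intros bm_section assms)+
  have "kop K (\<lambda>y. u y + t * v y) x = (\<integral>y. K (x, y) * u y + t * (K (x, y) * v y) \<partial>\<mu>)"
    unfolding kop_def by (simp add: algebra_simps)
  also have "\<dots> = kop K u x + t * kop K v x"
    unfolding kop_def using i by simp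
  finally show ?thesis .
qed

lemma kop_sqnorm_le:
  assumes K: "K \<in> bm (\<mu> \<Otimes>\<^sub>M \<mu>)" and B: "\<And>z. \<bar>K z\<bar> \<le> B" and u: "u \<in> bm \<mu>"
  shows "(\<integral>x. (kop K u x)\<^sup>2 \<partial>\<mu>) \<le> B\<^sup>2 * (\<integral>x. (u x)\<^sup>2 \<partial>\<mu>)"
proof -
  have "(kop K u x)\<^sup>2 \<le> B\<^sup>2 * (\<integral>x. (u x)\<^sup>2 \<partial>\<mu>)" for x
  proof -
    have "(kop K u x)\<^sup>2 \<le> (\<integral>y. (K (x, y))\<^sup>2 \<partial>\<mu>) * (\<integral>x. (u x)\<^sup>2 \<partial>\<mu>)"
      unfolding kop_def by (intro mu.bm_Cauchy_Schwarz bm_section K u)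
    also have "\<dots> \<le> (\<integral>y. B\<^sup>2 \<partial>\<mu>) * (\<integral>x. (u x)\<^sup>2 \<partial>\<mu>)"
    proof (intro mult_right_mono integral_mono)
      show "(K (x, y))\<^sup>2 \<le> B\<^sup>2" for y using B[of "(x, y)"] power_mono[of "\<bar>K (x, y)\<bar>" B 2] by simp
    qed (auto intro!: mu.bm_integrable bm_intros bm_section K)
    finally show ?thesis by simp
  qed
  then have "(\<integral>x. (kop K u x)\<^sup>2 \<partial>\<mu>) \<le> (\<integral>x. B\<^sup>2 * (\<integral>x. (u x)\<^sup>2 \<partial>\<mu>) \<partial>\<mu>)"
    by (intro integral_mono mu.bm_integrable bm_power2 bm_kop bm_const K u) 
  then show ?thesis by simp
qed

text \<open>
  Averaged over the centers \<open>S\<close> of a finite net of the orbit of \<open>f\<close>, every kernel sees a fixed proportion of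
  the component of \<open>u\<close> along \<open>f\<close>: whichever translate of \<open>f\<close> the kernel is built from, some center is close to it.
\<close>
lemma kernels_energy:
  assumes k: "k \<in> kernels f" and f: "f \<in> bm \<mu>" and u: "u \<in> bm \<mu>" and S: "finite S"
    and net: "\<And>g. \<exists>s\<in>S. (\<integral>x. (f (act s x) - f (act g x))\<^sup>2 \<partial>\<mu>) \<le> \<eta>"
  shows "(\<integral>x. f x * u x \<partial>\<mu>)\<^sup>2 / 2 - \<eta> * (\<integral>x. (u x)\<^sup>2 \<partial>\<mu>)
    \<le> (\<Sum>s\<in>S. \<integral>z. k z * (u (act s (fst z)) * u (act s (snd z))) \<partial>(\<mu> \<Otimes>\<^sub>M \<mu>))"
  using k
proof induction
  case (base g)
  have eq: "(\<integral>z. f (act g (fst z)) * f (act g (snd z)) * (u (act s (fst z)) * u (act s (snd z))) \<partial>(\<mu> \<Otimes>\<^sub>M \<mu>))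
      = (\<integral>x. f (act g x) * u (act s x) \<partial>\<mu>)\<^sup>2" for s
  proof -
    have b: "(\<lambda>x. f (act g x)) \<in> bm \<mu>" "(\<lambda>x. u (act s x)) \<in> bm \<mu>" by (intro bm_act f u)+
    have "(\<integral>z. f (act g (fst z)) * f (act g (snd z)) * (u (act s (fst z)) * u (act s (snd z))) \<partial>(\<mu> \<Otimes>\<^sub>M \<mu>))
      = (\<integral>x. (\<integral>y. f (act g x) * f (act g y) * (u (act s x) * u (act s y)) \<partial>\<mu>) \<partial>\<mu>)"
      using integral_mu_mu[OF bm_mult[OF bm_mult[OF bm_fst[OF b(1)] bm_snd[OF b(1)]] bm_mult[OF bm_fst[OF b(2)] bm_snd[OF b(2)]]]]
      by simp
    also have "\<dots> = (\<integral>x. (f (act g x) * u (act s x)) * (\<integral>y. f (act g y) * u (act s y) \<partial>\<mu>) \<partial>\<mu>)"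
      by (simp add: mult_ac flip: integral_mult_right_zero)
    also have "\<dots> = (\<integral>x. f (act g x) * u (act s x) \<partial>\<mu>)\<^sup>2"
      by (simp add: power2_eq_square)
    finally show ?thesis .
  qed
  obtain s where s: "s \<in> S" "(\<integral>x. (f (act s x) - f (act g x))\<^sup>2 \<partial>\<mu>) \<le> \<eta>" using net by blast
  define A where "A = (\<integral>x. f (act g x) * u (act s x) \<partial>\<mu>)"
  define B where "B = (\<integral>x. f x * u x \<partial>\<mu>)"
  have fu: "(\<lambda>x. f x * u x) \<in> borel_measurable borel"
    using bm_measurable[OF bm_mult[OF f u]] by simp
  have u2: "(\<lambda>x. (u x)\<^sup>2) \<in> borel_measurable borel"
    using bm_measurable[OF bm_power2[OF u]] by simp
  have i: "integrable \<mu> (\<lambda>x. f (act s x) * u (act s x))" "integrable \<mu> (\<lambda>x. f (act g x) * u (act s x))"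
    by (intro mu.bm_integrable bm_intros bm_act f u)+
  have "B - A = (\<integral>x. (f (act s x) - f (act g x)) * u (act s x) \<partial>\<mu>)"
    unfolding A_def B_def integral_act[OF fu, of s, symmetric]
    using i by (simp add: left_diff_distrib)
  then have "(B - A)\<^sup>2 \<le> (\<integral>x. (f (act s x) - f (act g x))\<^sup>2 \<partial>\<mu>) * (\<integral>x. (u (act s x))\<^sup>2 \<partial>\<mu>)"
    using mu.bm_Cauchy_Schwarz[OF bm_diff[OF bm_act[OF f] bm_act[OF f]] bm_act[OF u], of s g s] by simp
  also have "\<dots> \<le> \<eta> * (\<integral>x. (u (act s x))\<^sup>2 \<partial>\<mu>)"
    using s(2) by (intro mult_right_mono) auto
  also have "(\<integral>x. (u (act s x))\<^sup>2 \<partial>\<mu>) = (\<integral>x. (u x)\<^sup>2 \<partial>\<mu>)"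
    by (rule integral_act[OF u2])
  finally have BA: "(B - A)\<^sup>2 \<le> \<eta> * (\<integral>x. (u x)\<^sup>2 \<partial>\<mu>)" .
  \<comment> \<open>If the translate by \<open>g\<close> is close to the one by \<open>s\<close>,
    then \<open>A\<close> is close to \<open>B\<close>, and half of \<open>B\<^sup>2\<close>
    survives in \<open>A\<^sup>2\<close>.\<close>
  have "B\<^sup>2 / 2 - (B - A)\<^sup>2 \<le> A\<^sup>2"
    using zero_le_power2[of "B - 2 * A"] by (simp add: power2_eq_square algebra_simps)
  also have "A\<^sup>2 \<le> (\<Sum>s\<in>S. (\<integral>x. f (act g x) * u (act s x) \<partial>\<mu>)\<^sup>2)"
    unfolding A_def using s(1) S by (intro member_le_sum) auto
  finally show ?case
    unfolding eq using BA by (simp add: B_def)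
next
  case (mid k l)
  \<comment> \<open>The good center \<open>s\<close> differs between \<open>k\<close> and
    \<open>l\<close>. Summing over all of \<open>S\<close> makes the bound affine in the kernel, so
    it passes to midpoints.\<close>
  have i: "integrable (\<mu> \<Otimes>\<^sub>M \<mu>) (\<lambda>z. h z * (u (act s (fst z)) * u (act s (snd z))))" if "h \<in> kernels f" for h s
    using kernels_bm[OF that f] bm_fst[OF bm_act[OF u, of s]] bm_snd[OF bm_act[OF u, of s]]
    by (rule P.bm_integrable[OF bm_mult[OF _ bm_mult]])
  have "(\<Sum>s\<in>S. \<integral>z. (k z + l z) / 2 * (u (act s (fst z)) * u (act s (snd z))) \<partial>(\<mu> \<Otimes>\<^sub>M \<mu>))
      = (\<Sum>s\<in>S. ((\<integral>z. k z * (u (act s (fst z)) * u (act s (snd z))) \<partial>(\<mu> \<Otimes>\<^sub>M \<mu>))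
          + (\<integral>z. l z * (u (act s (fst z)) * u (act s (snd z))) \<partial>(\<mu> \<Otimes>\<^sub>M \<mu>))) / 2)"
  proof (rule sum.cong)
    fix s
    have "(\<integral>z. (k z + l z) / 2 * (u (act s (fst z)) * u (act s (snd z))) \<partial>(\<mu> \<Otimes>\<^sub>M \<mu>))
      = (\<integral>z. (k z * (u (act s (fst z)) * u (act s (snd z))) + l z * (u (act s (fst z)) * u (act s (snd z)))) / 2 \<partial>(\<mu> \<Otimes>\<^sub>M \<mu>))"
      by (intro Bochner_Integration.integral_cong) (auto simp: algebra_simps)
    also have "\<dots> = ((\<integral>z. k z * (u (act s (fst z)) * u (act s (snd z))) \<partial>(\<mu> \<Otimes>\<^sub>M \<mu>))
          + (\<integral>z. l z * (u (act s (fst z)) * u (act s (snd z))) \<partial>(\<mu> \<Otimes>\<^sub>M \<mu>))) / 2"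
      using i[OF mid.hyps(1)] i[OF mid.hyps(2)] by simp
    finally show "(\<integral>z. (k z + l z) / 2 * (u (act s (fst z)) * u (act s (snd z))) \<partial>(\<mu> \<Otimes>\<^sub>M \<mu>)) = \<dots>" .
  qed simp
  then show ?case using mid.IH by (simp add: sum.distrib flip: sum_divide_distrib)
qed

text \<open>Since \<open>K\<close> is invariant, in the limit every summand of
  \<open>kernels_energy\<close> becomes the same integral, whatever \<open>s\<close> is, and the sum
  is \<open>card S\<close> times the quadratic form of \<open>kop K\<close>. The factor depends on
  \<open>\<eta>\<close> through the net, but not on \<open>u\<close>. Boundedness of
  \<open>u\<close> makes \<open>L\<^sup>1\<close>-convergence of the kernels sufficient.\<close>

lemma invariant_kernel_energy:
  assumes ds: "discrete_spectrum act \<mu>" and f: "continuous_on UNIV f"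
    and K: "K \<in> bm (\<mu> \<Otimes>\<^sub>M \<mu>)" and k: "\<And>j::nat. k j \<in> kernels f"
    and lim: "(\<lambda>j. \<integral>z. \<bar>k j z - K z\<bar> \<partial>(\<mu> \<Otimes>\<^sub>M \<mu>)) \<longlonglongrightarrow> 0"
    and inv: "\<And>g. AE z in \<mu> \<Otimes>\<^sub>M \<mu>. K (act_pair g z) = K z"
    and "\<eta> > 0"
  obtains r :: real where "r \<ge> 0" "\<And>u. u \<in> bm \<mu> \<Longrightarrow>
    (\<integral>x. f x * u x \<partial>\<mu>)\<^sup>2 / 2 - \<eta> * (\<integral>x. (u x)\<^sup>2 \<partial>\<mu>) \<le> r * (\<integral>x. u x * kop K u x \<partial>\<mu>)"
proof -
  have f_bm: "f \<in> bm \<mu>" by (rule bm_continuous[OF f])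
  have "continuous_on UNIV (\<lambda>x. complex_of_real (f x))" by (intro continuous_intros f)
  then obtain S where S: "finite S" "\<forall>g. \<exists>s\<in>S. L2_gap (\<lambda>x. complex_of_real (f x)) s g < \<eta>"
    using ds \<open>\<eta> > 0\<close> unfolding discrete_spectrum_iff by blast
  have net: "\<exists>s\<in>S. (\<integral>x. (f (act s x) - f (act g x))\<^sup>2 \<partial>\<mu>) \<le> \<eta>" for g
  proof -
    obtain s where "s \<in> S" "L2_gap (\<lambda>x. complex_of_real (f x)) s g < \<eta>" using S(2) by blast
    moreover have "L2_gap (\<lambda>x. complex_of_real (f x)) s g = (\<integral>x. (f (act s x) - f (act g x))\<^sup>2 \<partial>\<mu>)"
      unfolding L2_gap_def of_real_diff[symmetric] norm_of_real by simp
    ultimately show ?thesis by (intro bexI[of _ s]) auto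
  qed
  have main: "(\<integral>x. f x * u x \<partial>\<mu>)\<^sup>2 / 2 - \<eta> * (\<integral>x. (u x)\<^sup>2 \<partial>\<mu>) \<le> real (card S) * (\<integral>x. u x * kop K u x \<partial>\<mu>)"
    if u: "u \<in> bm \<mu>" for u
  proof -
    define w where "w z = u (fst z) * u (snd z)" for z
    have w: "w \<in> bm (\<mu> \<Otimes>\<^sub>M \<mu>)"
      unfolding w_def[abs_def] by (rule bm_mult[OF bm_fst[OF u] bm_snd[OF u]])
    have lim_s: "(\<lambda>j. \<integral>z. k j z * w (act_pair s z) \<partial>(\<mu> \<Otimes>\<^sub>M \<mu>)) \<longlonglongrightarrow> (\<integral>z. K z * w z \<partial>(\<mu> \<Otimes>\<^sub>M \<mu>))" for s
    proof -
      have ws: "(\<lambda>z. w (act_pair s z)) \<in> bm (\<mu> \<Otimes>\<^sub>M \<mu>)" by (rule bm_act_pair[OF w])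
      obtain B where B: "B > 0" "\<And>z. \<bar>w z\<bar> \<le> B" by (rule bmE[OF w], rule that)
      have Kw: "(\<lambda>z. K z * w z) \<in> borel_measurable (\<mu> \<Otimes>\<^sub>M \<mu>)"
        by (rule bm_measurable[OF bm_mult[OF K w]])
      have "(\<integral>z. K z * w z \<partial>(\<mu> \<Otimes>\<^sub>M \<mu>)) = (\<integral>z. K (act_pair s z) * w (act_pair s z) \<partial>(\<mu> \<Otimes>\<^sub>M \<mu>))"
        by (rule integral_act_pair[OF Kw, symmetric])
      also have "\<dots> = (\<integral>z. K z * w (act_pair s z) \<partial>(\<mu> \<Otimes>\<^sub>M \<mu>))"
      proof (rule integral_cong_AE)
        show "AE z in \<mu> \<Otimes>\<^sub>M \<mu>. K (act_pair s z) * w (act_pair s z) = K z * w (act_pair s z)"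
          using inv[of s] by eventually_elim simp
      qed (rule bm_measurable, intro bm_intros bm_act_pair K w)+
      finally have eq: "(\<integral>z. K z * w z \<partial>(\<mu> \<Otimes>\<^sub>M \<mu>)) = (\<integral>z. K z * w (act_pair s z) \<partial>(\<mu> \<Otimes>\<^sub>M \<mu>))" .
      have "(\<lambda>j. (\<integral>z. k j z * w (act_pair s z) \<partial>(\<mu> \<Otimes>\<^sub>M \<mu>)) - (\<integral>z. K z * w z \<partial>(\<mu> \<Otimes>\<^sub>M \<mu>))) \<longlonglongrightarrow> 0"
      proof (rule Lim_null_comparison)
        show "(\<lambda>j. B * (\<integral>z. \<bar>k j z - K z\<bar> \<partial>(\<mu> \<Otimes>\<^sub>M \<mu>))) \<longlonglongrightarrow> 0"
          using tendsto_mult_left[OF lim, of B] by simp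
        have "norm ((\<integral>z. k j z * w (act_pair s z) \<partial>(\<mu> \<Otimes>\<^sub>M \<mu>)) - (\<integral>z. K z * w z \<partial>(\<mu> \<Otimes>\<^sub>M \<mu>)))
            \<le> B * (\<integral>z. \<bar>k j z - K z\<bar> \<partial>(\<mu> \<Otimes>\<^sub>M \<mu>))" for j
        proof -
          have kb: "k j \<in> bm (\<mu> \<Otimes>\<^sub>M \<mu>)" by (rule kernels_bm[OF k f_bm])
          have i: "integrable (\<mu> \<Otimes>\<^sub>M \<mu>) (\<lambda>z. k j z * w (act_pair s z))"
            "integrable (\<mu> \<Otimes>\<^sub>M \<mu>) (\<lambda>z. K z * w (act_pair s z))"
            by (intro P.bm_integrable bm_mult kb K ws)+
          have "(\<integral>z. k j z * w (act_pair s z) \<partial>(\<mu> \<Otimes>\<^sub>M \<mu>)) - (\<integral>z. K z * w z \<partial>(\<mu> \<Otimes>\<^sub>M \<mu>))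
              = (\<integral>z. (k j z - K z) * w (act_pair s z) \<partial>(\<mu> \<Otimes>\<^sub>M \<mu>))"
            unfolding eq using i by (simp add: left_diff_distrib)
          also have "norm \<dots> \<le> (\<integral>z. \<bar>(k j z - K z) * w (act_pair s z)\<bar> \<partial>(\<mu> \<Otimes>\<^sub>M \<mu>))"
            by (simp add: integral_abs_bound)
          also have "\<dots> \<le> (\<integral>z. B * \<bar>k j z - K z\<bar> \<partial>(\<mu> \<Otimes>\<^sub>M \<mu>))"
          proof (intro integral_mono P.bm_integrable bm_abs bm_mult bm_diff bm_const kb K ws)
            fix z
            have "\<bar>k j z - K z\<bar> * \<bar>w (act_pair s z)\<bar> \<le> \<bar>k j z - K z\<bar> * B"
              by (intro mult_left_mono B) auto
            then show "\<bar>(k j z - K z) * w (act_pair s z)\<bar> \<le> B * \<bar>k j z - K z\<bar>"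
              by (simp add: abs_mult mult.commute)
          qed
          finally show ?thesis by simp
        qed
        then show "eventually (\<lambda>j. norm ((\<integral>z. k j z * w (act_pair s z) \<partial>(\<mu> \<Otimes>\<^sub>M \<mu>)) - (\<integral>z. K z * w z \<partial>(\<mu> \<Otimes>\<^sub>M \<mu>)))
            \<le> B * (\<integral>z. \<bar>k j z - K z\<bar> \<partial>(\<mu> \<Otimes>\<^sub>M \<mu>))) sequentially" by simp
      qed
      then show ?thesis by (rule LIM_zero_cancel)
    qed
    have "(\<lambda>j. \<Sum>s\<in>S. \<integral>z. k j z * w (act_pair s z) \<partial>(\<mu> \<Otimes>\<^sub>M \<mu>)) \<longlonglongrightarrow> (\<Sum>s\<in>S. \<integral>z. K z * w z \<partial>(\<mu> \<Otimes>\<^sub>M \<mu>))"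
      by (intro tendsto_sum lim_s)
    then have "(\<integral>x. f x * u x \<partial>\<mu>)\<^sup>2 / 2 - \<eta> * (\<integral>x. (u x)\<^sup>2 \<partial>\<mu>) \<le> (\<Sum>s\<in>S. \<integral>z. K z * w z \<partial>(\<mu> \<Otimes>\<^sub>M \<mu>))"
    proof (rule LIMSEQ_le_const, intro exI allI impI)
      fix j
      show "(\<integral>x. f x * u x \<partial>\<mu>)\<^sup>2 / 2 - \<eta> * (\<integral>x. (u x)\<^sup>2 \<partial>\<mu>) \<le> (\<Sum>s\<in>S. \<integral>z. k j z * w (act_pair s z) \<partial>(\<mu> \<Otimes>\<^sub>M \<mu>))"
        using kernels_energy[OF k[of j] f_bm u S(1) net] by (simp add: w_def act_pair_def)
    qed
    also have "\<dots> = real (card S) * (\<integral>z. K z * w z \<partial>(\<mu> \<Otimes>\<^sub>M \<mu>))" by simp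
    also have "(\<integral>z. K z * w z \<partial>(\<mu> \<Otimes>\<^sub>M \<mu>)) = (\<integral>x. u x * kop K u x \<partial>\<mu>)"
      unfolding integral_mu_mu[OF bm_mult[OF K w]] kop_def
      by (simp add: w_def mult_ac flip: integral_mult_right_zero)
    finally show ?thesis .
  qed
  show ?thesis by (rule that[OF _ main]) simp_all
qed

text \<open>
  The residual \<open>v = f - kop K \<psi>\<close> of a near-minimizer is almost orthogonal to the range of \<open>kop K\<close>; in particular
  \<open>v\<close> has little energy, so it is also almost orthogonal to \<open>f\<close>, hence to itself.
\<close>
lemma range_kop_dense:
  assumes f: "f \<in> bm \<mu>" and K: "K \<in> bm (\<mu> \<Otimes>\<^sub>M \<mu>)"
    and energy: "\<And>\<eta>. \<eta> > 0 \<Longrightarrow> \<exists>r\<ge>0. \<forall>u\<in>bm \<mu>.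
      (\<integral>x. f x * u x \<partial>\<mu>)\<^sup>2 / 2 - \<eta> * (\<integral>x. (u x)\<^sup>2 \<partial>\<mu>) \<le> r * (\<integral>x. u x * kop K u x \<partial>\<mu>)"
    and "e > 0"
  shows "\<exists>\<psi>\<in>bm \<mu>. (\<integral>x. (f x - kop K \<psi> x)\<^sup>2 \<partial>\<mu>) < e"
proof -
  define J where "J \<psi> = (\<integral>x. (f x - kop K \<psi> x)\<^sup>2 \<partial>\<mu>)" for \<psi>
  define d where "d = (INF \<psi>\<in>bm \<mu>. J \<psi>)"
  have ne: "bm \<mu> \<noteq> {}" using bm_const[of 0 \<mu>] by blast
  have J0: "0 \<le> J \<psi>" for \<psi> by (simp add: J_def)
  have d_le: "d \<le> J \<psi>" if "\<psi> \<in> bm \<mu>" for \<psi>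
    unfolding d_def by (rule cINF_lower[OF _ that]) (auto intro!: bdd_belowI[of _ 0] J0)
  have d0: "0 \<le> d" unfolding d_def by (rule cINF_greatest[OF ne]) (rule J0)
  obtain B where B: "B > 0" "\<And>z. \<bar>K z\<bar> \<le> B" by (rule bmE[OF K], rule that)
  define F2 where "F2 = (\<integral>x. (f x)\<^sup>2 \<partial>\<mu>)"
  define Q where "Q = F2 + 1"
  have F2: "0 \<le> F2" by (simp add: F2_def)
  have "J (\<lambda>_. 0) = F2" by (simp add: J_def F2_def kop_def)
  then have dF: "d \<le> F2" using d_le[OF bm_const[of 0]] by simp
  \<comment> \<open>As \<open>r\<close> depends on \<open>\<eta>\<close>, first \<open>t\<close>
    tends to \<open>0\<close> for fixed \<open>\<eta>\<close>, and only then \<open>\<eta>\<close>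
    is made small.\<close>
  have est: "d \<le> sqrt (2 * (\<eta> * Q + r * sqrt (t * (B\<^sup>2 * Q)))) + sqrt (t * (4 * Q))"
    if \<eta>: "\<eta> > 0" and r: "r \<ge> 0" and t: "0 < t" "t \<le> 1"
      and E: "\<forall>u\<in>bm \<mu>. (\<integral>x. f x * u x \<partial>\<mu>)\<^sup>2 / 2 - \<eta> * (\<integral>x. (u x)\<^sup>2 \<partial>\<mu>) \<le> r * (\<integral>x. u x * kop K u x \<partial>\<mu>)"
    for \<eta> r t
  proof -
    have "Inf (J ` bm \<mu>) < d + t" using t by (simp add: d_def)
    then obtain \<psi> where \<psi>: "\<psi> \<in> bm \<mu>" "J \<psi> < d + t"
      using cInf_lessD[of "J ` bm \<mu>"] ne by blast
    define v where "v x = f x - kop K \<psi> x" for x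
    have v: "v \<in> bm \<mu>" unfolding v_def[abs_def] by (intro bm_diff f bm_kop K \<psi>(1))
    define R where "R = (\<integral>x. (v x)\<^sup>2 \<partial>\<mu>)"
    have R: "d \<le> R" "R \<le> d + t" "0 \<le> R" "R \<le> Q"
      using d_le[OF \<psi>(1)] \<psi>(2) dF t unfolding R_def v_def J_def Q_def by auto
    \<comment> \<open>Moving \<open>\<psi>\<close> by \<open>s * \<xi>\<close> can lower
      \<open>J\<close> by at most \<open>t\<close>, because \<open>J \<psi> < d + t\<close>. This
      holds for every \<open>s\<close>, so the discriminant bound applies.\<close>
    have orth: "(\<integral>x. v x * kop K \<xi> x \<partial>\<mu>)\<^sup>2 \<le> t * (\<integral>x. (kop K \<xi> x)\<^sup>2 \<partial>\<mu>)" if \<xi>: "\<xi> \<in> bm \<mu>" for \<xi>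
    proof (rule square_le_mult_of_quadratic)
      fix s :: real
      have i: "integrable \<mu> (\<lambda>x. (v x)\<^sup>2)" "integrable \<mu> (\<lambda>x. v x * kop K \<xi> x)" "integrable \<mu> (\<lambda>x. (kop K \<xi> x)\<^sup>2)"
        by (intro mu.bm_integrable bm_power2 bm_mult v bm_kop K \<xi>)+
      have "d \<le> J (\<lambda>y. \<psi> y + s * \<xi> y)" by (intro d_le bm_add bm_mult bm_const \<psi>(1) \<xi>)
      also have "\<dots> = (\<integral>x. (v x)\<^sup>2 - 2 * s * (v x * kop K \<xi> x) + s\<^sup>2 * (kop K \<xi> x)\<^sup>2 \<partial>\<mu>)"
        unfolding J_def v_def kop_add_mult[OF K \<psi>(1) \<xi>]
        by (intro Bochner_Integration.integral_cong) (auto simp: power2_eq_square algebra_simps)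
      also have "\<dots> = R - 2 * s * (\<integral>x. v x * kop K \<xi> x \<partial>\<mu>) + s\<^sup>2 * (\<integral>x. (kop K \<xi> x)\<^sup>2 \<partial>\<mu>)"
        using i by (simp add: R_def)
      finally show "2 * s * (\<integral>x. v x * kop K \<xi> x \<partial>\<mu>) \<le> t + s\<^sup>2 * (\<integral>x. (kop K \<xi> x)\<^sup>2 \<partial>\<mu>)"
        using R(2) by linarith
    qed simp
    \<comment> \<open>\<open>orth\<close> is used with \<open>\<xi> = v\<close>, bounding the energy
      \<open>a1\<close> of the residual, and with \<open>\<xi> = \<psi>\<close>, bounding its
      correlation \<open>a2\<close> with the approximation. The energy inequality converts
      \<open>a1\<close> into a bound on \<open>a3\<close>, and \<open>R = a3 - a2\<close>.\<close>
    define a1 where "a1 = (\<integral>x. v x * kop K v x \<partial>\<mu>)"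
    define a2 where "a2 = (\<integral>x. v x * kop K \<psi> x \<partial>\<mu>)"
    have "a1\<^sup>2 \<le> t * (\<integral>x. (kop K v x)\<^sup>2 \<partial>\<mu>)" unfolding a1_def by (rule orth[OF v])
    also have "\<dots> \<le> t * (B\<^sup>2 * Q)"
    proof -
      have "(\<integral>x. (kop K v x)\<^sup>2 \<partial>\<mu>) \<le> B\<^sup>2 * R" unfolding R_def by (rule kop_sqnorm_le[OF K B(2) v])
      also have "\<dots> \<le> B\<^sup>2 * Q" using R(4) by (intro mult_left_mono) auto
      finally show ?thesis using t by simp
    qed
    finally have a1: "a1 \<le> sqrt (t * (B\<^sup>2 * Q))" by (intro real_le_rsqrt)
    have "a2\<^sup>2 \<le> t * (\<integral>x. (kop K \<psi> x)\<^sup>2 \<partial>\<mu>)" unfolding a2_def by (rule orth[OF \<psi>(1)])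
    also have "\<dots> \<le> t * (4 * Q)"
    proof -
      have i: "integrable \<mu> (\<lambda>x. (f x)\<^sup>2)" "integrable \<mu> (\<lambda>x. (v x)\<^sup>2)" "integrable \<mu> (\<lambda>x. (kop K \<psi> x)\<^sup>2)"
        by (intro mu.bm_integrable bm_power2 v f bm_kop K \<psi>(1))+
      have "(\<integral>x. (kop K \<psi> x)\<^sup>2 \<partial>\<mu>) \<le> (\<integral>x. 2 * (f x)\<^sup>2 + 2 * (v x)\<^sup>2 \<partial>\<mu>)"
      proof (rule integral_mono)
        fix x
        have "(f x - v x)\<^sup>2 \<le> 2 * (f x)\<^sup>2 + 2 * (v x)\<^sup>2"
          using zero_le_power2[of "f x + v x"] by (simp add: power2_eq_square algebra_simps)
        then show "(kop K \<psi> x)\<^sup>2 \<le> 2 * (f x)\<^sup>2 + 2 * (v x)\<^sup>2" by (simp add: v_def)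
      qed (use i in auto)
      also have "\<dots> = 2 * F2 + 2 * R" using i by (simp add: F2_def R_def)
      also have "\<dots> \<le> 4 * Q" using R(4) by (simp add: Q_def)
      finally show ?thesis using t by simp
    qed
    finally have "(- a2)\<^sup>2 \<le> t * (4 * Q)" by simp
    then have a2: "- a2 \<le> sqrt (t * (4 * Q))" by (rule real_le_rsqrt)
    define a3 where "a3 = (\<integral>x. f x * v x \<partial>\<mu>)"
    have "a3\<^sup>2 / 2 - \<eta> * R \<le> r * a1" using E v unfolding a3_def R_def a1_def by blast
    also have "\<dots> \<le> r * sqrt (t * (B\<^sup>2 * Q))" by (intro mult_left_mono a1 r)
    finally have "a3\<^sup>2 / 2 \<le> \<eta> * R + r * sqrt (t * (B\<^sup>2 * Q))" by simp
    also have "\<dots> \<le> \<eta> * Q + r * sqrt (t * (B\<^sup>2 * Q))" using \<eta> R(4) by simp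
    finally have "a3\<^sup>2 \<le> 2 * (\<eta> * Q + r * sqrt (t * (B\<^sup>2 * Q)))" by simp
    then have a3: "a3 \<le> sqrt (2 * (\<eta> * Q + r * sqrt (t * (B\<^sup>2 * Q))))" by (rule real_le_rsqrt)
    have "R = (\<integral>x. f x * v x - v x * kop K \<psi> x \<partial>\<mu>)"
      unfolding R_def by (intro Bochner_Integration.integral_cong) (auto simp: v_def power2_eq_square algebra_simps)
    also have "\<dots> = a3 - a2"
      unfolding a3_def a2_def
      by (rule Bochner_Integration.integral_diff) (intro mu.bm_integrable bm_mult v f bm_kop K \<psi>(1))+
    finally show ?thesis using R(1) a2 a3 by linarith
  qed
  have sq: "d\<^sup>2 \<le> 2 * (\<eta> * Q)" if "\<eta> > 0" for \<eta>
  proof -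
    obtain r where r: "r \<ge> 0" and E: "\<forall>u\<in>bm \<mu>. (\<integral>x. f x * u x \<partial>\<mu>)\<^sup>2 / 2 - \<eta> * (\<integral>x. (u x)\<^sup>2 \<partial>\<mu>) \<le> r * (\<integral>x. u x * kop K u x \<partial>\<mu>)"
      using energy[OF \<open>\<eta> > 0\<close>] by blast
    define t where "t n = inverse (real (Suc n))" for n
    have t: "t \<longlonglongrightarrow> 0" unfolding t_def by (rule LIMSEQ_inverse_real_of_nat)
    have "(\<lambda>n. sqrt (2 * (\<eta> * Q + r * sqrt (t n * (B\<^sup>2 * Q)))) + sqrt (t n * (4 * Q)))
        \<longlonglongrightarrow> sqrt (2 * (\<eta> * Q + r * sqrt (0 * (B\<^sup>2 * Q)))) + sqrt (0 * (4 * Q))"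
      by (intro tendsto_intros t)
    then have "d \<le> sqrt (2 * (\<eta> * Q + r * sqrt (0 * (B\<^sup>2 * Q)))) + sqrt (0 * (4 * Q))"
    proof (rule LIMSEQ_le_const, intro exI allI impI)
      fix n
      have "0 < t n" "t n \<le> 1" by (simp_all add: t_def inverse_le_1_iff)
      then show "d \<le> sqrt (2 * (\<eta> * Q + r * sqrt (t n * (B\<^sup>2 * Q)))) + sqrt (t n * (4 * Q))"
        using est[OF \<open>\<eta> > 0\<close> r _ _ E] by blast
    qed
    then have "d \<le> sqrt (2 * (\<eta> * Q))" by simp
    then have "d\<^sup>2 \<le> (sqrt (2 * (\<eta> * Q)))\<^sup>2" using d0 by (intro power_mono)
    also have "\<dots> = 2 * (\<eta> * Q)" using that F2 by (simp add: Q_def)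
    finally show ?thesis .
  qed
  have "d = 0"
  proof (rule ccontr)
    assume "d \<noteq> 0"
    have Q: "Q > 0" using F2 by (simp add: Q_def)
    \<comment> \<open>For this \<open>\<eta>\<close> the bound \<open>2 * (\<eta> * Q)\<close> is
      \<open>d\<^sup>2 / 2\<close>, which is impossible for \<open>d \<noteq> 0\<close>.\<close>
    then have "d\<^sup>2 / (4 * Q) > 0" using \<open>d \<noteq> 0\<close> by simp
    from sq[OF this] have "d\<^sup>2 \<le> d\<^sup>2 / 2" using Q by simp
    then show False using \<open>d \<noteq> 0\<close> by simp
  qed
  then have "Inf (J ` bm \<mu>) < e" using \<open>e > 0\<close> by (simp add: d_def)
  then show ?thesis using cInf_lessD[of "J ` bm \<mu>"] ne unfolding J_def by blast
qed

end

section \<open>Discrete spectrum implies equicontinuity in the mean\<close>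

context folner_system
begin

section \<open>Orbit averages of a single continuous function\<close>

lemma avg_add:
  "set_integrable m (F n) k \<Longrightarrow> set_integrable m (F n) l \<Longrightarrow> avg n (\<lambda>g. k g + l g) = avg n k + avg n l"
  unfolding avg_def by (simp add: set_integral_add distrib_left)

lemma avg_const: "avg n (\<lambda>_. c) = c"
  using measure_F_pos[of n] by (simp add: avg_def set_lebesgue_integral_def)

lemma avg_mono_AE:
  assumes "set_integrable m (F n) k" "set_integrable m (F n) l" "AE g in m. k g \<le> l g"
  shows "avg n k \<le> avg n l"
  unfolding avg_def set_lebesgue_integral_def
proof (intro mult_left_mono integral_mono_AE)
  show "AE g in m. indicat_real (F n) g *\<^sub>R k g \<le> indicat_real (F n) g *\<^sub>R l g"
    using assms(3) by eventually_elim (auto split: split_indicator)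
qed (use assms in \<open>auto simp: set_integrable_def\<close>)

lemma compact_inner_approx:
  assumes "S \<in> sets borel" "e > 0"
  obtains Q where "compact Q" "Q \<subseteq> S" "measure \<mu> Q > measure \<mu> S - e"
proof -
  obtain C U where CU: "closed C" "open U" "C \<subseteq> S" "S \<subseteq> U" "measure \<mu> (U - C) < e"
    using finite_borel_measure_closed_open_approx[OF finite_measure_mu sets_mu assms] by (elim exE conjE)
  have "compact C" using compact_Int_closed[OF compact_X CU(1)] by simp
  have "measure \<mu> S - measure \<mu> C = measure \<mu> (S - C)"
    using CU assms(1) by (intro mu.finite_measure_Diff[symmetric]) auto
  also have "\<dots> \<le> measure \<mu> (U - C)" using CU by (intro mu.finite_measure_mono) auto
  finally show ?thesis using CU that[OF \<open>compact C\<close> CU(3)] by linarith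
qed

text \<open>For fixed \<open>g\<close> the identity holds off a null set of \<open>x\<close> that
  depends on \<open>g\<close>. Interchanging the quantifiers by Fubini gives one null set of
  \<open>x\<close> outside which it holds for almost every \<open>g\<close>, enough for averages
  over \<open>F n\<close>.\<close>

lemma kop_translate_AE:
  assumes K: "K \<in> bm (\<mu> \<Otimes>\<^sub>M \<mu>)" and \<psi>: "\<psi> \<in> bm \<mu>"
    and inv: "\<And>g. AE z in \<mu> \<Otimes>\<^sub>M \<mu>. K (act_pair g z) = K z"
  shows "AE x in \<mu>. AE g in m. kop K \<psi> (act g x) = (\<integral>y. K (x, y) * \<psi> (act g y) \<partial>\<mu>)"
proof -
  have [measurable]: "K \<in> borel_measurable (\<mu> \<Otimes>\<^sub>M \<mu>)" "\<psi> \<in> borel_measurable borel"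
    using bm_measurable[OF K] bm_measurable[OF \<psi>] by simp_all
  have [measurable]: "kop K \<psi> \<in> borel_measurable borel"
    using bm_measurable[OF bm_kop[OF K \<psi>]] by simp
  have "AE x in \<mu>. kop K \<psi> (act g x) = (\<integral>y. K (x, y) * \<psi> (act g y) \<partial>\<mu>)" for g
  proof -
    have "AE x in \<mu>. AE y in \<mu>. K (act_pair g (x, y)) = K (x, y)"
      by (rule mu_mu.AE_pair[OF inv])
    then show ?thesis
    proof eventually_elim
      case (elim x)
      have "kop K \<psi> (act g x) = (\<integral>y. K (act g x, act g y) * \<psi> (act g y) \<partial>\<mu>)"
        unfolding kop_def by (rule integral_act[symmetric]) measurable
      also have "\<dots> = (\<integral>y. K (x, y) * \<psi> (act g y) \<partial>\<mu>)"
      proof (rule integral_cong_AE)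
        show "AE y in \<mu>. K (act g x, act g y) * \<psi> (act g y) = K (x, y) * \<psi> (act g y)"
          using elim by eventually_elim (simp add: act_pair_def)
      qed measurable
      finally show ?case .
    qed
  qed
  then have "AE g in m. AE x in \<mu>. kop K \<psi> (act g x) = (\<integral>y. K (x, y) * \<psi> (act g y) \<partial>\<mu>)" by simp
  then show ?thesis
    by (subst (asm) m_mu.AE_commute) measurable
qed

text \<open>Three sets are removed: \<open>E\<close>, where some average of the error
  \<open>h\<close> is large; \<open>W\<close>, where the section of \<open>K\<close> is far from
  that of the continuous kernel \<open>k j\<close>; and the null set \<open>N\<close>, off which the
  translation formula holds for almost every \<open>g\<close>. The modulus \<open>\<delta>\<close>
  comes from \<open>k j\<close> alone.\<close>

lemma orbit_average_small:
  assumes ds: "discrete_spectrum act \<mu>" and tempered: "tempered m F"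
    and f: "continuous_on UNIV f" and "\<epsilon> > 0" and "\<tau> > 0"
  shows "\<exists>Q. compact Q \<and> measure \<mu> Q > 1 - \<tau> \<and> (\<exists>\<delta>>0. \<forall>x\<in>Q. \<forall>y\<in>Q. dist x y < \<delta> \<longrightarrow>
    (\<forall>n. avg n (\<lambda>g. \<bar>f (act g x) - f (act g y)\<bar>) < (\<epsilon>::real)))"
proof -
  have f_bm: "f \<in> bm \<mu>" by (rule bm_continuous[OF f])
  obtain C where "C > 0" and C_all: "\<forall>n. emeasure m (\<Union>k<n. F_quot k n) \<le> ennreal C * emeasure m (F n)"
    using tempered unfolding tempered_def by (elim exE conjE)
  note C = \<open>C > 0\<close> C_all[rule_format]
  obtain K k where K: "K \<in> bm (\<mu> \<Otimes>\<^sub>M \<mu>)" and k: "\<And>j::nat. k j \<in> kernels f"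
    and lim: "(\<lambda>j. \<integral>z. \<bar>k j z - K z\<bar> \<partial>(\<mu> \<Otimes>\<^sub>M \<mu>)) \<longlonglongrightarrow> 0"
    and inv: "\<And>g. AE z in \<mu> \<Otimes>\<^sub>M \<mu>. K (act_pair g z) = K z"
    by (rule invariant_kernel[OF f_bm], rule that)
  \<comment> \<open>With this value the maximal inequality at height \<open>\<epsilon>/8\<close>,
    with constant \<open>2 * (1 + C)\<close>, gives \<open>E\<close> measure at most
    \<open>\<tau> / 4\<close>.\<close>
  define \<kappa> where "\<kappa> = \<epsilon> / 8 * \<tau> / (8 * (1 + C))"
  have \<kappa>: "\<kappa> > 0" using \<open>\<epsilon> > 0\<close> \<open>\<tau> > 0\<close> C(1) by (simp add: \<kappa>_def)
  have "\<exists>\<psi>\<in>bm \<mu>. (\<integral>x. (f x - kop K \<psi> x)\<^sup>2 \<partial>\<mu>) < \<kappa>\<^sup>2"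
  proof (rule range_kop_dense[OF f_bm K])
    fix \<eta> :: real assume "\<eta> > 0"
    obtain r :: real where "r \<ge> 0" "\<And>u. u \<in> bm \<mu> \<Longrightarrow>
      (\<integral>x. f x * u x \<partial>\<mu>)\<^sup>2 / 2 - \<eta> * (\<integral>x. (u x)\<^sup>2 \<partial>\<mu>) \<le> r * (\<integral>x. u x * kop K u x \<partial>\<mu>)"
      by (rule invariant_kernel_energy[OF ds f K k lim inv \<open>\<eta> > 0\<close>], rule that)
    then show "\<exists>r\<ge>0. \<forall>u\<in>bm \<mu>. (\<integral>x. f x * u x \<partial>\<mu>)\<^sup>2 / 2 - \<eta> * (\<integral>x. (u x)\<^sup>2 \<partial>\<mu>) \<le> r * (\<integral>x. u x * kop K u x \<partial>\<mu>)"
      by auto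
  qed (use \<kappa> in simp)
  then obtain \<psi> where \<psi>: "\<psi> \<in> bm \<mu>" "(\<integral>x. (f x - kop K \<psi> x)\<^sup>2 \<partial>\<mu>) < \<kappa>\<^sup>2" by blast
  obtain \<Psi> where \<Psi>: "\<Psi> > 0" "\<And>x. \<bar>\<psi> x\<bar> \<le> \<Psi>" by (rule bmE[OF \<psi>(1)], rule that)
  define \<phi> where "\<phi> = kop K \<psi>"
  have \<phi>: "\<phi> \<in> bm \<mu>" unfolding \<phi>_def by (rule bm_kop[OF K \<psi>(1)])
  define h where "h x = \<bar>f x - \<phi> x\<bar>" for x
  have h_bm: "h \<in> bm \<mu>" unfolding h_def[abs_def] by (intro bm_abs bm_diff f_bm \<phi>)
  obtain H where H: "H > 0" "\<And>x. \<bar>h x\<bar> \<le> H" by (rule bmE[OF h_bm], rule that)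
  have h0: "0 \<le> h x" for x by (simp add: h_def)
  have [measurable]: "h \<in> borel_measurable borel" "f \<in> borel_measurable borel" "\<psi> \<in> borel_measurable borel"
      "\<phi> \<in> borel_measurable borel" "K \<in> borel_measurable (\<mu> \<Otimes>\<^sub>M \<mu>)"
    using bm_measurable[OF h_bm] bm_measurable[OF f_bm] bm_measurable[OF \<psi>(1)] bm_measurable[OF \<phi>] bm_measurable[OF K]
    by simp_all
  have int_h: "(\<integral>x. h x \<partial>\<mu>) \<le> \<kappa>"
  proof -
    have "(\<integral>x. h x \<partial>\<mu>)\<^sup>2 \<le> (\<integral>x. (h x)\<^sup>2 \<partial>\<mu>)"
      using mu.integral_squared_le[OF mu.bm_integrable[OF h_bm] mu.bm_integrable[OF bm_power2[OF h_bm]]] by simp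
    also have "(\<integral>x. (h x)\<^sup>2 \<partial>\<mu>) = (\<integral>x. (f x - kop K \<psi> x)\<^sup>2 \<partial>\<mu>)"
      unfolding h_def \<phi>_def power2_abs ..
    also have "\<dots> \<le> \<kappa>\<^sup>2" by (rule less_imp_le[OF \<psi>(2)])
    finally show ?thesis by (rule power2_le_imp_le) (rule less_imp_le[OF \<kappa>])
  qed
  define E where "E = {x. \<exists>n. ennreal (\<epsilon>/8) * emeasure m (F n) \<le> (\<integral>\<^sup>+g\<in>F n. ennreal (h (act g x)) \<partial>m)}"
  have E_sets [measurable]: "E \<in> sets borel"
  proof -
    have "{x \<in> space borel. \<exists>n. ennreal (\<epsilon>/8) * emeasure m (F n) \<le> (\<integral>\<^sup>+g\<in>F n. ennreal (h (act g x)) \<partial>m)} \<in> sets borel"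
      by measurable
    then show ?thesis by (simp add: E_def)
  qed
  have E_small: "measure \<mu> E \<le> \<tau> / 4"
  proof -
    have "ennreal (\<epsilon>/8) * emeasure \<mu> E \<le> 2 * (1 + ennreal C) * (\<integral>\<^sup>+x. ennreal (h x) \<partial>\<mu>)"
      unfolding E_def by (rule maximal_inequality[OF _ C(2)]) measurable
    also have "(\<integral>\<^sup>+x. ennreal (h x) \<partial>\<mu>) = ennreal (\<integral>x. h x \<partial>\<mu>)"
      by (rule nn_integral_eq_integral[OF mu.bm_integrable[OF h_bm]]) (simp add: h0)
    also have "2 * (1 + ennreal C) * \<dots> = ennreal (2 * (1 + C) * (\<integral>x. h x \<partial>\<mu>))"
      using C(1) by (simp add: ennreal_mult' ennreal_plus)
    finally have "\<epsilon>/8 * measure \<mu> E \<le> 2 * (1 + C) * (\<integral>x. h x \<partial>\<mu>)"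
      using \<open>\<epsilon> > 0\<close> C(1) h0 unfolding mu.emeasure_eq_measure
      by (simp add: ennreal_le_iff flip: ennreal_mult')
    also have "\<dots> \<le> 2 * (1 + C) * \<kappa>" using int_h C(1) by (intro mult_left_mono) auto
    also have "\<dots> = \<epsilon>/8 * (\<tau> / 4)" using C(1) by (simp add: \<kappa>_def field_simps)
    finally show ?thesis using \<open>\<epsilon> > 0\<close> by simp
  qed
  have "\<epsilon> / (8 * \<Psi>) * (\<tau> / 4) > 0" using \<open>\<epsilon> > 0\<close> \<open>\<tau> > 0\<close> \<Psi>(1) by simp
  then have "eventually (\<lambda>j. (\<integral>z. \<bar>k j z - K z\<bar> \<partial>(\<mu> \<Otimes>\<^sub>M \<mu>)) < \<epsilon> / (8 * \<Psi>) * (\<tau> / 4)) sequentially"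
    by (rule order_tendstoD(2)[OF lim])
  then obtain j where j: "(\<integral>z. \<bar>k j z - K z\<bar> \<partial>(\<mu> \<Otimes>\<^sub>M \<mu>)) < \<epsilon> / (8 * \<Psi>) * (\<tau> / 4)"
    by (auto simp: eventually_sequentially)
  have kj_bm: "k j \<in> bm (\<mu> \<Otimes>\<^sub>M \<mu>)" by (rule kernels_bm[OF k f_bm])
  have kK_bm: "(\<lambda>z. \<bar>k j z - K z\<bar>) \<in> bm (\<mu> \<Otimes>\<^sub>M \<mu>)" by (intro bm_abs bm_diff kj_bm K)
  define w where "w x = (\<integral>y. \<bar>k j (x, y) - K (x, y)\<bar> \<partial>\<mu>)" for x
  have w_bm: "w \<in> bm \<mu>" unfolding w_def[abs_def] by (rule bm_integral_section[OF kK_bm])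
  have w_meas [measurable]: "w \<in> borel_measurable borel" using bm_measurable[OF w_bm] by simp
  have w0: "0 \<le> w x" for x by (simp add: w_def)
  \<comment> \<open>Markov for \<open>w\<close>, whose integral is the
    \<open>L\<^sup>1\<close>-distance of \<open>k j\<close> and \<open>K\<close>. Dividing by
    \<open>\<Psi>\<close> offsets the later multiplication by \<open>\<psi>\<close>.\<close>
  define W where "W = {x. \<epsilon> / (8 * \<Psi>) \<le> w x}"
  have W_sets [measurable]: "W \<in> sets borel"
  proof -
    have "{x \<in> space borel. \<epsilon> / (8 * \<Psi>) \<le> w x} \<in> sets borel" by measurable
    then show ?thesis by (simp add: W_def)
  qed
  have W_small: "measure \<mu> W \<le> \<tau> / 4"
  proof -
    have "\<epsilon> / (8 * \<Psi>) * measure \<mu> W = (\<integral>x. \<epsilon> / (8 * \<Psi>) * indicator W x \<partial>\<mu>)" by simp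
    also have "\<dots> \<le> (\<integral>x. w x \<partial>\<mu>)"
    proof (rule integral_mono)
      show "integrable \<mu> (\<lambda>x. \<epsilon> / (8 * \<Psi>) * indicator W x)"
        by (rule mu.bm_integrable, rule bm_mult[OF bm_const], rule bmI[of _ _ 1]) (auto split: split_indicator)
      show "\<epsilon> / (8 * \<Psi>) * indicator W x \<le> w x" for x
        using w0[of x] by (auto simp: W_def split: split_indicator)
    qed (rule mu.bm_integrable[OF w_bm])
    also have "\<dots> = (\<integral>z. \<bar>k j z - K z\<bar> \<partial>(\<mu> \<Otimes>\<^sub>M \<mu>))"
      unfolding w_def by (rule integral_mu_mu[OF kK_bm, symmetric])
    also have "\<dots> \<le> \<epsilon> / (8 * \<Psi>) * (\<tau> / 4)" using j by simp
    finally show ?thesis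
      by (rule mult_left_le_imp_le) (use \<open>\<epsilon> > 0\<close> \<Psi>(1) in simp)
  qed
  have "\<epsilon> / (8 * \<Psi>) > 0" using \<open>\<epsilon> > 0\<close> \<Psi>(1) by simp
  from kernels_equicontinuous[OF k[of j] f this] obtain \<delta> where \<delta>: "\<delta> > 0"
    "\<forall>x x' y. dist x x' < \<delta> \<longrightarrow> \<bar>k j (x, y) - k j (x', y)\<bar> < \<epsilon> / (8 * \<Psi>)"
    by (elim exE conjE)
  obtain N where N: "N \<in> sets \<mu>" "emeasure \<mu> N = 0"
    "{x \<in> space \<mu>. \<not> (AE g in m. \<phi> (act g x) = (\<integral>y. K (x, y) * \<psi> (act g y) \<partial>\<mu>))} \<subseteq> N"
    using kop_translate_AE[OF K \<psi>(1) inv] unfolding \<phi>_def[symmetric]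
    by (elim AE_E) (rule that)
  define S where "S = - (E \<union> W \<union> N)"
  have S_sets: "S \<in> sets borel" using N(1) unfolding S_def by auto
  have "measure \<mu> (E \<union> W \<union> N) \<le> measure \<mu> E + measure \<mu> W + measure \<mu> N"
    using N(1) by (intro order_trans[OF measure_Un_le] add_right_mono measure_Un_le) auto
  also have "\<dots> \<le> \<tau> / 2" using E_small W_small N(2) by (simp add: measure_def)
  finally have "measure \<mu> (E \<union> W \<union> N) \<le> \<tau> / 2" .
  then have S: "measure \<mu> S \<ge> 1 - \<tau> / 2"
    using mu.finite_measure_compl[of "E \<union> W \<union> N"] N(1) by (simp add: S_def Compl_eq_Diff_UNIV)
  obtain Q where Q: "compact Q" "Q \<subseteq> S" "measure \<mu> Q > measure \<mu> S - \<tau> / 2"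
    by (rule compact_inner_approx[OF S_sets, of "\<tau> / 2"]) (use \<open>\<tau> > 0\<close> that in auto)
  have "avg n (\<lambda>g. \<bar>f (act g x) - f (act g x')\<bar>) < \<epsilon>" if "x \<in> Q" "x' \<in> Q" "dist x x' < \<delta>" for x x' n
  proof -
    have h_avg: "avg n (\<lambda>g. h (act g x)) < \<epsilon> / 8" if "x \<in> Q" for x
    proof -
      have "x \<notin> E" using that Q(2) by (auto simp: S_def)
      then have "(\<integral>\<^sup>+g\<in>F n. ennreal (h (act g x)) \<partial>m) < ennreal (\<epsilon>/8) * emeasure m (F n)"
        by (simp add: E_def not_le)
      moreover have "(\<integral>\<^sup>+g\<in>F n. ennreal (h (act g x)) \<partial>m) = emeasure m (F n) * ennreal (avg n (\<lambda>g. h (act g x)))"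
        by (rule nn_integral_avg[where K = H]) (use H h0 in \<open>auto simp: abs_le_iff\<close>)
      ultimately have "emeasure m (F n) * ennreal (avg n (\<lambda>g. h (act g x))) < emeasure m (F n) * ennreal (\<epsilon>/8)"
        by (simp only: mult.commute)
      then have "\<not> ennreal (\<epsilon>/8) \<le> ennreal (avg n (\<lambda>g. h (act g x)))"
        by (metis mult_left_mono not_le zero_le)
      then show ?thesis by (meson ennreal_leI not_le)
    qed
    have i: "set_integrable m (F n) (\<lambda>g. h (act g x))" for x
      by (rule set_integrable_F[of _ H]) (use H in auto)
    obtain FF where FF: "\<And>x. \<bar>f x\<bar> \<le> FF" by (rule bmE[OF f_bm], rule that)
    have i_f: "set_integrable m (F n) (\<lambda>g. \<bar>f (act g x) - f (act g x')\<bar>)"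
    proof (rule set_integrable_F[of _ "2 * FF"])
      show "\<bar>\<bar>f (act g x) - f (act g x')\<bar>\<bar> \<le> 2 * FF" for g
        using FF[of "act g x"] FF[of "act g x'"] by linarith
    qed measurable
    have ic: "set_integrable m (F n) (\<lambda>g. c)" for c :: real
      by (rule set_integrable_F[of _ "\<bar>c\<bar>"]) auto
    \<comment> \<open>A detour through \<open>k j\<close>: two values of \<open>w\<close> outside
      \<open>W\<close> and one oscillation of \<open>k j\<close>, each below
      \<open>\<epsilon> / (8 * \<Psi>)\<close>.\<close>
    have "(\<integral>y. \<bar>K (x, y) - K (x', y)\<bar> \<partial>\<mu>) \<le> 3 * (\<epsilon> / (8 * \<Psi>))"
    proof -
      have "(\<integral>y. \<bar>K (x, y) - K (x', y)\<bar> \<partial>\<mu>)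
          \<le> (\<integral>y. \<bar>k j (x, y) - K (x, y)\<bar> + \<bar>k j (x', y) - K (x', y)\<bar> + \<epsilon> / (8 * \<Psi>) \<partial>\<mu>)"
      proof (intro integral_mono mu.bm_integrable bm_abs bm_diff bm_add bm_const bm_section K kj_bm)
        fix y
        have "\<bar>k j (x, y) - k j (x', y)\<bar> < \<epsilon> / (8 * \<Psi>)" using \<delta>(2) that(3) by blast
        then show "\<bar>K (x, y) - K (x', y)\<bar> \<le> \<bar>k j (x, y) - K (x, y)\<bar> + \<bar>k j (x', y) - K (x', y)\<bar> + \<epsilon> / (8 * \<Psi>)"
          by linarith
      qed
      also have "\<dots> = w x + w x' + \<epsilon> / (8 * \<Psi>)"
      proof -
        have "integrable \<mu> (\<lambda>y. \<bar>k j (x, y) - K (x, y)\<bar>)" for x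
          by (intro mu.bm_integrable bm_abs bm_diff bm_section K kj_bm)
        then show ?thesis unfolding w_def by simp
      qed
      also have "\<dots> \<le> 3 * (\<epsilon> / (8 * \<Psi>))"
      proof -
        have "x \<notin> W" "x' \<notin> W" using that(1,2) Q(2) by (auto simp: S_def)
        then have "w x < \<epsilon> / (8 * \<Psi>)" "w x' < \<epsilon> / (8 * \<Psi>)" by (simp_all add: W_def)
        then show ?thesis by linarith
      qed
      finally show ?thesis .
    qed
    then have K_diff: "\<Psi> * (\<integral>y. \<bar>K (x, y) - K (x', y)\<bar> \<partial>\<mu>) \<le> 3 * \<epsilon> / 8"
      using \<Psi>(1) by (simp add: field_simps)
    have \<phi>_eq: "AE g in m. \<phi> (act g x) = (\<integral>y. K (x, y) * \<psi> (act g y) \<partial>\<mu>)" if "x \<in> Q" for x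
    proof -
      have "x \<notin> N" using that Q(2) by (auto simp: S_def)
      then show ?thesis using N(3) by auto
    qed
    \<comment> \<open>The averages of \<open>h\<close> stay below \<open>\<epsilon>/8\<close> for
      either point, so the total is below \<open>5 * \<epsilon> / 8\<close>.\<close>
    have "AE g in m. \<bar>f (act g x) - f (act g x')\<bar> \<le> h (act g x) + h (act g x') + 3 * \<epsilon> / 8"
      using \<phi>_eq[OF that(1)] \<phi>_eq[OF that(2)]
    proof eventually_elim
      case (elim g)
      have b: "(\<lambda>y. K (x, y) * \<psi> (act g y)) \<in> bm \<mu>" for x
        by (intro bm_mult bm_section bm_act K \<psi>(1))
      have "\<phi> (act g x) - \<phi> (act g x') = (\<integral>y. (K (x, y) - K (x', y)) * \<psi> (act g y) \<partial>\<mu>)"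
        unfolding elim using mu.bm_integrable[OF b] by (simp add: left_diff_distrib)
      also have "\<bar>\<dots>\<bar> \<le> (\<integral>y. \<bar>(K (x, y) - K (x', y)) * \<psi> (act g y)\<bar> \<partial>\<mu>)"
        by (rule integral_abs_bound)
      also have "\<dots> \<le> (\<integral>y. \<Psi> * \<bar>K (x, y) - K (x', y)\<bar> \<partial>\<mu>)"
      proof (intro integral_mono mu.bm_integrable bm_abs bm_mult bm_diff bm_const bm_section bm_act K \<psi>(1))
        fix y
        have "\<bar>K (x, y) - K (x', y)\<bar> * \<bar>\<psi> (act g y)\<bar> \<le> \<bar>K (x, y) - K (x', y)\<bar> * \<Psi>"
          by (intro mult_left_mono \<Psi>) auto
        then show "\<bar>(K (x, y) - K (x', y)) * \<psi> (act g y)\<bar> \<le> \<Psi> * \<bar>K (x, y) - K (x', y)\<bar>"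
          by (simp add: abs_mult mult.commute)
      qed
      also have "\<dots> \<le> 3 * \<epsilon> / 8" using K_diff by simp
      finally have "\<bar>\<phi> (act g x) - \<phi> (act g x')\<bar> \<le> 3 * \<epsilon> / 8" .
      then show ?case unfolding h_def by linarith
    qed
    then have "avg n (\<lambda>g. \<bar>f (act g x) - f (act g x')\<bar>) \<le> avg n (\<lambda>g. h (act g x) + h (act g x') + 3 * \<epsilon> / 8)"
      by (intro avg_mono_AE i_f set_integral_add(1) i ic)
    also have "\<dots> = avg n (\<lambda>g. h (act g x)) + avg n (\<lambda>g. h (act g x')) + 3 * \<epsilon> / 8"
      by (simp add: avg_add avg_const set_integral_add(1) i ic)
    also have "\<dots> < \<epsilon>"
      using h_avg[OF that(1)] h_avg[OF that(2)] \<open>\<epsilon> > 0\<close> by simp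
    finally show ?thesis .
  qed
  moreover have "measure \<mu> Q > 1 - \<tau>" using Q(3) S by linarith
  ultimately show ?thesis using Q(1) \<delta>(1) by (intro exI[of _ Q] conjI exI[of _ \<delta>]) auto
qed

text \<open>The complements are allotted \<open>\<tau> / 4 * (1/2)^k\<close>, in sum
  \<open>\<tau> / 2\<close>. Equicontinuity statements are inherited by subsets with the same
  \<open>\<delta>\<close>, which is what \<open>mono\<close> asks.\<close>

lemma compact_countable_intersection:
  assumes ex: "\<And>k \<tau>. \<tau> > 0 \<Longrightarrow> \<exists>Q. compact Q \<and> measure \<mu> Q > 1 - \<tau> \<and> R (k::nat) Q"
    and mono: "\<And>k Q Q'. R k Q \<Longrightarrow> Q' \<subseteq> Q \<Longrightarrow> R k Q'"
    and "\<tau> > 0"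
  shows "\<exists>Q. compact Q \<and> measure \<mu> Q > 1 - \<tau> \<and> (\<forall>k. R k Q)"
proof -
  have "\<forall>k. \<exists>Q. compact Q \<and> measure \<mu> Q > 1 - \<tau> / 4 * (1/2)^k \<and> R k Q"
    using \<open>\<tau> > 0\<close> by (intro allI ex) simp
  then obtain Q where Q: "\<And>k. compact (Q k)" "\<And>k. measure \<mu> (Q k) > 1 - \<tau> / 4 * (1/2)^k" "\<And>k. R k (Q k)"
    by metis
  have closed: "closed (Q k)" for k by (rule compact_imp_closed[OF Q(1)])
  have sets: "Q k \<in> sets \<mu>" for k by (simp add: closed)
  have c: "measure \<mu> (- Q k) \<le> \<tau> / 4 * (1/2)^k" for k
    using mu.finite_measure_compl[OF sets[of k]] Q(2)[of k] by (simp add: Compl_eq_Diff_UNIV)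
  have sm: "summable (\<lambda>k. \<tau> / 4 * (1/2::real)^k)" by (intro summable_mult summable_geometric) auto
  have smm: "summable (\<lambda>k. measure \<mu> (- Q k))"
    by (rule summable_comparison_test'[OF sm, of 0]) (use c in simp)
  have "measure \<mu> (\<Union>k. - Q k) \<le> (\<Sum>k. measure \<mu> (- Q k))"
    using sets smm by (intro mu.finite_measure_subadditive_countably) (auto simp: image_subset_iff closed)
  also have "\<dots> \<le> (\<Sum>k. \<tau> / 4 * (1/2)^k)" by (intro suminf_le smm sm c)
  also have "\<dots> = \<tau> / 2" by (subst suminf_mult) (auto simp: suminf_geometric)
  finally have U: "measure \<mu> (\<Union>k. - Q k) \<le> \<tau> / 2" .
  have "measure \<mu> (\<Inter>k. Q k) = 1 - measure \<mu> (\<Union>k. - Q k)"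
    using mu.finite_measure_compl[of "\<Inter>k. Q k"] sets closed by (simp add: Compl_eq_Diff_UNIV[symmetric] closed_INT)
  then have "measure \<mu> (\<Inter>k. Q k) > 1 - \<tau>" using U \<open>\<tau> > 0\<close> by linarith
  moreover have "compact (\<Inter>k. Q k)"
    using compact_Int_closed[OF compact_X, of "\<Inter>k. Q k"] closed by (simp add: closed_INT)
  moreover have "R k (\<Inter>k. Q k)" for k by (rule mono[OF Q(3)]) auto
  ultimately show ?thesis by blast
qed

text \<open>Stronger than density: \<open>N\<close> does not depend on \<open>x\<close>, so at each
  scale finitely many distance functions suffice.\<close>

lemma dense_sequence:
  obtains a :: "nat \<Rightarrow> 'x" where "\<And>e. e > 0 \<Longrightarrow> \<exists>N. \<forall>x. \<exists>i<N. dist x (a i) < e"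
proof -
  have "\<exists>A :: 'x set. finite A \<and> (\<forall>x. \<exists>y\<in>A. dist x y < inverse (real (Suc n)))" for n
  proof (rule finite_measurable_net[OF compact_X, of "inverse (real (Suc n))"])
    fix p :: "'x \<Rightarrow> 'x" assume "finite (range p)" "\<And>x. x \<in> UNIV \<Longrightarrow> dist x (p x) < inverse (real (Suc n))"
    then show ?thesis by (intro exI[of _ "range p"] conjI allI bexI[of _ "p _"]) simp_all
  qed simp_all
  then obtain A :: "nat \<Rightarrow> 'x set" where A: "\<And>n. finite (A n)" "\<And>n x. \<exists>y\<in>A n. dist x y < inverse (real (Suc n))"
    by metis
  define D where "D = (\<Union>n. A n)"
  have "countable D" unfolding D_def using A(1) by (simp add: countable_finite)
  moreover have "D \<noteq> {}" unfolding D_def using A(2) by blast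
  ultimately have D: "range (from_nat_into D) = D" by (simp add: range_from_nat_into)
  have "\<exists>N. \<forall>x. \<exists>i<N. dist x (from_nat_into D i) < e" if "e > 0" for e
  proof -
    obtain n where n: "inverse (real (Suc n)) < e" using reals_Archimedean[OF \<open>e > 0\<close>] by blast
    have sub: "A n \<subseteq> range (from_nat_into D)" unfolding D unfolding D_def by (rule UN_upper) simp
    obtain I where I: "finite I" "A n = from_nat_into D ` I"
      using finite_subset_image[OF A(1) sub] by (elim exE conjE) (rule that)
    have "\<exists>i<Suc (Max I). dist x (from_nat_into D i) < e" for x
    proof -
      obtain i where "i \<in> I" "dist x (from_nat_into D i) < inverse (real (Suc n))"
        using A(2)[of n x] unfolding I(2) by (elim bexE imageE) (auto intro: that)
      then show ?thesis using n Max_ge[OF I(1)] by (intro exI[of _ i]) (auto simp: less_Suc_eq_le)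
    qed
    then show ?thesis by blast
  qed
  then show ?thesis by (rule that)
qed

text \<open>Distances to finitely many net points determine the distance of two points up to a small
  error. Each pair of a net point and a tolerance has its own compact set; there are countably many
  pairs, so a common set exists.\<close>

theorem discrete_spectrum_imp_equicontinuous_in_mean:
  assumes ds: "discrete_spectrum act \<mu>" and tempered: "tempered m F"
  shows "equicontinuous_in_mean_measure act m F \<mu>"
  unfolding equicontinuous_in_mean_measure_def
proof (intro allI impI)
  fix \<tau> :: real assume "\<tau> > 0"
  obtain a :: "nat \<Rightarrow> 'x" where a: "\<And>e. e > 0 \<Longrightarrow> \<exists>N. \<forall>x. \<exists>i<N. dist x (a i) < e"
    by (rule dense_sequence, rule that)
  \<comment> \<open>The number \<open>k\<close> encodes a pair: the index of a point of the
    sequence, and \<open>j\<close> for the tolerance \<open>inverse (real (Suc j))\<close>.\<close>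
  define R where "R k Q \<longleftrightarrow> (\<exists>\<delta>>0. \<forall>x\<in>Q. \<forall>y\<in>Q. dist x y < \<delta> \<longrightarrow>
    (\<forall>n. avg n (\<lambda>g. \<bar>dist (act g x) (a (fst (prod_decode k))) - dist (act g y) (a (fst (prod_decode k)))\<bar>)
      < inverse (real (Suc (snd (prod_decode k))))))" for k Q
  have "\<exists>Q. compact Q \<and> measure \<mu> Q > 1 - \<tau> \<and> (\<forall>k. R k Q)"
  proof (rule compact_countable_intersection[OF _ _ \<open>\<tau> > 0\<close>])
    fix k and \<tau> :: real assume "\<tau> > 0"
    show "\<exists>Q. compact Q \<and> measure \<mu> Q > 1 - \<tau> \<and> R k Q"
      unfolding R_def
      by (rule orbit_average_small[OF ds tempered, of "\<lambda>x. dist x (a (fst (prod_decode k)))"])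
        (use \<open>\<tau> > 0\<close> in \<open>auto intro!: continuous_intros\<close>)
  next
    fix k Q Q' assume "R k Q" "Q' \<subseteq> Q"
    then show "R k Q'" unfolding R_def by (meson subsetD)
  qed
  then obtain Q where Q: "compact Q" "measure \<mu> Q > 1 - \<tau>" "\<And>k. R k Q" by blast
  have "equicontinuous_in_mean_on act m F Q"
    unfolding equicontinuous_in_mean_on_def
  proof (intro allI impI)
    fix \<epsilon> :: real assume \<epsilon>: "\<epsilon> > 0"
    obtain N where N: "\<And>x. \<exists>i<N. dist x (a i) < \<epsilon> / 8" using a[of "\<epsilon> / 8"] \<epsilon> by auto
    have N0: "N > 0" using N[of undefined] by auto
    \<comment> \<open>\<open>N\<close> terms of size \<open>l\<close> add up to
      \<open>\<epsilon> / 2\<close>; the net error contributes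
      \<open>\<epsilon> / 4\<close>.\<close>
    define l where "l = \<epsilon> / (2 * real N)"
    have "l > 0" using \<epsilon> N0 by (simp add: l_def)
    then obtain j where j: "inverse (real (Suc j)) < l" using reals_Archimedean by blast
    have "\<exists>\<delta>>0. \<forall>x\<in>Q. \<forall>y\<in>Q. dist x y < \<delta> \<longrightarrow>
        (\<forall>n. avg n (\<lambda>g. \<bar>dist (act g x) (a i) - dist (act g y) (a i)\<bar>) < inverse (real (Suc j)))" for i
      using Q(3)[of "prod_encode (i, j)"] by (simp add: R_def)
    then obtain \<delta> where \<delta>: "\<And>i. \<delta> i > 0" "\<And>i x y n. x \<in> Q \<Longrightarrow> y \<in> Q \<Longrightarrow> dist x y < \<delta> i \<Longrightarrow>
        avg n (\<lambda>g. \<bar>dist (act g x) (a i) - dist (act g y) (a i)\<bar>) < inverse (real (Suc j))"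
      by metis
    define \<delta>0 where "\<delta>0 = Min (\<delta> ` {..<N})"
    have \<delta>0: "\<delta>0 > 0" "\<And>i. i < N \<Longrightarrow> \<delta>0 \<le> \<delta> i"
    proof -
      have "\<delta> ` {..<N} \<noteq> {}" using N0 by auto
      then show "\<delta>0 > 0" unfolding \<delta>0_def using \<delta>(1) by (subst Min_gr_iff) auto
    qed (simp add: \<delta>0_def)
    obtain D where D: "D > 0" "\<And>x y :: 'x. dist x y \<le> D" using dist_bounded by blast
    have "mean_dist act m (F n) x y < \<epsilon>" if xy: "x \<in> Q" "y \<in> Q" "dist x y < \<delta>0" for x y n
    proof -
      let ?d = "\<lambda>i g. \<bar>dist (act g x) (a i) - dist (act g y) (a i)\<bar>"
      have id: "set_integrable m (F n) (?d i)" for i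
      proof (rule set_integrable_F[of _ D])
        show "\<bar>?d i g\<bar> \<le> D" for g
          using D(2)[of "act g x" "a i"] D(2)[of "act g y" "a i"] by (simp add: abs_le_iff) (smt (verit) zero_le_dist)
      qed measurable
      have ic: "set_integrable m (F n) (\<lambda>g. c)" for c :: real
        by (rule set_integrable_F[of _ "\<bar>c\<bar>"]) auto
      have i_s: "set_integrable m (F n) (\<lambda>g. \<Sum>i<N. ?d i g)"
        using id unfolding set_integrable_def scaleR_sum_right
        by (intro Bochner_Integration.integrable_sum)
      \<comment> \<open>The distance to a near net point is paid twice, once for each of the two
        points, up to the correction \<open>?d i g\<close>. The index \<open>i\<close> varies with
        \<open>g\<close>, hence the sum over all \<open>i < N\<close>.\<close>
      have pw: "dist (act g x) (act g y) \<le> \<epsilon> / 4 + (\<Sum>i<N. ?d i g)" for g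
      proof -
        obtain i where i: "i < N" "dist (act g x) (a i) < \<epsilon> / 8" using N by blast
        have "dist (act g x) (act g y) \<le> dist (act g x) (a i) + dist (act g y) (a i)"
          by (rule dist_triangle2)
        also have "\<dots> \<le> \<epsilon> / 4 + ?d i g" using i(2) by linarith
        also have "?d i g \<le> (\<Sum>i<N. ?d i g)" using i(1) by (intro member_le_sum) auto
        finally show ?thesis by simp
      qed
      have sum_avg: "avg n (\<lambda>g. \<Sum>i<N. ?d i g) = (\<Sum>i<N. avg n (?d i))"
        using id unfolding avg_def set_lebesgue_integral_def set_integrable_def scaleR_sum_right
        by (subst Bochner_Integration.integral_sum) (simp_all only: sum_distrib_left)
      have "mean_dist act m (F n) x y \<le> avg n (\<lambda>g. \<epsilon> / 4 + (\<Sum>i<N. ?d i g))"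
        unfolding mean_dist_eq
      proof (intro avg_mono_AE set_integral_add(1) ic i_s)
        show "set_integrable m (F n) (\<lambda>g. dist (act g x) (act g y))"
          by (rule set_integrable_F[of _ D]) (use D in auto)
      qed (use pw in simp)
      also have "\<dots> = \<epsilon> / 4 + (\<Sum>i<N. avg n (?d i))"
        by (simp add: avg_add[OF ic i_s] avg_const sum_avg)
      also have "(\<Sum>i<N. avg n (?d i)) \<le> (\<Sum>i<N. l)"
      proof (rule sum_mono)
        fix i assume "i \<in> {..<N}"
        then have "avg n (?d i) < inverse (real (Suc j))"
          using \<delta>0(2)[of i] xy by (intro \<delta>(2)) auto
        then show "avg n (?d i) \<le> l" using j by simp
      qed
      also have "(\<Sum>i<N. l) = \<epsilon> / 2" using N0 by (simp add: l_def)
      finally show ?thesis using \<epsilon> by simp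
    qed
    then show "\<exists>\<delta>>0. \<forall>x\<in>Q. \<forall>y\<in>Q. dist x y < \<delta> \<longrightarrow> (\<forall>n. mean_dist act m (F n) x y < \<epsilon>)"
      using \<delta>0(1) by blast
  qed
  then show "\<exists>Q. compact Q \<and> 1 - \<tau> < measure \<mu> Q \<and> equicontinuous_in_mean_on act m F Q"
    using Q(1,2) by blast
qed

lemma equicontinuous_in_mean_imp_mean_equicontinuous:
  assumes "equicontinuous_in_mean_measure act m F \<mu>"
  shows "mean_equicontinuous_measure act m F \<mu>"
proof -
  have "mean_equicontinuous_on act m F Q" if Q: "equicontinuous_in_mean_on act m F Q" for Q
    unfolding mean_equicontinuous_on_def
  proof (intro allI impI)
    fix \<epsilon> :: real assume \<epsilon>: "\<epsilon> > 0"
    \<comment> \<open>A strict bound for every \<open>n\<close> is only a weak one for the limsup;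
      halving restores strictness.\<close>
    then have "\<epsilon> / 2 > 0" by simp
    with Q obtain \<delta> where \<delta>: "\<delta> > 0"
      "\<forall>x\<in>Q. \<forall>y\<in>Q. dist x y < \<delta> \<longrightarrow> (\<forall>n. mean_dist act m (F n) x y < \<epsilon> / 2)"
      unfolding equicontinuous_in_mean_on_def by blast
    have "limsup (\<lambda>n. ereal (mean_dist act m (F n) x y)) < ereal \<epsilon>"
      if "x \<in> Q" "y \<in> Q" "dist x y < \<delta>" for x y
    proof -
      have "limsup (\<lambda>n. ereal (mean_dist act m (F n) x y)) \<le> ereal (\<epsilon> / 2)"
        using \<delta>(2) that by (intro Limsup_bounded always_eventually allI) (auto simp: less_imp_le)
      also have "\<dots> < ereal \<epsilon>" using \<epsilon> by simp
      finally show ?thesis .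
    qed
    then show "\<exists>\<delta>>0. \<forall>x\<in>Q. \<forall>y\<in>Q. dist x y < \<delta> \<longrightarrow>
        limsup (\<lambda>n. ereal (mean_dist act m (F n) x y)) < ereal \<epsilon>"
      using \<delta>(1) by blast
  qed
  then show ?thesis
    using assms unfolding mean_equicontinuous_measure_def equicontinuous_in_mean_measure_def by blast
qed

end

theorem theorem1p3:
  fixes act :: "'g::{topological_group_add, t2_space} \<Rightarrow> 'x::metric_space \<Rightarrow> 'x"
    and m :: "'g measure"
    and F :: "nat \<Rightarrow> 'g set"
    and \<mu> :: "'x measure"
  assumes "locally_compact_space (euclidean :: 'g topology)"
    and "amenable_group TYPE('g)"
    and "left_haar_measure m"
    and "folner_sequence m F"
    and "tempered m F"
    and "measure_preserving_system act \<mu>"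
  shows "(discrete_spectrum act \<mu> \<longleftrightarrow> mean_equicontinuous_measure act m F \<mu>) \<and>
         (mean_equicontinuous_measure act m F \<mu> \<longleftrightarrow> equicontinuous_in_mean_measure act m F \<mu>)"
proof -
  interpret folner_system act m F \<mu>
    by (rule folner_system.intro) (use assms in auto)
  show ?thesis
    using mean_equicontinuous_imp_discrete_spectrum equicontinuous_in_mean_imp_mean_equicontinuous
      discrete_spectrum_imp_equicontinuous_in_mean[OF _ assms(5)] by blast
qed

end
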